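(* Let $\Omega\subseteq\mathbb{R}^3$ be a bounded domain and let $j:\mathbb{R}^3\to[0,+\infty]$ be a Borel-measurable kernel such that (i) $j(-z)=j(z)$ for all $z\in\mathbb{R}^3$; (ii) $\int_{\mathbb{R}^3}\min\{1,|z|^2\}\,j(z)\,dz<+\infty$; (iii) $j\notin L^1(B_R)$ for every $R>0$. Then the micromagnetic energy $$\mathcal E_\Omega(m):=\iint_{\Omega\times\Omega}j(x-y)|m(x)-m(y)|^2\,dx\,dy-\int_\Omega h_d[m](x)\cdot m(x)\,dx$$ admits a minimizer in $\mathcal X^j(\Omega;\mathbb{S}^2)$.
   Context: $B_R$ is the ball of radius $R$ centered at the origin. $\mathbb{S}^2$ is the unit sphere of $\mathbb{R}^3$, $L^2(\Omega;\mathbb{S}^2):=\{m\in L^2(\Omega;\mathbb{R}^3):|m|=1\text{ a.e. in }\Omega\}$, and $$\mathcal X^j(\Omega;\mathbb{S}^2):=\Big\{m\in L^2(\Omega;\mathbb{S}^2):\iint_{\Omega\times\Omega}j(x-y)|m(x)-m(y)|^2\,dx\,dy<+\infty\Big\}.$$ For $m\in L^2(\Omega;\mathbb{R}^3)$, the demagnetizing field $h_d[m]\in L^2(\mathbb{R}^3;\mathbb{R}^3)$ is the unique $L^2(\mathbb{R}^3;\mathbb{R}^3)$ solution (in the sense of distributions) of $$\operatorname{div}(m\chi_\Omega+h_d[m])=0,\qquad \operatorname{curl}h_d[m]=0\qquad\text{in }\mathbb{R}^3,$$ where $m\chi_\Omega$ is the extension of $m$ by zero outside $\Omega$. *)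

theory Defs
  imports "HOL-Analysis.Analysis"
begin

text \<open>Elements of \<open>L\<^sup>2\<close> are represented by Lebesgue measurable functions on the
  whole space whose values outside \<open>\<Omega>\<close> are irrelevant; functions that agree almost everywhere
  are not identified, and all notions below depend only on the class.\<close>

definition L2_on :: "(real^3) set \<Rightarrow> (real^3 \<Rightarrow> real^3) set" where
  "L2_on \<Omega> = {m \<in> borel_measurable (lebesgue_on \<Omega>).
     integrable (lebesgue_on \<Omega>) (\<lambda>x. (norm (m x))\<^sup>2)}"

definition L2_sphere :: "(real^3) set \<Rightarrow> (real^3 \<Rightarrow> real^3) set" where
  "L2_sphere \<Omega> = {m \<in> L2_on \<Omega>. AE x in lebesgue_on \<Omega>. m x \<in> sphere 0 1}"

definition exchange_energy ::
    "(real^3) set \<Rightarrow> (real^3 \<Rightarrow> ennreal) \<Rightarrow> (real^3 \<Rightarrow> real^3) \<Rightarrow> ennreal" where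
  "exchange_energy \<Omega> j m =
     (\<integral>\<^sup>+ (x, y). j (x - y) * ennreal ((norm (m x - m y))\<^sup>2)
        \<partial>(lebesgue_on \<Omega> \<Otimes>\<^sub>M lebesgue_on \<Omega>))"

definition X_space :: "(real^3) set \<Rightarrow> (real^3 \<Rightarrow> ennreal) \<Rightarrow> (real^3 \<Rightarrow> real^3) set" where
  "X_space \<Omega> j = {m \<in> L2_sphere \<Omega>. exchange_energy \<Omega> j m < \<infinity>}"

fun C_k :: "nat \<Rightarrow> (real^3 \<Rightarrow> real) \<Rightarrow> bool" where
  "C_k 0 f \<longleftrightarrow> continuous_on UNIV f"
| "C_k (Suc k) f \<longleftrightarrow> (\<forall>x. f differentiable (at x)) \<and>
     (\<forall>v. C_k k (\<lambda>x. frechet_derivative f (at x) v))"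

definition test_fun :: "(real^3 \<Rightarrow> real) \<Rightarrow> bool" where
  "test_fun \<phi> \<longleftrightarrow> (\<forall>k. C_k k \<phi>) \<and> compact (closure {x. \<phi> x \<noteq> 0})"

definition grad :: "(real^3 \<Rightarrow> real) \<Rightarrow> real^3 \<Rightarrow> real^3" where
  "grad \<phi> x = (\<chi> i. frechet_derivative \<phi> (at x) (axis i 1))"

text \<open>The action of the distributions \<open>div u\<close> and \<open>curl u\<close> on a test function, obtained by
  moving the derivatives in \<open>\<nabla> \<bullet> u\<close> and \<open>\<nabla> \<times> u\<close> onto the test function; the curl is tested
  componentwise, against a scalar test function, which gives a vector.\<close>

definition distr_div :: "(real^3 \<Rightarrow> real^3) \<Rightarrow> (real^3 \<Rightarrow> real) \<Rightarrow> real" where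
  "distr_div u \<phi> = - (\<integral>x. grad \<phi> x \<bullet> u x \<partial>lebesgue)"

definition distr_curl :: "(real^3 \<Rightarrow> real^3) \<Rightarrow> (real^3 \<Rightarrow> real) \<Rightarrow> real^3" where
  "distr_curl u \<phi> = - (\<integral>x. cross3 (grad \<phi> x) (u x) \<partial>lebesgue)"

definition is_demag_field ::
    "(real^3) set \<Rightarrow> (real^3 \<Rightarrow> real^3) \<Rightarrow> (real^3 \<Rightarrow> real^3) \<Rightarrow> bool" where
  "is_demag_field \<Omega> m h \<longleftrightarrow> h \<in> L2_on UNIV \<and>
     (\<forall>\<phi>. test_fun \<phi> \<longrightarrow> distr_div (\<lambda>x. indicat_real \<Omega> x *\<^sub>R m x + h x) \<phi> = 0) \<and>
     (\<forall>\<phi>. test_fun \<phi> \<longrightarrow> distr_curl h \<phi> = 0)"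

text \<open>The demagnetizing field is unique only up to equality almost everywhere, so Hilbert choice
  merely picks a representative of its class.\<close>

definition demag_field :: "(real^3) set \<Rightarrow> (real^3 \<Rightarrow> real^3) \<Rightarrow> real^3 \<Rightarrow> real^3" where
  "demag_field \<Omega> m = (SOME h. is_demag_field \<Omega> m h)"

text \<open>The first term may be infinite, the second is real; hence the value in \<open>ereal\<close>.\<close>

definition micromag_energy ::
    "(real^3) set \<Rightarrow> (real^3 \<Rightarrow> ennreal) \<Rightarrow> (real^3 \<Rightarrow> real^3) \<Rightarrow> ereal" where
  "micromag_energy \<Omega> j m =
     enn2ereal (exchange_energy \<Omega> j m) -
     ereal (\<integral>x. demag_field \<Omega> m x \<bullet> m x \<partial>lebesgue_on \<Omega>)"

end

theory Submission
  imports Defs "HOL-Library.Diagonal_Subsequence"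
begin

text \<open>Direct method. A minimizing sequence has bounded exchange energy; since \<open>j\<close> is not integrable
  near the origin, such a sequence is precompact in \<open>L\<^sup>2(\<Omega>)\<close>, so a subsequence converges almost
  everywhere and the constraint \<open>|m| = 1\<close> passes to the limit. The exchange energy is lower
  semicontinuous by Fatou's lemma. The field \<open>h\<^sub>d[m]\<close> is minus the \<open>L\<^sup>2\<close> projection of \<open>m \<chi>\<^sub>\<Omega>\<close> onto
  the closure of the gradients of test functions (uniqueness is Liouville's theorem for weakly
  harmonic \<open>L\<^sup>2\<close> functions), whence \<open>- \<integral> h\<^sub>d[m] \<bullet> m = \<parallel>h\<^sub>d[m]\<parallel>\<^sup>2\<close> is the supremum over test functions
  \<open>\<psi>\<close> of the functionals \<open>- 2 \<integral> \<nabla>\<psi> \<bullet> m \<chi>\<^sub>\<Omega> - \<integral> |\<nabla>\<psi>|\<^sup>2\<close>, which are continuous along the subsequence.\<close>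

subsection \<open>Extraction of subsequences\<close>

text \<open>\<open>j\<close> is merely a Borel function, with no lower bound by a power of
  \<open>norm z\<close>, so no fractional Sobolev embedding applies. Compactness has to come from
  the single fact that truncations of \<open>j\<close> carry arbitrarily large mass near the origin;
  weak compactness takes care of the cross term that separates the exchange energy from the L^2
  norm.

  Uniqueness of the field is essential: \<open>demag_field\<close> is picked by \<open>SOME\<close>,
  and only uniqueness shows that the picked field is a limit of gradients. Liouville's theorem is
  obtained without Fourier transform and without means over spheres: for the integrals against
  \<open>bump 2 (1 - s * ((x - a) \<bullet> (x - a)))\<close>, harmonicity becomes an ordinary
  differential equation in the scale \<open>s\<close>, and square integrability excludes its nonzero
  solutions.

  Elements of L^2 are functions here, not classes, so the minimizing sequence is changed on null
  sets until the constraint and the convergence hold at every point.\<close>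

lemma L2_Cauchy_AE_convergent_subseq:
  fixes f :: "nat \<Rightarrow> 'a \<Rightarrow> 'b::{banach, second_countable_topology}"
  assumes [measurable]: "\<And>n. f n \<in> borel_measurable M"
    and Cauchy: "\<And>e. e > 0 \<Longrightarrow>
      \<exists>N. \<forall>m\<ge>N. \<forall>n\<ge>N. (\<integral>\<^sup>+x. ennreal ((norm (f m x - f n x))\<^sup>2) \<partial>M) \<le> ennreal e"
  obtains r :: "nat \<Rightarrow> nat"
    where "strict_mono r" "AE x in M. convergent (\<lambda>k. f (r k) x)"
proof -
  \<comment> \<open>The rate \<open>1/8\<close> leaves room for the weight \<open>4^k\<close>: the
    weighted integrals are still at most \<open>(1/2)^k\<close>, and finiteness of the weighted
    series at a point gives \<open>norm (d k x) \<le> sqrt c * (1/2)^k\<close>, a summable bound on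
    the increments.\<close>
  have "\<forall>k::nat. \<exists>N. \<forall>m\<ge>N. \<forall>n\<ge>N.
      (\<integral>\<^sup>+x. ennreal ((norm (f m x - f n x))\<^sup>2) \<partial>M) \<le> ennreal ((1/8)^k)"
    by (intro allI Cauchy) simp
  then obtain N :: "nat \<Rightarrow> nat" where N: "\<And>k m n. m \<ge> N k \<Longrightarrow> n \<ge> N k \<Longrightarrow>
      (\<integral>\<^sup>+x. ennreal ((norm (f m x - f n x))\<^sup>2) \<partial>M) \<le> ennreal ((1/8)^k)"
    by metis
  \<comment> \<open>The summand \<open>k\<close> forces strict growth; the sum of the thresholds up
    to \<open>k\<close> gives \<open>r k \<ge> N k\<close>.\<close>
  define r where "r k = k + (\<Sum>i\<le>k. N i)" for k
  have r: "strict_mono r" unfolding strict_mono_Suc_iff by (simp add: r_def)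
  have rN: "r k \<ge> N k" for k
    unfolding r_def by (simp add: add_increasing member_le_sum)
  define d where "d k x = f (r (Suc k)) x - f (r k) x" for k x
  have [measurable]: "d k \<in> borel_measurable M" for k unfolding d_def by simp
  have d: "(\<integral>\<^sup>+x. ennreal (4^k * (norm (d k x))\<^sup>2) \<partial>M) \<le> ennreal ((1/2)^k)" for k
  proof -
    have "r (Suc k) \<ge> N k" using rN[of k] r by (meson le_trans lessI less_imp_le strict_mono_less_eq)
    then have "(\<integral>\<^sup>+x. ennreal ((norm (d k x))\<^sup>2) \<partial>M) \<le> ennreal ((1/8)^k)"
      unfolding d_def using N[OF _ rN] by simp
    then have "ennreal (4^k) * (\<integral>\<^sup>+x. ennreal ((norm (d k x))\<^sup>2) \<partial>M) \<le> ennreal (4^k) * ennreal ((1/8)^k)"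
      by (rule mult_left_mono) simp
    also have "\<dots> = ennreal ((1/2)^k)"
      by (simp flip: ennreal_mult power_mult_distrib)
    finally show ?thesis
      by (simp add: ennreal_mult nn_integral_cmult)
  qed
  have "(\<integral>\<^sup>+x. (\<Sum>k. ennreal (4^k * (norm (d k x))\<^sup>2)) \<partial>M) = (\<Sum>k. \<integral>\<^sup>+x. ennreal (4^k * (norm (d k x))\<^sup>2) \<partial>M)"
    by (rule nn_integral_suminf) simp
  also have "\<dots> \<le> (\<Sum>k. ennreal ((1/2)^k))"
    by (intro suminf_le d) auto
  also have "\<dots> = ennreal (\<Sum>k. (1/2)^k)"
    by (intro suminf_ennreal2 summable_geometric) auto
  finally have "(\<integral>\<^sup>+x. (\<Sum>k. ennreal (4^k * (norm (d k x))\<^sup>2)) \<partial>M) \<noteq> \<infinity>"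
    by (auto simp: top_unique)
  then have "AE x in M. (\<Sum>k. ennreal (4^k * (norm (d k x))\<^sup>2)) \<noteq> \<infinity>"
    by (intro nn_integral_noteq_infinite) auto
  then have "AE x in M. convergent (\<lambda>k. f (r k) x)"
  proof (rule AE_mp, intro AE_I2 impI)
    fix x assume x: "(\<Sum>k. ennreal (4^k * (norm (d k x))\<^sup>2)) \<noteq> \<infinity>"
    define c where "c = enn2real (\<Sum>k. ennreal (4^k * (norm (d k x))\<^sup>2))"
    have "norm (d k x) \<le> sqrt c * (1/2)^k" for k
    proof -
      have "(\<Sum>i\<in>{k}. ennreal (4^i * (norm (d i x))\<^sup>2)) \<le> (\<Sum>k. ennreal (4^k * (norm (d k x))\<^sup>2))"
        by (rule sum_le_suminf) auto
      then have "ennreal (4^k * (norm (d k x))\<^sup>2) \<le> ennreal c"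
        using x unfolding c_def by (simp add: less_top)
      then have le: "4^k * (norm (d k x))\<^sup>2 \<le> c"
        by (subst (asm) ennreal_le_iff) (auto simp: c_def)
      have "(2^k * norm (d k x))\<^sup>2 = 4^k * (norm (d k x))\<^sup>2"
        by (simp add: power_mult_distrib) (simp add: power2_eq_square flip: power_mult_distrib)
      with le have "2^k * norm (d k x) \<le> sqrt c" by (simp add: real_le_rsqrt)
      then show ?thesis by (simp add: field_simps)
    qed
    moreover have "summable (\<lambda>k. sqrt c * (1/2)^k)"
      by (rule summable_mult, rule summable_geometric) simp
    ultimately have "summable (\<lambda>k. d k x)"
      using summable_comparison_test'[of "\<lambda>k. sqrt c * (1/2)^k" 0 "\<lambda>k. d k x"] by blast
    then have "convergent (\<lambda>n. \<Sum>k<n. d k x)" by (simp add: summable_iff_convergent)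
    moreover have "(\<Sum>k<n. d k x) = f (r n) x - f (r 0) x" for n
      unfolding d_def by (rule sum_lessThan_telescope)
    ultimately have "convergent (\<lambda>n. (f (r n) x - f (r 0) x) + f (r 0) x)"
      by (intro convergent_add convergent_const) simp
    then show "convergent (\<lambda>k. f (r k) x)" by simp
  qed
  with r show thesis by (rule that)
qed

lemma bounded_family_convergent_subseq:
  fixes a :: "nat \<Rightarrow> nat \<Rightarrow> 'b::heine_borel"
  assumes "\<And>i. bounded (range (a i))"
  obtains r :: "nat \<Rightarrow> nat" where "strict_mono r" "\<And>i. convergent (\<lambda>k. a i (r k))"
proof -
  interpret subseqs "\<lambda>i s. convergent (\<lambda>k. a i (s k))"
  proof
    fix i and s :: "nat \<Rightarrow> nat" assume "strict_mono s"
    have "bounded (range (a i \<circ> s))" by (rule bounded_subset[OF assms[of i]]) auto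
    then obtain l r where "strict_mono r" "((a i \<circ> s) \<circ> r) \<longlonglongrightarrow> l"
      using bounded_imp_convergent_subsequence by blast
    then show "\<exists>r'. strict_mono r' \<and> convergent (\<lambda>k. a i ((s \<circ> r') k))"
      unfolding convergent_def comp_def by auto
  qed
  have "convergent (\<lambda>k. a i (diagseq k))" for i
  proof -
    \<comment> \<open>The diagonal sequence is a subsequence of the refinement for \<open>i\<close>
      only from index \<open>Suc i\<close> on; the earlier members do not affect
      convergence.\<close>
    have "convergent (\<lambda>k. a i ((diagseq \<circ> (+) (Suc i)) k))"
    proof (rule diagseq_holds)
      fix r s :: "nat \<Rightarrow> nat" and n assume "strict_mono r" "convergent (\<lambda>k. a n (s k))"
      then show "convergent (\<lambda>k. a n ((s \<circ> r) k))"
        using convergent_subseq_convergent[of "\<lambda>k. a n (s k)" r] by (simp add: comp_def)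
    qed
    then show ?thesis
      using convergent_ignore_initial_segment[of "\<lambda>k. a i (diagseq k)" "Suc i"]
      by (simp add: comp_def add.commute)
  qed
  with subseq_diagseq show thesis by (rule that)
qed

text \<open>Countability lets a diagonal argument treat all indicators of the generator at once;
  stability under intersection and membership of \<open>UNIV\<close> are what the Dynkin induction
  over Borel sets consumes. \<open>UNIV\<close> arises as the intersection of the empty
  family.\<close>

lemma borel_countable_Int_stable_generator:
  obtains G :: "'a::second_countable_topology set set"
  where "countable G" "Int_stable G" "UNIV \<in> G" "sets (borel :: 'a measure) = sigma_sets UNIV G"
proof -
  obtain B :: "'a set set" where B: "countable B" "topological_basis B"
    using ex_countable_basis by blast
  define G where "G = Inter ` {F. finite F \<and> F \<subseteq> B}"
  have "countable G" unfolding G_def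
    using countable_Collect_finite_subset[OF B(1)] by (intro countable_image) (simp add: conj_commute)
  moreover have "Int_stable G"
  proof (rule Int_stableI)
    fix a b assume "a \<in> G" "b \<in> G"
    then obtain F H where "a = \<Inter>F" "finite F" "F \<subseteq> B" "b = \<Inter>H" "finite H" "H \<subseteq> B"
      unfolding G_def by auto
    then show "a \<inter> b \<in> G" unfolding G_def by (intro image_eqI[of _ _ "F \<union> H"]) auto
  qed
  moreover have "UNIV \<in> G" unfolding G_def by (intro image_eqI[of _ _ "{}"]) auto
  moreover have "sets (borel :: 'a measure) = sigma_sets UNIV G"
  proof -
    have sB: "sets (borel :: 'a measure) = sigma_sets UNIV B"
      by (subst borel_eq_countable_basis[OF B]) (simp add: sets_measure_of)
    also have "\<dots> = sigma_sets UNIV G"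
    proof (rule sigma_sets_eqI)
      fix a assume "a \<in> B"
      then have "a \<in> G" unfolding G_def by (intro image_eqI[of _ _ "{a}"]) auto
      then show "a \<in> sigma_sets UNIV G" by auto
    next
      fix b assume "b \<in> G"
      then obtain F where F: "b = \<Inter>F" "finite F" "F \<subseteq> B" unfolding G_def by auto
      have "open b" unfolding F(1)
        using F B(2) by (intro open_Inter) (auto simp: topological_basis_open)
      then have "b \<in> sets borel" by simp
      then show "b \<in> sigma_sets UNIV B" using sB by simp
    qed
    finally show ?thesis .
  qed
  ultimately show thesis by (rule that)
qed

text \<open>Banach-Alaoglu for bounded fields acting on integrable weights \<open>g\<close>, done by
  hand: diagonalise over the indicators of a countable generator, then enlarge the class of
  admissible weights up to all integrable functions. The limit functional is never represented by a
  function; only convergence of the integrals is used later.\<close>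

lemma weakly_convergent_subseq:
  fixes u :: "nat \<Rightarrow> 'a::euclidean_space \<Rightarrow> 'b::euclidean_space"
  assumes S: "S \<in> lmeasurable"
    and u [measurable]: "\<And>n. u n \<in> borel_measurable (lebesgue_on S)"
    and ub: "\<And>n x. norm (u n x) \<le> 1"
  obtains r :: "nat \<Rightarrow> nat" where "strict_mono r"
    "\<And>g :: 'a \<Rightarrow> real. integrable (lebesgue_on S) g \<Longrightarrow>
       convergent (\<lambda>k. \<integral>x. g x *\<^sub>R u (r k) x \<partial>lebesgue_on S)"
proof -
  define M where "M = lebesgue_on S"
  interpret finite_measure M unfolding M_def by (rule finite_measure_lebesgue_on[OF S])
  have [measurable]: "u n \<in> borel_measurable M" for n unfolding M_def by simp
  have borelM [measurable]: "(indicator A :: 'a \<Rightarrow> real) \<in> borel_measurable M" if "A \<in> sets borel" for A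
    unfolding M_def using that by (intro measurable_restrict_space1 measurable_completion) auto
  obtain G :: "'a set set" where G: "countable G" "Int_stable G" "UNIV \<in> G"
      "sets (borel :: 'a measure) = sigma_sets UNIV G"
    by (rule borel_countable_Int_stable_generator)
  define I where "I g k = (\<integral>x. g x *\<^sub>R u k x \<partial>M)" for g :: "'a \<Rightarrow> real" and k
  have intg [simp, intro]: "integrable M (\<lambda>x. g x *\<^sub>R u k x)" if "integrable M g" for g :: "'a \<Rightarrow> real" and k
    using that by (rule Bochner_Integration.integrable_bound)
      (use that ub in \<open>auto intro!: AE_I2 mult_left_le\<close>)
  have Ib: "norm (I g k) \<le> (\<integral>x. \<bar>g x\<bar> \<partial>M)" if "integrable M g" for g k
    unfolding I_def
    by (rule order_trans[OF integral_norm_bound], rule integral_mono)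
      (use that ub integrable_norm[OF intg[OF that]] in \<open>auto intro!: mult_left_le\<close>)
  have indI: "integrable M (indicator A :: 'a \<Rightarrow> real)" if "A \<in> sets borel" for A
    using borelM[OF that] by (intro integrable_const_bound[of _ 1]) (auto simp: indicator_def)
  have bdd: "bounded (range (I (indicator A)))" if "A \<in> sets borel" for A
    unfolding bounded_iff using Ib[OF indI[OF that]] by auto
  have GB: "A \<in> sets borel" if "A \<in> G" for A using that G(4) by auto
  have "bounded (range (I (indicator (from_nat_into G i))))" for i
    using G(3) by (intro bdd GB from_nat_into) auto
  then obtain r :: "nat \<Rightarrow> nat" where r: "strict_mono r"
      "\<And>i. convergent (\<lambda>k. I (indicator (from_nat_into G i)) (r k))"
    using bounded_family_convergent_subseq[of "\<lambda>i. I (indicator (from_nat_into G i))"] by blast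
  define P where "P g \<longleftrightarrow> convergent (\<lambda>k. I g (r k))" for g
  have PG: "P (indicator A)" if "A \<in> G" for A
    using r(2)[of "to_nat_on G A"] that G(1) by (simp add: P_def)
  have Padd: "P (\<lambda>x. f x + g x)" if "P f" "P g" "integrable M f" "integrable M g" for f g
    using convergent_add[OF that(1,2)[unfolded P_def]] that(3,4)
    unfolding P_def I_def by (simp add: scaleR_add_left)
  have Pscale: "P (\<lambda>x. c * f x)" if "P f" "integrable M f" for c f
    using that bounded_linear.convergent[OF bounded_linear_scaleR_right, of "\<lambda>k. I f (r k)" c]
    unfolding P_def I_def by (simp flip: scaleR_scaleR)
  \<comment> \<open>Since \<open>norm (u k x) \<le> 1\<close>, replacing \<open>f\<close> by
    \<open>s i\<close> changes \<open>I\<close> by at most their L^1 distance, uniformly in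
    \<open>k\<close>; an \<open>e/3\<close> argument then carries convergence over to
    \<open>f\<close>.\<close>
  have Plim: "P f" if s: "\<And>i. P (s i)" "\<And>i. integrable M (s i)" and f: "integrable M f"
      and lim: "AE x in M. (\<lambda>i. s i x) \<longlonglongrightarrow> f x" and w: "integrable M w"
      and le: "\<And>i. AE x in M. \<bar>s i x - f x\<bar> \<le> w x" for s :: "nat \<Rightarrow> 'a \<Rightarrow> real" and f w
  proof -
    have lim0: "(\<lambda>i. \<integral>x. \<bar>s i x - f x\<bar> \<partial>M) \<longlonglongrightarrow> (\<integral>x. 0 \<partial>M)"
    proof (rule integral_dominated_convergence[where w=w])
      show "AE x in M. (\<lambda>i. \<bar>s i x - f x\<bar>) \<longlonglongrightarrow> 0"
        using lim by eventually_elim (simp add: LIM_zero tendsto_rabs_zero)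
    qed (use s f w le in auto)
    have "Cauchy (\<lambda>k. I f (r k))"
      unfolding Cauchy_def
    proof (intro allI impI)
      fix e :: real assume e: "e > 0"
      from lim0 e have "\<forall>\<^sub>F i in sequentially. (\<integral>x. \<bar>s i x - f x\<bar> \<partial>M) < e/3"
        by (intro order_tendstoD(2)) auto
      then obtain i where i: "(\<integral>x. \<bar>s i x - f x\<bar> \<partial>M) < e/3"
        by (auto simp: eventually_sequentially)
      from s(1)[of i] have "Cauchy (\<lambda>k. I (s i) (r k))"
        unfolding P_def by (rule convergent_Cauchy)
      with e obtain N where N: "\<And>m n. m \<ge> N \<Longrightarrow> n \<ge> N \<Longrightarrow> dist (I (s i) (r m)) (I (s i) (r n)) < e/3"
        unfolding Cauchy_def by (metis divide_pos_pos zero_less_numeral)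
      have d: "dist (I (s i) k) (I f k) < e/3" for k
      proof -
        have "I (s i) k - I f k = I (\<lambda>x. s i x - f x) k"
          unfolding I_def using s(2) f by (simp add: scaleR_diff_left)
        then show ?thesis
          using Ib[of "\<lambda>x. s i x - f x" k] i s(2) f by (simp add: dist_norm)
      qed
      show "\<exists>N. \<forall>m\<ge>N. \<forall>n\<ge>N. dist (I f (r m)) (I f (r n)) < e"
      proof (intro exI allI impI)
        fix m n assume "N \<le> m" "N \<le> n"
        from N[OF this] d[of "r m"] d[of "r n"] show "dist (I f (r m)) (I f (r n)) < e"
          using dist_triangle[of "I f (r m)" "I f (r n)" "I (s i) (r m)"]
            dist_triangle[of "I (s i) (r m)" "I f (r n)" "I (s i) (r n)"]
          by (simp add: dist_commute)
      qed
    qed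
    then show ?thesis unfolding P_def by (simp add: Cauchy_convergent_iff)
  qed
  have Pborel: "P (indicator A)" if "A \<in> sets borel" for A
  proof -
    have "A \<in> sigma_sets UNIV G" using that G(4) by simp
    from G(2) subset_UNIV[of G, folded Pow_UNIV] this show ?thesis
    proof (induction rule: sigma_sets_induct_disjoint)
      case (basic A)
      then show ?case by (rule PG)
    next
      case empty
      then show ?case by (simp add: P_def I_def convergent_const)
    next
      case (compl A)
      then have A: "A \<in> sets borel" using G(4) by simp
      \<comment> \<open>The complement is \<open>UNIV\<close> minus \<open>A\<close>; this is where
        \<open>UNIV \<in> G\<close> enters.\<close>
      have "P (\<lambda>x. indicator UNIV x + (-1) * indicator A x)"
        by (rule Padd[OF PG[OF G(3)] Pscale[OF compl(2)]])
          (auto intro!: indI A)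
      moreover have "(\<lambda>x. indicator UNIV x + (-1) * indicator A x) = (indicator (UNIV - A) :: 'a \<Rightarrow> real)"
        by (auto simp: indicator_def)
      ultimately show ?case by simp
    next
      case (union A)
      then have A: "A i \<in> sets borel" for i using G(4) by auto
      have Ps: "P (\<lambda>x. \<Sum>i<n. indicator (A i) x)" for n
      proof (induction n)
        case 0
        then show ?case by (simp add: P_def I_def convergent_const)
      next
        case (Suc n)
        have "P (\<lambda>x. (\<Sum>i<n. indicator (A i) x) + indicator (A n) x)"
          by (intro Padd Suc union Bochner_Integration.integrable_sum indI A)
        then show ?case by simp
      qed
      have eq: "(\<Sum>i<n. indicator (A i) x) = (indicator (\<Union>i<n. A i) x :: real)" for n x
        by (subst indicator_UN_disjoint) (use union(1) in \<open>auto simp: disjoint_family_on_def\<close>)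
      show ?case
      proof (rule Plim[where s="\<lambda>n x. \<Sum>i<n. indicator (A i) x" and w="\<lambda>_. 1"])
        show "AE x in M. (\<lambda>n. \<Sum>i<n. indicator (A i) x :: real) \<longlonglongrightarrow> indicator (\<Union> (range A)) x"
          unfolding eq by (intro AE_I2 LIMSEQ_indicator_UN)
        show "AE x in M. \<bar>(\<Sum>i<n. indicator (A i) x) - indicator (\<Union> (range A)) x\<bar> \<le> (1::real)" for n
          unfolding eq by (auto simp: indicator_def)
      qed (auto intro!: Ps indI A Bochner_Integration.integrable_sum sets.countable_UN)
    qed
  qed
  have Pleb: "P (indicator A)" if A: "A \<in> sets M" for A
  proof -
    from A obtain A' where A': "A' \<in> sets lebesgue" "A = A' \<inter> S"
      unfolding M_def by (auto simp: sets_restrict_space)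
    have "A \<in> sets lebesgue" using A' S by auto
    then obtain C N N' where C: "A = C \<union> N" "N \<subseteq> N'" "N' \<in> null_sets lborel" "C \<in> sets lborel"
      by (rule sets_completionE)
    have "AE x in lebesgue. x \<notin> N'" using C(3)
      by (intro AE_completion AE_not_in)
    then have ae: "AE x in M. x \<notin> N'" unfolding M_def
      by (subst AE_restrict_space_iff) (use S in auto)
    \<comment> \<open>A constant sequence and the zero majorant: here \<open>Plim\<close> serves
      only to pass from the Borel set \<open>C\<close> to \<open>A\<close>, which differs from it
      inside a null set.\<close>
    show ?thesis
    proof (rule Plim[where s="\<lambda>_. indicator C" and w="\<lambda>_. 0"])
      show "AE x in M. (\<lambda>i. indicator C x) \<longlonglongrightarrow> (indicator A x :: real)"
        using ae by eventually_elim (use C(1,2) in \<open>auto simp: indicator_def\<close>)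
      show "AE x in M. \<bar>indicator C x - indicator A x\<bar> \<le> (0::real)"
        using ae by eventually_elim (use C(1,2) in \<open>auto simp: indicator_def\<close>)
      show "integrable M (indicator A :: 'a \<Rightarrow> real)"
        using A by (intro integrable_const_bound[of _ 1]) auto
    qed (use C(4) in \<open>auto intro!: Pborel indI\<close>)
  qed
  have "P g" if "integrable M g" for g
    using that
  proof (induction rule: integrable_induct)
    case (base A c)
    then have "P (\<lambda>x. c * indicator A x)"
      by (intro Pscale Pleb) (auto intro!: integrable_const_bound[of _ 1])
    then show ?case by (simp add: mult.commute)
  next
    case (add f g)
    then show ?case by (intro Padd)
  next
    case (lim f s)
    show ?case
    proof (rule Plim[of s _ "\<lambda>x. 3 * \<bar>f x\<bar>"])
      \<comment> \<open>The approximants satisfy \<open>norm (s i x) \<le> 2 * norm (f x)\<close>,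
        whence the factor 3.\<close>
      have "\<bar>s i x - f x\<bar> \<le> 3 * \<bar>f x\<bar>" if "x \<in> space M" for i x
      proof -
        have "norm (s i x) \<le> 2 * norm (f x)" using lim that by blast
        then show ?thesis using abs_triangle_ineq4[of "s i x" "f x"] by simp
      qed
      then show "AE x in M. \<bar>s i x - f x\<bar> \<le> 3 * \<bar>f x\<bar>" for i by (intro AE_I2)
    qed (use lim in auto)
  qed
  then show thesis
    using that[OF r(1)] unfolding P_def I_def M_def by blast
qed

subsection \<open>Compactness from a non-integrable kernel\<close>

lemma measurable_id_lebesgue_on:
  "(\<lambda>x. x) \<in> borel_measurable (lebesgue_on S)"
  by (intro measurable_restrict_space1 measurable_completion) auto

lemma nn_integral_lebesgue_reflect_translate:
  fixes f :: "'a::euclidean_space \<Rightarrow> ennreal"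
  assumes [measurable]: "f \<in> borel_measurable borel"
  shows "(\<integral>\<^sup>+y. f (x - y) \<partial>lebesgue) = (\<integral>\<^sup>+y. f y \<partial>lebesgue)"
proof -
  have "(\<integral>\<^sup>+y. f y \<partial>lborel) = (\<integral>\<^sup>+y. f y \<partial>density (distr lborel borel (\<lambda>y. x + (-1) *\<^sub>R y)) (\<lambda>_. ennreal (\<bar>-1\<bar>^DIM('a))))"
    by (subst lborel_affine[of "-1" x]) simp_all
  also have "\<dots> = (\<integral>\<^sup>+y. f (x - y) \<partial>lborel)"
    by (simp add: density_1 nn_integral_distr)
  finally show ?thesis by (simp add: nn_integral_completion)
qed

text \<open>Monotone convergence of \<open>min (j z) (of_nat n)\<close>. A truncation is bounded, as
  compactness of the convolution requires, and yet its mass can be made to exceed any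
  \<open>B\<close>. Since truncated values are finite, \<open>enn2real\<close> loses
  nothing.\<close>

lemma nn_integral_truncated_kernel_unbounded:
  fixes j :: "'a::euclidean_space \<Rightarrow> ennreal"
  assumes [measurable]: "j \<in> borel_measurable borel"
    and inf: "(\<integral>\<^sup>+z\<in>ball 0 R. j z \<partial>lebesgue) = \<infinity>"
  obtains n :: nat
  where "(\<integral>\<^sup>+z. ennreal (enn2real (min (j z) (of_nat n)) * indicator (ball 0 R) z) \<partial>lebesgue) \<ge> ennreal B"
proof -
  have eq: "ennreal (enn2real (min (j z) (of_nat n)) * indicator (ball 0 R) z) = min (j z) (of_nat n) * indicator (ball 0 R) z" for n z
    by (auto simp: indicator_def min_def less_top[symmetric] ennreal_enn2real_if of_nat_less_top top_unique
        ennreal_of_nat_eq_real_of_nat)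
  have sup: "(SUP n. min a (of_nat n)) = (a::ennreal)" for a
    using inf_SUP[of a "of_nat :: nat \<Rightarrow> ennreal" UNIV]
    by (simp add: inf_min ennreal_SUP_of_nat_eq_top min_def)
  have [measurable]: "ball 0 R \<in> sets (borel :: 'a measure)" by simp
  have [measurable]: "(\<lambda>z. min (j z) (of_nat n) * indicator (ball 0 R) z) \<in> borel_measurable borel" for n
    by measurable
  have "(SUP n. \<integral>\<^sup>+z. min (j z) (of_nat n) * indicator (ball 0 R) z \<partial>lebesgue)
      = (\<integral>\<^sup>+z. (SUP n. min (j z) (of_nat n) * indicator (ball 0 R) z) \<partial>lebesgue)"
  proof (rule nn_integral_monotone_convergence_SUP[symmetric])
    show "incseq (\<lambda>n z. min (j z) (of_nat n) * indicator (ball 0 R) z)"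
      by (auto simp: incseq_def le_fun_def indicator_def intro: min.coboundedI2)
  qed (auto intro!: measurable_completion)
  also have "\<dots> = (\<integral>\<^sup>+z\<in>ball 0 R. j z \<partial>lebesgue)"
    by (intro nn_integral_cong) (simp add: sup indicator_def)
  finally have "(SUP n. \<integral>\<^sup>+z. min (j z) (of_nat n) * indicator (ball 0 R) z \<partial>lebesgue) = top"
    using inf by simp
  then have "ennreal B < (SUP n. \<integral>\<^sup>+z. min (j z) (of_nat n) * indicator (ball 0 R) z \<partial>lebesgue)"
    by (simp only: ennreal_less_top)
  then obtain n where "ennreal B < (\<integral>\<^sup>+z. min (j z) (of_nat n) * indicator (ball 0 R) z \<partial>lebesgue)"
    unfolding less_SUP_iff by auto
  then show thesis using that[of n] unfolding eq by simp
qed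

text \<open>Convolution with a bounded kernel turns weak convergence into pointwise convergence,
  because \<open>k (x - y)\<close> as a function of \<open>y\<close> is an admissible weight for
  each \<open>x\<close>; on a set of finite measure the uniform bound upgrades this to L^1
  convergence of \<open>T i\<close>. The quadratic form of a difference is at most twice the L^1
  distance of \<open>T i\<close> and \<open>T l\<close>. Smallness from above is all that the
  compactness argument asks for.\<close>

lemma compact_kernel_L2_Cauchy:
  fixes w :: "nat \<Rightarrow> 'a::euclidean_space \<Rightarrow> 'b::euclidean_space" and k :: "'a \<Rightarrow> real"
  assumes S: "S \<in> lmeasurable"
    and w [measurable]: "\<And>n. w n \<in> borel_measurable (lebesgue_on S)"
    and wb: "\<And>n x. norm (w n x) \<le> 1"
    and weak: "\<And>g :: 'a \<Rightarrow> real. integrable (lebesgue_on S) g \<Longrightarrow>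
       convergent (\<lambda>i. \<integral>x. g x *\<^sub>R w i x \<partial>lebesgue_on S)"
    and k [measurable]: "k \<in> borel_measurable borel" and kb: "\<And>z. \<bar>k z\<bar> \<le> B"
    and e: "e > 0"
  shows "\<exists>N. \<forall>i\<ge>N. \<forall>l\<ge>N.
    (\<integral>p. k (fst p - snd p) * ((w i (fst p) - w l (fst p)) \<bullet> (w i (snd p) - w l (snd p)))
      \<partial>(lebesgue_on S \<Otimes>\<^sub>M lebesgue_on S)) < e"
proof -
  define M where "M = lebesgue_on S"
  interpret finite_measure M unfolding M_def by (rule finite_measure_lebesgue_on[OF S])
  interpret P: pair_sigma_finite M M ..
  interpret PF: finite_measure "M \<Otimes>\<^sub>M M"
    by (rule finite_measure_pair_measure) unfold_locales
  have [measurable]: "w n \<in> borel_measurable M" "(\<lambda>x. x) \<in> borel_measurable M" for n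
    unfolding M_def by (auto intro: measurable_id_lebesgue_on)
  have B0: "B \<ge> 0" using kb[of 0] by linarith
  have kint: "integrable M (\<lambda>y. k (x - y))" for x
    by (rule integrable_const_bound[of _ B]) (use kb in auto)
  have kwint: "integrable M (\<lambda>y. k (x - y) *\<^sub>R w i y)" for x i
    by (rule integrable_const_bound[of _ B])
      (use kb wb B0 in \<open>auto intro!: AE_I2 mult_mono[of _ B _ 1, simplified]\<close>)
  define T where "T i x = (\<integral>y. k (x - y) *\<^sub>R w i y \<partial>M)" for i x
  have [measurable]: "T i \<in> borel_measurable M" for i
    unfolding T_def by measurable
  have Tb: "norm (T i x) \<le> B * measure M (space M)" for i x
  proof -
    have "norm (T i x) \<le> (\<integral>y. norm (k (x - y) *\<^sub>R w i y) \<partial>M)"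
      unfolding T_def by (rule integral_norm_bound)
    also have "\<dots> \<le> (\<integral>y. B \<partial>M)"
      by (rule integral_mono) (use kwint kb wb B0 in \<open>auto intro!: mult_mono[of _ B _ 1, simplified] integrable_norm[OF kwint, simplified]\<close>)
    finally show ?thesis by (simp add: mult.commute)
  qed
  have "\<forall>x. \<exists>l. (\<lambda>i. T i x) \<longlonglongrightarrow> l"
    using weak[OF kint[unfolded M_def]] unfolding T_def convergent_def M_def by blast
  then obtain W where W: "\<And>x. (\<lambda>i. T i x) \<longlonglongrightarrow> W x" by metis
  have [measurable]: "W \<in> borel_measurable M"
    by (rule borel_measurable_LIMSEQ_metric[of T]) (auto intro: W)
  have Wb: "norm (W x) \<le> B * measure M (space M)" for x
    by (rule tendsto_upperbound[OF tendsto_norm[OF W[of x]]]) (auto intro: always_eventually Tb)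
  have TW: "integrable M (T i)" "integrable M W" for i
    by (auto intro!: integrable_const_bound[of _ "B * measure M (space M)"] AE_I2 Tb Wb)
  have "(\<lambda>i. \<integral>x. norm (T i x - W x) \<partial>M) \<longlonglongrightarrow> (\<integral>x. 0 \<partial>M)"
  proof (rule integral_dominated_convergence[where w="\<lambda>_. 2 * (B * measure M (space M))"])
    show "AE x in M. (\<lambda>i. norm (T i x - W x)) \<longlonglongrightarrow> 0"
      using W by (intro AE_I2 tendsto_norm_zero LIM_zero)
    show "AE x in M. norm (norm (T i x - W x)) \<le> 2 * (B * measure M (space M))" for i
      using norm_triangle_ineq4[of "T i _" "W _"] Tb[of i] Wb
      by (intro AE_I2) (smt (verit) norm_ge_zero real_norm_def)
  qed auto
  \<comment> \<open>Two errors of \<open>e/4\<close>, doubled by \<open>norm (?v x) \<le> 2\<close>,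
    add up to \<open>e\<close>.\<close>
  then have "\<forall>\<^sub>F i in sequentially. (\<integral>x. norm (T i x - W x) \<partial>M) < e/4"
    using e by (intro order_tendstoD(2)) auto
  then obtain N where N: "\<And>i. i \<ge> N \<Longrightarrow> (\<integral>x. norm (T i x - W x) \<partial>M) < e/4"
    by (auto simp: eventually_sequentially)
  show ?thesis unfolding M_def[symmetric]
  proof (intro exI allI impI)
    fix i l assume il: "i \<ge> N" "l \<ge> N"
    let ?v = "\<lambda>x. w i x - w l x"
    have vb: "norm (?v x) \<le> 2" for x
      using norm_triangle_ineq4[of "w i x" "w l x"] wb[of i x] wb[of l x] by linarith
    have "integrable (M \<Otimes>\<^sub>M M) (\<lambda>(x,y). k (x - y) * (?v x \<bullet> ?v y))"
    proof (rule PF.integrable_const_bound[of _ "B * (2 * 2)"])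
      show "AE p in M \<Otimes>\<^sub>M M. norm (case p of (x,y) \<Rightarrow> k (x - y) * (?v x \<bullet> ?v y)) \<le> B * (2 * 2)"
      proof (rule AE_I2, clarify)
        fix x y
        have "\<bar>?v x \<bullet> ?v y\<bar> \<le> norm (?v x) * norm (?v y)" by (rule Cauchy_Schwarz_ineq2)
        also have "\<dots> \<le> 2 * 2" by (intro mult_mono vb) auto
        finally show "norm (k (x - y) * (?v x \<bullet> ?v y)) \<le> B * (2 * 2)"
          using kb[of "x - y"] B0 unfolding real_norm_def abs_mult by (intro mult_mono) auto
      qed
    qed measurable
    then have "(\<integral>p. k (fst p - snd p) * (?v (fst p) \<bullet> ?v (snd p)) \<partial>(M \<Otimes>\<^sub>M M))
        = (\<integral>x. \<integral>y. k (x - y) * (?v x \<bullet> ?v y) \<partial>M \<partial>M)"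
      by (subst P.integral_fst'[symmetric]) (auto simp: split_beta')
    also have "\<dots> = (\<integral>x. ?v x \<bullet> (T i x - T l x) \<partial>M)"
    proof (rule Bochner_Integration.integral_cong[OF refl])
      fix x
      have "T i x - T l x = (\<integral>y. k (x - y) *\<^sub>R ?v y \<partial>M)"
        unfolding T_def using kwint by (simp add: scaleR_diff_right)
      moreover have "integrable M (\<lambda>y. k (x - y) *\<^sub>R ?v y)"
        using kwint by (simp add: scaleR_diff_right)
      ultimately show "(\<integral>y. k (x - y) * (?v x \<bullet> ?v y) \<partial>M) = ?v x \<bullet> (T i x - T l x)"
        by (simp flip: integral_inner_right)
    qed
    also have "\<dots> \<le> (\<integral>x. 2 * (norm (T i x - W x) + norm (T l x - W x)) \<partial>M)"
    proof (rule integral_mono)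
      show "integrable M (\<lambda>x. ?v x \<bullet> (T i x - T l x))"
      proof (rule Bochner_Integration.integrable_bound[of _ "\<lambda>x. 2 * norm (T i x - T l x)"])
        show "AE x in M. norm (?v x \<bullet> (T i x - T l x)) \<le> norm (2 * norm (T i x - T l x))"
        proof (rule AE_I2)
          fix x
          show "norm (?v x \<bullet> (T i x - T l x)) \<le> norm (2 * norm (T i x - T l x))"
            using Cauchy_Schwarz_ineq2[of "?v x" "T i x - T l x"]
              mult_right_mono[OF vb[of x], of "norm (T i x - T l x)"] by simp
        qed
      qed (use TW in auto)
      fix x
      have "?v x \<bullet> (T i x - T l x) \<le> 2 * norm (T i x - T l x)"
        using norm_cauchy_schwarz[of "?v x" "T i x - T l x"]
          mult_right_mono[OF vb[of x], of "norm (T i x - T l x)"] by simp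
      also have "norm (T i x - T l x) \<le> norm (T i x - W x) + norm (T l x - W x)"
        using norm_triangle_ineq4[of "T i x - W x" "T l x - W x"] by simp
      finally show "?v x \<bullet> (T i x - T l x) \<le> 2 * (norm (T i x - W x) + norm (T l x - W x))" by simp
    qed (use TW in auto)
    also have "\<dots> = 2 * ((\<integral>x. norm (T i x - W x) \<partial>M) + (\<integral>x. norm (T l x - W x) \<partial>M))"
      using TW by simp
    also have "\<dots> < e" using N[OF il(1)] N[OF il(2)] by simp
    finally show "(\<integral>p. k (fst p - snd p) * (?v (fst p) \<bullet> ?v (snd p)) \<partial>(M \<Otimes>\<^sub>M M)) < e" .
  qed
qed

lemma borel_measurable_kernel_lebesgue_on:
  fixes j :: "'a::euclidean_space \<Rightarrow> 'b::topological_space"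
  assumes [measurable]: "j \<in> borel_measurable borel"
  shows "(\<lambda>p. j (fst p - snd p)) \<in> borel_measurable (lebesgue_on S \<Otimes>\<^sub>M lebesgue_on S)"
proof -
  have [measurable]: "(\<lambda>x. x) \<in> borel_measurable (lebesgue_on S)" by (rule measurable_id_lebesgue_on)
  have "(\<lambda>p. (\<lambda>x. x) (fst p) - (\<lambda>x. x) (snd p)) \<in> borel_measurable (lebesgue_on S \<Otimes>\<^sub>M lebesgue_on S)"
    by measurable
  then show ?thesis using assms by (rule measurable_compose)
qed

lemma exchange_energy_altdef:
  "exchange_energy \<Omega> j m = (\<integral>\<^sup>+p. j (fst p - snd p) * ennreal ((norm (m (fst p) - m (snd p)))\<^sup>2)
     \<partial>(lebesgue_on \<Omega> \<Otimes>\<^sub>M lebesgue_on \<Omega>))"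
  unfolding exchange_energy_def by (simp add: split_beta')

text \<open>Truncate \<open>j\<close> to a bounded kernel \<open>k\<close> supported in a small ball, with \<open>c = \<integral> k\<close> as large as
  desired. For a difference \<open>v\<close> of two members of a weakly convergent subsequence, expanding the
  square gives \<open>c \<integral>\<^sub>K |v|\<^sup>2 \<le> \<integral>\<integral> k(x-y) |v(x)-v(y)|\<^sup>2 + 2 \<integral>\<integral> k(x-y) v(x)\<bullet>v(y)\<close> for a compact
  \<open>K \<subseteq> \<Omega>\<close>. The first term is at most four times the energy bound and the second tends to 0, because
  convolution with \<open>k\<close> is a compact operator.\<close>

lemma nonintegrable_kernel_compactness:
  fixes u :: "nat \<Rightarrow> real^3 \<Rightarrow> real^3" and j :: "real^3 \<Rightarrow> ennreal"
  assumes \<Omega>: "open \<Omega>" "bounded \<Omega>"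
    and j [measurable]: "j \<in> borel_measurable borel"
    and inf: "\<And>R. R > 0 \<Longrightarrow> (\<integral>\<^sup>+z\<in>ball 0 R. j z \<partial>lebesgue) = \<infinity>"
    and u [measurable]: "\<And>n. u n \<in> borel_measurable (lebesgue_on \<Omega>)"
    and ub: "\<And>n x. norm (u n x) \<le> 1"
    and C: "\<And>n. exchange_energy \<Omega> j (u n) \<le> ennreal C" "C \<ge> 0"
  obtains r :: "nat \<Rightarrow> nat"
    where "strict_mono r" "AE x in lebesgue_on \<Omega>. convergent (\<lambda>k. u (r k) x)"
proof -
  have lm: "\<Omega> \<in> lmeasurable" using \<Omega> by (simp add: lmeasurable_open)
  define M where "M = lebesgue_on \<Omega>"
  interpret finite_measure M unfolding M_def by (rule finite_measure_lebesgue_on[OF lm])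
  interpret P: pair_sigma_finite M M ..
  interpret PF: finite_measure "M \<Otimes>\<^sub>M M"
    by (rule finite_measure_pair_measure) unfold_locales
  note [measurable] = borel_measurable_kernel_lebesgue_on[of _ \<Omega>, folded M_def]
  have [measurable]: "u n \<in> borel_measurable M" "(\<lambda>x. x) \<in> borel_measurable M" for n
    unfolding M_def by (auto intro: measurable_id_lebesgue_on)
  obtain r1 :: "nat \<Rightarrow> nat" where r1: "strict_mono r1" "\<And>g :: real^3 \<Rightarrow> real. integrable (lebesgue_on \<Omega>) g \<Longrightarrow>
       convergent (\<lambda>k. \<integral>x. g x *\<^sub>R u (r1 k) x \<partial>lebesgue_on \<Omega>)"
    by (rule weakly_convergent_subseq[where u=u, OF lm u ub]) (rule that)
  define w where "w k = u (r1 k)" for k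
  have wm [measurable]: "w k \<in> borel_measurable M" and wb: "norm (w k x) \<le> 1" for k x
    using u ub unfolding w_def M_def by auto
  have Cauchy: "\<exists>N. \<forall>i\<ge>N. \<forall>l\<ge>N. (\<integral>\<^sup>+x. ennreal ((norm (w i x - w l x))\<^sup>2) \<partial>M) \<le> ennreal e"
    if e: "e > 0" for e
  proof -
    have "\<Omega> \<in> sets lebesgue" using lm by auto
    \<comment> \<open>On \<open>\<Omega> - K\<close> the integrand
      \<open>(norm (v x))\<^sup>2\<close> will be at most 4, so a measure below \<open>e/8\<close>
      costs at most \<open>e/2\<close>; the other half of \<open>e\<close> is spent on
      \<open>K\<close>.\<close>
    then obtain K where K: "closed K" "K \<subseteq> \<Omega>" "\<Omega> - K \<in> lmeasurable" "emeasure lebesgue (\<Omega> - K) < ennreal (e/8)"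
      using sets_lebesgue_inner_closed[of \<Omega> "e/8"] e by auto
    have "compact K" using K \<Omega> by (meson bounded_subset compact_eq_bounded_closed)
    \<comment> \<open>A kernel supported in \<open>ball 0 R\<close> loses no mass at the boundary:
      for \<open>x \<in> K\<close>, all of \<open>k (x - y)\<close> lives on
      \<open>y \<in> \<Omega>\<close>.\<close>
    then obtain R where R: "R > 0" "(\<Union>x\<in>K. ball x R) \<subseteq> \<Omega>"
      using compact_subset_open_imp_ball_epsilon_subset[OF _ \<Omega>(1) K(2)] by blast
    \<comment> \<open>\<open>4 * C\<close> will bound the double integral for the difference
      \<open>v\<close> (\<open>2 * C\<close> from each of the two fields), the 2 comes from
      \<open>2 * Q\<close> with \<open>Q < 1\<close>, and \<open>B\<close> is chosen so that the
      total equals \<open>B * (e/2)\<close>.\<close>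
    define B where "B = (4 * C + 2) * 2 / e"
    have B: "B > 0" using e C(2) by (simp add: B_def)
    obtain n :: nat where n: "(\<integral>\<^sup>+z. ennreal (enn2real (min (j z) (of_nat n)) * indicator (ball 0 R) z) \<partial>lebesgue) \<ge> ennreal B"
      using nn_integral_truncated_kernel_unbounded[OF j inf[OF R(1)]] by blast
    define k where "k z = enn2real (min (j z) (of_nat n)) * indicator (ball 0 R) z" for z
    have [measurable]: "ball 0 R \<in> sets (borel :: (real^3) measure)" by simp
    have km [measurable]: "k \<in> borel_measurable borel" unfolding k_def by measurable
    have minfin: "min (j z) (of_nat n) < top" for z
      by (auto simp: min_less_iff_disj of_nat_less_top)
    have kj: "ennreal (k z) \<le> j z" for z
      using minfin[of z] by (auto simp: k_def indicator_def)
    have k0: "k z \<ge> 0" for z by (simp add: k_def)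
    have kn: "k z \<le> real n" for z
    proof -
      have "enn2real (min (j z) (of_nat n)) \<le> enn2real (of_nat n)"
        by (intro enn2real_mono) (auto simp: of_nat_less_top)
      then show ?thesis by (simp add: k_def indicator_def)
    qed
    have weak: "convergent (\<lambda>i. \<integral>x. g x *\<^sub>R w i x \<partial>lebesgue_on \<Omega>)"
      if "integrable (lebesgue_on \<Omega>) g" for g :: "real^3 \<Rightarrow> real"
      using r1(2)[OF that] unfolding w_def .
    have "\<bar>k z\<bar> \<le> real n" for z using k0[of z] kn[of z] by simp
    then have "\<exists>N. \<forall>i\<ge>N. \<forall>l\<ge>N.
        (\<integral>p. k (fst p - snd p) * ((w i (fst p) - w l (fst p)) \<bullet> (w i (snd p) - w l (snd p))) \<partial>(M \<Otimes>\<^sub>M M)) < 1"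
      unfolding M_def by (intro compact_kernel_L2_Cauchy[OF lm wm[unfolded M_def] wb weak km]) auto
    then obtain N where N: "\<And>i l. i \<ge> N \<Longrightarrow> l \<ge> N \<Longrightarrow>
        (\<integral>p. k (fst p - snd p) * ((w i (fst p) - w l (fst p)) \<bullet> (w i (snd p) - w l (snd p))) \<partial>(M \<Otimes>\<^sub>M M)) < 1"
      by meson
    show ?thesis
    proof (intro exI allI impI)
      fix i l assume il: "i \<ge> N" "l \<ge> N"
      define v where "v x = w i x - w l x" for x
      have [measurable]: "v \<in> borel_measurable M" unfolding v_def by measurable
      have vb: "norm (v x) \<le> 2" for x
        using norm_triangle_ineq4[of "w i x" "w l x"] wb[of i x] wb[of l x] unfolding v_def by linarith
      have vb2: "(norm (v x))\<^sup>2 \<le> 4" for x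
        using power_mono[OF vb[of x] norm_ge_zero, of 2] by simp
      define Q where "Q = (\<integral>p. k (fst p - snd p) * (v (fst p) \<bullet> v (snd p)) \<partial>(M \<Otimes>\<^sub>M M))"
      have Q: "Q < 1" using N[OF il] unfolding Q_def v_def .
      have int1: "integrable (M \<Otimes>\<^sub>M M) (\<lambda>p. k (fst p - snd p) * (v (fst p) \<bullet> v (snd p)))"
      proof (rule PF.integrable_const_bound[of _ "real n * (2 * 2)"])
        show "AE p in M \<Otimes>\<^sub>M M. norm (k (fst p - snd p) * (v (fst p) \<bullet> v (snd p))) \<le> real n * (2 * 2)"
        proof (rule AE_I2)
          fix p :: "(real^3) \<times> (real^3)"
          have "\<bar>v (fst p) \<bullet> v (snd p)\<bar> \<le> norm (v (fst p)) * norm (v (snd p))" by (rule Cauchy_Schwarz_ineq2)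
          also have "\<dots> \<le> 2 * 2" by (intro mult_mono vb) auto
          finally show "norm (k (fst p - snd p) * (v (fst p) \<bullet> v (snd p))) \<le> real n * (2 * 2)"
            unfolding real_norm_def abs_mult using k0 kn by (intro mult_mono) auto
        qed
      qed measurable
      have int2: "integrable (M \<Otimes>\<^sub>M M) (\<lambda>p. k (fst p - snd p) * (norm (v (fst p)))\<^sup>2)"
      proof (rule PF.integrable_const_bound[of _ "real n * 2\<^sup>2"])
        show "AE p in M \<Otimes>\<^sub>M M. norm (k (fst p - snd p) * (norm (v (fst p)))\<^sup>2) \<le> real n * 2\<^sup>2"
          unfolding real_norm_def abs_mult using k0 kn vb2 by (intro AE_I2 mult_mono) auto
      qed measurable
      have int3: "integrable (M \<Otimes>\<^sub>M M) (\<lambda>p. k (fst p - snd p) * (norm (v (fst p) - v (snd p)))\<^sup>2)"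
      proof (rule PF.integrable_const_bound[of _ "real n * 4\<^sup>2"])
        have "norm (v x - v y) \<le> 4" for x y
          using norm_triangle_ineq4[of "v x" "v y"] vb[of x] vb[of y] by linarith
        then have "(norm (v x - v y))\<^sup>2 \<le> 4\<^sup>2" for x y
          by (rule power_mono) simp
        then show "AE p in M \<Otimes>\<^sub>M M. norm (k (fst p - snd p) * (norm (v (fst p) - v (snd p)))\<^sup>2) \<le> real n * 4\<^sup>2"
          unfolding real_norm_def abs_mult using k0 kn by (intro AE_I2 mult_mono) auto
      qed measurable
      have "ennreal (\<integral>p. k (fst p - snd p) * (norm (v (fst p) - v (snd p)))\<^sup>2 \<partial>(M \<Otimes>\<^sub>M M))
          = (\<integral>\<^sup>+p. ennreal (k (fst p - snd p) * (norm (v (fst p) - v (snd p)))\<^sup>2) \<partial>(M \<Otimes>\<^sub>M M))"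
        by (intro nn_integral_eq_integral[symmetric] int3) (auto simp: k0)
      also have "\<dots> \<le> (\<integral>\<^sup>+p. 2 * (j (fst p - snd p) * ennreal ((norm (w i (fst p) - w i (snd p)))\<^sup>2))
          + 2 * (j (fst p - snd p) * ennreal ((norm (w l (fst p) - w l (snd p)))\<^sup>2)) \<partial>(M \<Otimes>\<^sub>M M))"
      proof (rule nn_integral_mono, clarsimp)
        fix x y
        let ?a = "w i x - w i y" and ?b = "w l x - w l y"
        \<comment> \<open>Parallelogram identity for the increments of the two fields; discarding
          the sum term bounds the energy of the difference by twice the two energies.\<close>
        have "(norm (?a - ?b))\<^sup>2 + (norm (?a + ?b))\<^sup>2 = 2 * (norm ?a)\<^sup>2 + 2 * (norm ?b)\<^sup>2"
          by (simp add: power2_norm_eq_inner inner_diff inner_add inner_commute algebra_simps)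
        moreover have "(norm (?a + ?b))\<^sup>2 \<ge> 0" by simp
        ultimately have "(norm (?a - ?b))\<^sup>2 \<le> 2 * (norm ?a)\<^sup>2 + 2 * (norm ?b)\<^sup>2" by linarith
        moreover have "v x - v y = ?a - ?b" by (simp add: v_def)
        ultimately have le: "(norm (v x - v y))\<^sup>2 \<le> 2 * (norm ?a)\<^sup>2 + 2 * (norm ?b)\<^sup>2"
          by (simp only:)
        have "ennreal (k (x - y) * (norm (v x - v y))\<^sup>2) \<le> ennreal (k (x - y)) * ennreal (2 * (norm ?a)\<^sup>2 + 2 * (norm ?b)\<^sup>2)"
          using le k0 by (subst ennreal_mult[symmetric]) (auto intro!: ennreal_leI mult_left_mono)
        also have "\<dots> \<le> j (x - y) * ennreal (2 * (norm ?a)\<^sup>2 + 2 * (norm ?b)\<^sup>2)"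
          by (intro mult_right_mono kj) auto
        also have "\<dots> = 2 * (j (x - y) * ennreal ((norm ?a)\<^sup>2)) + 2 * (j (x - y) * ennreal ((norm ?b)\<^sup>2))"
          by (simp add: ennreal_plus ennreal_mult distrib_left mult_ac)
        finally show "ennreal (k (x - y) * (norm (v x - v y))\<^sup>2)
           \<le> 2 * (j (x - y) * ennreal ((norm ?a)\<^sup>2)) + 2 * (j (x - y) * ennreal ((norm ?b)\<^sup>2))" .
      qed
      also have "\<dots> = 2 * exchange_energy \<Omega> j (w i) + 2 * exchange_energy \<Omega> j (w l)"
        unfolding exchange_energy_altdef M_def[symmetric] by (simp add: nn_integral_add nn_integral_cmult)
      also have "\<dots> \<le> 2 * ennreal C + 2 * ennreal C"
        unfolding w_def by (intro add_mono mult_left_mono C) auto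
      also have "\<dots> = ennreal (4 * C)" using C(2)
        by (simp add: ennreal_mult' flip: distrib_right)
      finally have le3: "(\<integral>p. k (fst p - snd p) * (norm (v (fst p) - v (snd p)))\<^sup>2 \<partial>(M \<Otimes>\<^sub>M M)) \<le> 4 * C"
        using C(2) by (simp add: ennreal_le_iff)
      have le2: "(\<integral>p. k (fst p - snd p) * (norm (v (fst p)))\<^sup>2 \<partial>(M \<Otimes>\<^sub>M M)) \<le> 4 * C + 2"
      proof -
        have "(\<integral>p. k (fst p - snd p) * (norm (v (fst p)))\<^sup>2 \<partial>(M \<Otimes>\<^sub>M M))
          \<le> (\<integral>p. k (fst p - snd p) * (norm (v (fst p) - v (snd p)))\<^sup>2 + 2 * (k (fst p - snd p) * (v (fst p) \<bullet> v (snd p))) \<partial>(M \<Otimes>\<^sub>M M))"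
        proof (rule integral_mono)
          fix p :: "(real^3) \<times> (real^3)"
          \<comment> \<open>Here \<open>(norm (v (snd p)))\<^sup>2\<close> is discarded; the cross
            term is the form controlled by \<open>Q\<close>.\<close>
          have "(norm (v (fst p)))\<^sup>2 \<le> (norm (v (fst p) - v (snd p)))\<^sup>2 + 2 * (v (fst p) \<bullet> v (snd p))"
            by (simp add: power2_norm_eq_inner inner_diff inner_commute)
          from mult_left_mono[OF this k0[of "fst p - snd p"]]
          show "k (fst p - snd p) * (norm (v (fst p)))\<^sup>2
            \<le> k (fst p - snd p) * (norm (v (fst p) - v (snd p)))\<^sup>2 + 2 * (k (fst p - snd p) * (v (fst p) \<bullet> v (snd p)))"
            by (simp add: algebra_simps)
        qed (use int1 int2 int3 in auto)
        also have "\<dots> = (\<integral>p. k (fst p - snd p) * (norm (v (fst p) - v (snd p)))\<^sup>2 \<partial>(M \<Otimes>\<^sub>M M)) + 2 * Q"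
          unfolding Q_def using int1 int3 by simp
        finally show ?thesis using le3 Q by linarith
      qed
      have "K \<inter> \<Omega> \<in> sets M" "\<Omega> - K \<in> sets M"
        using K(1) lm by (auto simp: M_def sets_restrict_space_iff)
      then have [measurable]: "(indicator K :: _ \<Rightarrow> ennreal) \<in> borel_measurable M"
         "(indicator (\<Omega> - K) :: _ \<Rightarrow> ennreal) \<in> borel_measurable M"
        by (auto simp: borel_measurable_indicator_iff M_def Int_commute)
      have "ennreal B * (\<integral>\<^sup>+x. ennreal ((norm (v x))\<^sup>2) * indicator K x \<partial>M)
         = (\<integral>\<^sup>+x. ennreal B * (ennreal ((norm (v x))\<^sup>2) * indicator K x) \<partial>M)"
        by (rule nn_integral_cmult[symmetric]) measurable
      also have "\<dots> \<le> (\<integral>\<^sup>+x. \<integral>\<^sup>+y. ennreal (k (x - y) * (norm (v x))\<^sup>2) \<partial>M \<partial>M)"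
      proof (rule nn_integral_mono)
        fix x
        show "ennreal B * (ennreal ((norm (v x))\<^sup>2) * indicator K x) \<le> (\<integral>\<^sup>+y. ennreal (k (x - y) * (norm (v x))\<^sup>2) \<partial>M)"
        proof (cases "x \<in> K")
          case True
          have "ennreal B \<le> (\<integral>\<^sup>+z. ennreal (k z) \<partial>lebesgue)" using n unfolding k_def .
          also have "\<dots> = (\<integral>\<^sup>+y. ennreal (k (x - y)) \<partial>lebesgue)"
            by (rule nn_integral_lebesgue_reflect_translate[symmetric]) measurable
          also have "\<dots> = (\<integral>\<^sup>+y. ennreal (k (x - y)) * indicator \<Omega> y \<partial>lebesgue)"
          proof (rule nn_integral_cong)
            fix y
            show "ennreal (k (x - y)) = ennreal (k (x - y)) * indicator \<Omega> y"
            proof (cases "x - y \<in> ball 0 R")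
              case a: True
              then have "y \<in> ball x R" by (simp add: dist_norm norm_minus_commute)
              then have "y \<in> \<Omega>" using R(2) True by blast
              then show ?thesis by simp
            qed (simp add: k_def)
          qed
          also have "\<dots> = (\<integral>\<^sup>+y. ennreal (k (x - y)) \<partial>M)"
            unfolding M_def using lm by (intro nn_integral_restrict_space[symmetric]) auto
          finally have "ennreal B * ennreal ((norm (v x))\<^sup>2) \<le> (\<integral>\<^sup>+y. ennreal (k (x - y)) \<partial>M) * ennreal ((norm (v x))\<^sup>2)"
            by (rule mult_right_mono) simp
          also have "\<dots> = (\<integral>\<^sup>+y. ennreal (k (x - y) * (norm (v x))\<^sup>2) \<partial>M)"
            using k0 by (simp add: ennreal_mult nn_integral_multc)
          finally show ?thesis using True by simp
        qed simp
      qed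
      also have "\<dots> = (\<integral>\<^sup>+p. ennreal (k (fst p - snd p) * (norm (v (fst p)))\<^sup>2) \<partial>(M \<Otimes>\<^sub>M M))"
        by (subst nn_integral_fst[symmetric]) auto
      also have "\<dots> = ennreal (\<integral>p. k (fst p - snd p) * (norm (v (fst p)))\<^sup>2 \<partial>(M \<Otimes>\<^sub>M M))"
        by (intro nn_integral_eq_integral int2) (auto simp: k0)
      also have "\<dots> \<le> ennreal (4 * C + 2)" by (intro ennreal_leI le2)
      also have "4 * C + 2 = B * (e/2)" using e by (simp add: B_def)
      also have "ennreal (B * (e/2)) = ennreal B * ennreal (e/2)"
        using B e by (intro ennreal_mult) auto
      finally have inK: "(\<integral>\<^sup>+x. ennreal ((norm (v x))\<^sup>2) * indicator K x \<partial>M) \<le> ennreal (e/2)"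
        using B by (subst (asm) ennreal_mult_le_mult_iff) auto
      have "(\<integral>\<^sup>+x. ennreal ((norm (v x))\<^sup>2) * indicator (\<Omega> - K) x \<partial>M) \<le> (\<integral>\<^sup>+x. 4 * indicator (\<Omega> - K) x \<partial>M)"
      proof (intro nn_integral_mono mult_right_mono)
        fix x show "ennreal ((norm (v x))\<^sup>2) \<le> 4"
          using ennreal_leI[OF vb2[of x]] by simp
      qed simp
      also have "\<dots> = 4 * emeasure M (\<Omega> - K)"
        using K(1) lm by (intro nn_integral_cmult_indicator) (auto simp: M_def sets_restrict_space_iff)
      also have "\<dots> = 4 * emeasure lebesgue (\<Omega> - K)"
        unfolding M_def using lm by (subst emeasure_restrict_space) auto
      also have "\<dots> \<le> 4 * ennreal (e/8)" using K(4) by (intro mult_left_mono) auto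
      also have "\<dots> = ennreal (e/2)" using e by (subst ennreal_numeral[symmetric], subst ennreal_mult[symmetric]) auto
      finally have outK: "(\<integral>\<^sup>+x. ennreal ((norm (v x))\<^sup>2) * indicator (\<Omega> - K) x \<partial>M) \<le> ennreal (e/2)" .
      have "(\<integral>\<^sup>+x. ennreal ((norm (v x))\<^sup>2) \<partial>M)
        = (\<integral>\<^sup>+x. ennreal ((norm (v x))\<^sup>2) * indicator K x + ennreal ((norm (v x))\<^sup>2) * indicator (\<Omega> - K) x \<partial>M)"
        by (intro nn_integral_cong) (auto simp: M_def indicator_def)
      also have "\<dots> = (\<integral>\<^sup>+x. ennreal ((norm (v x))\<^sup>2) * indicator K x \<partial>M) + (\<integral>\<^sup>+x. ennreal ((norm (v x))\<^sup>2) * indicator (\<Omega> - K) x \<partial>M)"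
      proof (rule nn_integral_add)
        show "(\<lambda>x. ennreal ((norm (v x))\<^sup>2) * indicator K x) \<in> borel_measurable M"
          "(\<lambda>x. ennreal ((norm (v x))\<^sup>2) * indicator (\<Omega> - K) x) \<in> borel_measurable M" by measurable
      qed
      also have "\<dots> \<le> ennreal (e/2) + ennreal (e/2)" by (intro add_mono inK outK)
      also have "\<dots> = ennreal e" using e by (subst ennreal_plus[symmetric]) auto
      finally show "(\<integral>\<^sup>+x. ennreal ((norm (w i x - w l x))\<^sup>2) \<partial>M) \<le> ennreal e" unfolding v_def .
    qed
  qed
  obtain r2 :: "nat \<Rightarrow> nat" where r2: "strict_mono r2" "AE x in M. convergent (\<lambda>k. w (r2 k) x)"
    using L2_Cauchy_AE_convergent_subseq[OF wm Cauchy] by blast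
  show thesis
    by (rule that[of "r1 \<circ> r2"]) (use r1(1) r2(1) r2(2)[unfolded w_def M_def] in \<open>auto simp: strict_mono_def\<close>)
qed

subsection \<open>Test functions\<close>

text \<open>The powers of \<open>inverse t\<close> make the family closed under differentiation up
  to linear combinations: only the exponents \<open>n + 1\<close> and \<open>n + 2\<close> appear.
  \<open>bump 0\<close> is the standard function that is flat at 0.\<close>

definition bump :: "nat \<Rightarrow> real \<Rightarrow> real" where
  "bump n t = (if t \<le> 0 then 0 else exp (- inverse t) * inverse t ^ n)"

lemma bump_nonneg: "bump n t \<ge> 0" and bump_pos: "t > 0 \<Longrightarrow> bump n t > 0"
  and bump_nonpos [simp]: "t \<le> 0 \<Longrightarrow> bump n t = 0"
  by (auto simp: bump_def)

lemma bump_at_right: "(bump n \<longlongrightarrow> 0) (at_right 0)"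
proof -
  have "((\<lambda>t. inverse t ^ n / exp (inverse t)) \<longlongrightarrow> 0) (at_right (0::real))"
    by (rule filterlim_compose[OF tendsto_power_div_exp_0 filterlim_inverse_at_top_right])
  then show ?thesis
    by (rule Lim_transform_eventually)
      (auto simp: eventually_at_filter bump_def exp_minus divide_inverse)
qed

lemma bump_deriv:
  "(bump n has_real_derivative bump (n + 2) t - of_nat n * bump (n + 1) t) (at t)"
proof -
  consider "t < 0" | "t = 0" | "t > 0" by linarith
  then show ?thesis
  proof cases
    case 1
    have "((\<lambda>_. 0) has_real_derivative 0) (at t)" by simp
    then have "(bump n has_real_derivative 0) (at t)"
      by (rule has_field_derivative_transform_within_open[where S="{..<0}"]) (use 1 in auto)
    then show ?thesis using 1 by simp
  next
    case 3
    have d: "(inverse has_real_derivative - (inverse t ^ 2)) (at t)"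
      using DERIV_inverse[of t] 3 by (simp add: numeral_2_eq_2)
    have "((\<lambda>t. exp (- inverse t) * inverse t ^ n) has_real_derivative
        exp (- inverse t) * (- (- (inverse t ^ 2))) * inverse t ^ n
        + of_nat n * (- (inverse t ^ 2) * inverse t ^ (n - Suc 0)) * exp (- inverse t)) (at t)"
      by (rule DERIV_mult[OF DERIV_fun_exp[OF DERIV_minus[OF d]] DERIV_power[OF d]])
    also have "exp (- inverse t) * (- (- (inverse t ^ 2))) * inverse t ^ n
        + of_nat n * (- (inverse t ^ 2) * inverse t ^ (n - Suc 0)) * exp (- inverse t)
        = bump (n + 2) t - of_nat n * bump (n + 1) t"
      using 3 by (cases n) (simp_all add: bump_def power2_eq_square algebra_simps)
    finally have "((\<lambda>t. exp (- inverse t) * inverse t ^ n) has_real_derivative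
        bump (n + 2) t - of_nat n * bump (n + 1) t) (at t)" .
    then show ?thesis
      by (rule has_field_derivative_transform_within_open[where S="{0<..}"])
        (use 3 in \<open>auto simp: bump_def\<close>)
  next
    case 2
    have "((\<lambda>h. (bump n (0 + h) - bump n 0) / h) \<longlongrightarrow> 0) (at 0)"
      unfolding filterlim_at_split
    proof
      have "\<forall>\<^sub>F h in at_left 0. 0 = (bump n (0 + h) - bump n 0) / h"
        by (auto simp: eventually_at_filter)
      then show "((\<lambda>h. (bump n (0 + h) - bump n 0) / h) \<longlongrightarrow> 0) (at_left 0)"
        by (rule Lim_transform_eventually[OF tendsto_const])
      \<comment> \<open>For positive \<open>h\<close> the difference quotient at 0 is exactly
        \<open>bump (Suc n) h\<close>.\<close>
      show "((\<lambda>h. (bump n (0 + h) - bump n 0) / h) \<longlongrightarrow> 0) (at_right 0)"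
        by (rule Lim_transform_eventually[OF bump_at_right[of "Suc n"]])
          (auto simp: eventually_at_filter bump_def field_simps)
    qed
    then show ?thesis using 2 by (simp add: DERIV_def)
  qed
qed

lemma continuous_on_bump [continuous_intros]:
  assumes "continuous_on S f" shows "continuous_on S (\<lambda>x. bump n (f x))"
proof -
  have "continuous_on UNIV (bump n)"
    using bump_deriv by (intro continuous_at_imp_continuous_on ballI DERIV_isCont)
  then show ?thesis using assms by (rule continuous_on_compose2) auto
qed

text \<open>The range \<open>t \<le> 1\<close> is that of the arguments
  \<open>1 - s * ((x - a) \<bullet> (x - a))\<close> for positive \<open>s\<close>.\<close>

lemma bump_bounded: obtains B where "B > 0" "\<And>t. t \<le> 1 \<Longrightarrow> \<bar>bump n t\<bar> \<le> B"
proof -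
  have "compact (bump n ` {0..1})"
    by (intro compact_continuous_image continuous_intros) auto
  then obtain B where B: "B > 0" "\<And>t. t \<in> {0..1} \<Longrightarrow> norm (bump n t) \<le> B"
    by (auto simp: bounded_pos dest!: compact_imp_bounded)
  have "\<bar>bump n t\<bar> \<le> B" if "t \<le> 1" for t
    using B(1) B(2)[of t] that by (cases "t \<le> 0") auto
  with B(1) show thesis by (rule that)
qed

section \<open>Calculus of k times differentiable functions\<close>

lemma C_k_SucI:
  assumes "\<And>x. (f has_derivative f' x) (at x)" "\<And>v. C_k k (\<lambda>x. f' x v)"
  shows "C_k (Suc k) f"
proof -
  have "frechet_derivative f (at x) = f' x" for x
    using frechet_derivative_at[OF assms(1)] by simp
  then show ?thesis using assms by (auto simp: differentiable_def)
qed

lemma C_k_SucE: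
  assumes "C_k (Suc k) f"
  shows "(f has_derivative frechet_derivative f (at x)) (at x)"
    and "C_k k (\<lambda>x. frechet_derivative f (at x) v)"
  using assms by (simp_all flip: frechet_derivative_works)

text \<open>The product rule leaves one factor undifferentiated, so the induction for products needs
  this descent.\<close>

lemma C_k_SucD: "C_k (Suc k) f \<Longrightarrow> C_k k f"
proof (induction k arbitrary: f)
  case 0
  then show ?case by (auto intro!: continuous_at_imp_continuous_on differentiable_imp_continuous_within)
next
  case (Suc k)
  show ?case
    by (rule C_k_SucI[OF C_k_SucE(1)[OF Suc.prems] Suc.IH[OF C_k_SucE(2)[OF Suc.prems]]])
qed

lemma C_k_const: "C_k k (\<lambda>_. c)"
proof (induction k arbitrary: c)
  case (Suc k)
  show ?case by (rule C_k_SucI[where f'="\<lambda>_ _. 0"]) (auto intro: Suc)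
qed (simp add: continuous_on_const)

lemma C_k_inner: "C_k k (\<lambda>x. (x - a) \<bullet> e)"
proof (cases k)
  case (Suc n)
  show ?thesis unfolding Suc
    by (rule C_k_SucI[where f'="\<lambda>_ v. v \<bullet> e"]) (auto intro!: derivative_eq_intros C_k_const)
qed (auto intro!: continuous_intros)

lemma C_k_add: "C_k k f \<Longrightarrow> C_k k g \<Longrightarrow> C_k k (\<lambda>x. f x + g x)"
proof (induction k arbitrary: f g)
  case (Suc k)
  show ?case
    by (rule C_k_SucI[OF has_derivative_add[OF C_k_SucE(1)[OF Suc.prems(1)] C_k_SucE(1)[OF Suc.prems(2)]]])
      (intro Suc.IH C_k_SucE(2)[OF Suc.prems(1)] C_k_SucE(2)[OF Suc.prems(2)])
qed (simp add: continuous_on_add)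

lemma C_k_mult: "C_k k f \<Longrightarrow> C_k k g \<Longrightarrow> C_k k (\<lambda>x. f x * g x)"
proof (induction k arbitrary: f g)
  case (Suc k)
  show ?case
    by (rule C_k_SucI[OF has_derivative_mult[OF C_k_SucE(1)[OF Suc.prems(1)] C_k_SucE(1)[OF Suc.prems(2)]]])
      (intro C_k_add Suc.IH C_k_SucE(2)[OF Suc.prems(1)] C_k_SucE(2)[OF Suc.prems(2)]
        C_k_SucD[OF Suc.prems(1)] C_k_SucD[OF Suc.prems(2)])
qed (simp add: continuous_on_mult)

lemma radial_bump_has_derivative:
  fixes a x :: "'a::real_inner"
  shows "((\<lambda>x. bump n (1 - s * ((x - a) \<bullet> (x - a)))) has_derivative
    (\<lambda>v. (bump (n + 2) (1 - s * ((x - a) \<bullet> (x - a))) - of_nat n * bump (n + 1) (1 - s * ((x - a) \<bullet> (x - a))))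
       * ((- 2 * s) * ((x - a) \<bullet> v)))) (at x)"
proof -
  have "((\<lambda>x. 1 - s * ((x - a) \<bullet> (x - a))) has_derivative (\<lambda>v. (- 2 * s) * ((x - a) \<bullet> v))) (at x)"
    by (auto intro!: derivative_eq_intros simp: inner_commute algebra_simps)
  from has_derivative_compose[OF this bump_deriv[unfolded has_field_derivative_def]]
  show ?thesis by simp
qed

text \<open>The induction must treat all exponents \<open>n\<close> at once, because differentiation
  raises them.\<close>

lemma C_k_radial_bump: "C_k k (\<lambda>x. bump n (1 - s * ((x - a) \<bullet> (x - a))))"
proof (induction k arbitrary: n)
  case (Suc k)
  have D: "C_k k (\<lambda>x. (bump (n + 2) (1 - s * ((x - a) \<bullet> (x - a))) +
      (- of_nat n) * bump (n + 1) (1 - s * ((x - a) \<bullet> (x - a)))) * ((- 2 * s) * ((x - a) \<bullet> v)))" for v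
    by (intro C_k_mult C_k_add C_k_const C_k_inner Suc)
  show ?case
    by (rule C_k_SucI[OF radial_bump_has_derivative]) (use D in simp)
qed (auto intro!: continuous_intros)

section \<open>Gradients of test functions\<close>

lemma test_fun_differentiable:
  assumes "test_fun \<phi>" shows "(\<phi> has_derivative frechet_derivative \<phi> (at x)) (at x)"
proof -
  have "C_k (Suc 0) \<phi>" using assms unfolding test_fun_def by blast
  then show ?thesis by (rule C_k_SucE(1))
qed

lemma test_fun_continuous: "test_fun \<phi> \<Longrightarrow> continuous_on UNIV \<phi>"
  unfolding test_fun_def by (metis C_k.simps(1))

lemma frechet_derivative_grad:
  assumes "test_fun \<phi>" shows "frechet_derivative \<phi> (at x) v = grad \<phi> x \<bullet> v"
proof -
  interpret bounded_linear "frechet_derivative \<phi> (at x)"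
    by (rule has_derivative_bounded_linear[OF test_fun_differentiable[OF assms]])
  have "v = (\<Sum>i\<in>UNIV. v $ i *\<^sub>R axis i 1)"
    by (simp add: vec_eq_iff axis_def if_distrib cong: if_cong)
  then have "frechet_derivative \<phi> (at x) v = (\<Sum>i\<in>UNIV. v $ i * frechet_derivative \<phi> (at x) (axis i 1))"
    by (metis (mono_tags, lifting) sum scaleR real_scaleR_def sum.cong)
  then show ?thesis by (simp add: grad_def inner_vec_def mult.commute)
qed

lemma test_fun_has_derivative:
  "test_fun \<phi> \<Longrightarrow> (\<phi> has_derivative (\<lambda>v. grad \<phi> x \<bullet> v)) (at x)"
  using test_fun_differentiable[of \<phi> x] frechet_derivative_grad[of \<phi> x]
  by (metis (no_types, lifting) ext)

lemma grad_unique: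
  assumes "(\<phi> has_derivative (\<lambda>v. g \<bullet> v)) (at x)" shows "grad \<phi> x = g"
  unfolding grad_def frechet_derivative_at[OF assms, symmetric] by (simp add: vec_eq_iff inner_axis)

lemma continuous_on_grad:
  assumes "test_fun \<phi>" shows "continuous_on UNIV (grad \<phi>)"
proof -
  have "C_k (Suc 0) \<phi>" using assms unfolding test_fun_def by blast
  then have "continuous_on UNIV (\<lambda>x. frechet_derivative \<phi> (at x) v)" for v by simp
  then show ?thesis unfolding grad_def by (intro continuous_on_vec_lambda)
qed

lemma test_fun_bounded_support:
  assumes "test_fun \<phi>"
  obtains R where "R > 0" "\<And>x. norm x \<ge> R \<Longrightarrow> \<phi> x = 0" "\<And>x. norm x \<ge> R \<Longrightarrow> grad \<phi> x = 0"
proof -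
  let ?C = "closure {x. \<phi> x \<noteq> 0}"
  have "compact ?C" using assms by (simp add: test_fun_def)
  then obtain R where R: "R > 0" "\<And>x. x \<in> ?C \<Longrightarrow> norm x \<le> R"
    using compact_imp_bounded bounded_pos by metis
  have z: "\<phi> x = 0" if "norm x \<ge> R + 1" for x
    using R(2)[of x] closure_subset[of "{x. \<phi> x \<noteq> 0}"] that by auto
  \<comment> \<open>The margin 1 keeps \<open>x\<close> off the closed support, whose complement is
    open; so \<open>\<phi>\<close> vanishes near \<open>x\<close>, and its gradient at
    \<open>x\<close> with it.\<close>
  have g: "grad \<phi> x = 0" if "norm x \<ge> R + 1" for x
  proof (rule grad_unique)
    have "x \<in> - ?C" using R(2)[of x] that by auto
    have "((\<lambda>_. 0) has_derivative (\<lambda>v. 0 \<bullet> v)) (at x)" by simp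
    then show "(\<phi> has_derivative (\<lambda>v. 0 \<bullet> v)) (at x)"
      by (rule has_derivative_transform_within_open[of _ _ _ _ "- ?C"])
        (use \<open>x \<in> - ?C\<close> closure_subset[of "{x. \<phi> x \<noteq> 0}"] in auto)
  qed
  from R(1) z g show thesis by (intro that[of "R + 1"]) auto
qed

lemma grad_bounded:
  assumes "test_fun \<phi>" obtains B where "B > 0" "\<And>x. norm (grad \<phi> x) \<le> B"
proof -
  obtain R where R: "R > 0" "\<And>x. norm x \<ge> R \<Longrightarrow> grad \<phi> x = 0"
    using test_fun_bounded_support[OF assms] by metis
  have "compact (grad \<phi> ` cball 0 R)"
    by (intro compact_continuous_image continuous_on_subset[OF continuous_on_grad[OF assms]]) auto
  then obtain B where B: "B > 0" "\<And>x. x \<in> cball 0 R \<Longrightarrow> norm (grad \<phi> x) \<le> B"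
    by (auto simp: bounded_pos dest!: compact_imp_bounded)
  have "norm (grad \<phi> x) \<le> B" for x
    using B R(2)[of x] by (cases "norm x \<le> R") auto
  with B(1) show thesis by (rule that)
qed

lemma test_fun_0: "test_fun (\<lambda>_. 0)"
  by (simp add: test_fun_def C_k_const)

lemma test_fun_add:
  assumes "test_fun \<phi>" "test_fun \<psi>" shows "test_fun (\<lambda>x. \<phi> x + \<psi> x)"
proof -
  have "bounded ({x. \<phi> x \<noteq> 0} \<union> {x. \<psi> x \<noteq> 0})"
    using assms by (simp add: test_fun_def compact_closure)
  then have "bounded {x. \<phi> x + \<psi> x \<noteq> 0}" by (rule bounded_subset) auto
  with assms show ?thesis unfolding test_fun_def compact_closure by (auto intro: C_k_add)
qed

lemma test_fun_scale:
  assumes "test_fun \<phi>" shows "test_fun (\<lambda>x. c * \<phi> x)"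
proof -
  have "bounded {x. \<phi> x \<noteq> 0}" using assms by (simp add: test_fun_def compact_closure)
  then have "bounded {x. c * \<phi> x \<noteq> 0}" by (rule bounded_subset) auto
  with assms show ?thesis unfolding test_fun_def compact_closure by (auto intro: C_k_mult C_k_const)
qed

lemma grad_add: "test_fun \<phi> \<Longrightarrow> test_fun \<psi> \<Longrightarrow> grad (\<lambda>x. \<phi> x + \<psi> x) x = grad \<phi> x + grad \<psi> x"
  by (rule grad_unique)
    (use has_derivative_add[OF test_fun_has_derivative test_fun_has_derivative, of \<phi> \<psi> x] in
      \<open>simp add: inner_add_left\<close>)

lemma grad_scale: "test_fun \<phi> \<Longrightarrow> grad (\<lambda>x. c * \<phi> x) x = c *\<^sub>R grad \<phi> x"
  by (rule grad_unique)
    (use has_derivative_mult_right[OF test_fun_has_derivative, of \<phi> c x] in simp)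

lemma test_fun_linear_radial_bump:
  assumes "s > 0"
  shows "test_fun (\<lambda>x. ((x - a) \<bullet> e) * bump n (1 - s * ((x - a) \<bullet> (x - a))))"
proof -
  let ?\<psi> = "\<lambda>x. ((x - a) \<bullet> e) * bump n (1 - s * ((x - a) \<bullet> (x - a)))"
  have "{x. ?\<psi> x \<noteq> 0} \<subseteq> cball a (sqrt (1/s))"
  proof
    fix x assume "x \<in> {x. ?\<psi> x \<noteq> 0}"
    then have "1 - s * ((x - a) \<bullet> (x - a)) > 0"
      by (metis (mono_tags, lifting) bump_nonpos linorder_not_le mem_Collect_eq mult_zero_right)
    then have "(norm (x - a))\<^sup>2 \<le> 1/s"
      using assms by (simp add: power2_norm_eq_inner field_simps)
    then show "x \<in> cball a (sqrt (1/s))"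
      by (simp add: dist_norm norm_minus_commute real_le_rsqrt)
  qed
  then have "bounded {x. ?\<psi> x \<noteq> 0}" by (rule bounded_subset[OF bounded_cball])
  then show ?thesis unfolding test_fun_def
    by (auto intro: C_k_mult C_k_inner C_k_radial_bump simp: compact_closure)
qed

text \<open>Since \<open>bump 0\<close> has derivative \<open>bump 2\<close>, the function is, up to
  the factor \<open>- 1 / (2 * s)\<close>, the derivative in direction \<open>e\<close> of the
  radial function \<open>bump 0 (1 - s * ((x - a) \<bullet> (x - a)))\<close>. Its gradient is
  therefore a multiple of the Hessian of that radial function applied to \<open>e\<close>, which
  explains the part along \<open>e\<close> and the part along \<open>x - a\<close>.\<close>

lemma grad_linear_radial_bump:
  "grad (\<lambda>x. ((x - a) \<bullet> e) * bump 2 (1 - s * ((x - a) \<bullet> (x - a)))) x =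
    bump 2 (1 - s * ((x - a) \<bullet> (x - a))) *\<^sub>R e
    + ((bump 4 (1 - s * ((x - a) \<bullet> (x - a))) - 2 * bump 3 (1 - s * ((x - a) \<bullet> (x - a))))
       * (- 2 * s) * ((x - a) \<bullet> e)) *\<^sub>R (x - a)"
proof -
  define y where "y = x - a"
  define q where "q = 1 - s * (y \<bullet> y)"
  have e: "2 + 2 = (4::nat)" "2 + 1 = (3::nat)" "of_nat 2 = (2::real)" by simp_all
  have d: "((\<lambda>x. (x - a) \<bullet> e) has_derivative (\<lambda>v. v \<bullet> e)) (at x)"
    by (auto intro!: derivative_eq_intros)
  have "((\<lambda>x. ((x - a) \<bullet> e) * bump 2 (1 - s * ((x - a) \<bullet> (x - a)))) has_derivative
      (\<lambda>v. (y \<bullet> e) * ((bump 4 q - 2 * bump 3 q) * ((- 2 * s) * (y \<bullet> v))) + (v \<bullet> e) * bump 2 q)) (at x)"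
    using has_derivative_mult[OF d radial_bump_has_derivative[of 2 s a x]]
    unfolding e y_def[symmetric] q_def[symmetric] .
  also have "(\<lambda>v. (y \<bullet> e) * ((bump 4 q - 2 * bump 3 q) * ((- 2 * s) * (y \<bullet> v))) + (v \<bullet> e) * bump 2 q)
      = (\<lambda>v. (bump 2 q *\<^sub>R e + ((bump 4 q - 2 * bump 3 q) * (- 2 * s) * (y \<bullet> e)) *\<^sub>R y) \<bullet> v)"
    by (intro ext, simp only: inner_add_left inner_scaleR_left inner_commute[of _ e]) (simp add: algebra_simps)
  finally show ?thesis unfolding y_def[symmetric] q_def[symmetric] by (rule grad_unique)
qed

section \<open>Weak symmetry of mixed second derivatives\<close>

lemma integral_lebesgue_translate:
  fixes f :: "'a::euclidean_space \<Rightarrow> 'b::euclidean_space"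
  assumes "f \<in> borel_measurable borel"
  shows "(\<integral>x. f (x + c) \<partial>lebesgue) = (\<integral>x. f x \<partial>lebesgue)"
proof -
  have "(\<integral>x. f x \<partial>lborel) = (\<integral>x. f x \<partial>distr lborel borel ((+) c))"
    by (simp add: lborel_distr_plus)
  also have "\<dots> = (\<integral>x. f (x + c) \<partial>lborel)"
    using assms by (subst integral_distr) (auto simp: add.commute)
  finally show ?thesis using assms by (simp add: integral_completion)
qed

lemma integrable_lebesgue_continuous_compact_support:
  fixes f :: "'a::euclidean_space \<Rightarrow> 'b::euclidean_space"
  assumes f: "continuous_on UNIV f" and z: "\<And>x. norm x \<ge> R \<Longrightarrow> f x = 0"
  shows "integrable lebesgue f"
proof -
  have m: "f \<in> borel_measurable borel" using f by (rule borel_measurable_continuous_onI)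
  have "compact (f ` cball 0 R)"
    by (intro compact_continuous_image continuous_on_subset[OF f]) auto
  then obtain B where B: "B > 0" "\<And>x. x \<in> cball 0 R \<Longrightarrow> norm (f x) \<le> B"
    by (auto simp: bounded_pos dest!: compact_imp_bounded)
  have "integrable lebesgue (\<lambda>x::'a. indicator (cball 0 R) x *\<^sub>R B :: real)"
    using lmeasurable_iff_integrable[of "cball (0::'a) R"] by (intro integrable_scaleR_left) auto
  then show ?thesis
  proof (rule Bochner_Integration.integrable_bound)
    show "AE x in lebesgue. norm (f x) \<le> norm (indicator (cball 0 R) x *\<^sub>R B :: real)"
    proof (rule AE_I2)
      fix x show "norm (f x) \<le> norm (indicator (cball 0 R) x *\<^sub>R B :: real)"
        using B(1) B(2)[of x] z[of x] by (cases "norm x \<le> R") auto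
    qed
  qed (use m in \<open>auto intro: measurable_completion\<close>)
qed

definition diff_quot :: "real \<Rightarrow> 'a::real_normed_vector \<Rightarrow> ('a \<Rightarrow> real) \<Rightarrow> 'a \<Rightarrow> real" where
  "diff_quot t u f x = (f (x + t *\<^sub>R u) - f x) / t"

text \<open>Discrete integration by parts in both factors at once. Passing to the limit gives
  \<open>\<integral> \<partial>\<^sub>u\<psi> \<partial>\<^sub>v\<phi> = \<integral> \<partial>\<^sub>v\<psi> \<partial>\<^sub>u\<phi>\<close> without any appeal to symmetry of second derivatives.\<close>

lemma diff_quot_swap:
  fixes \<phi> \<psi> :: "'a::euclidean_space \<Rightarrow> real"
  assumes c: "continuous_on UNIV \<phi>" "continuous_on UNIV \<psi>"
    and z: "\<And>x. norm x \<ge> R \<Longrightarrow> \<phi> x = 0" "\<And>x. norm x \<ge> R \<Longrightarrow> \<psi> x = 0"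
    and t: "t \<noteq> 0"
  shows "(\<integral>x. diff_quot t u \<psi> x * diff_quot t v \<phi> x \<partial>lebesgue)
    = (\<integral>x. diff_quot (- t) v \<psi> x * diff_quot (- t) u \<phi> x \<partial>lebesgue)"
proof -
  define B where "B p q = (\<integral>x. \<psi> (x + p) * \<phi> (x + q) \<partial>lebesgue)" for p q
  have cont: "continuous_on UNIV (\<lambda>x. \<psi> (x + p) * \<phi> (x + q))" for p q
    by (intro continuous_on_mult continuous_on_compose2[OF c(1)] continuous_on_compose2[OF c(2)] continuous_intros) auto
  have int: "integrable lebesgue (\<lambda>x. \<psi> (x + p) * \<phi> (x + q))" for p q
  proof (rule integrable_lebesgue_continuous_compact_support[OF cont, of "R + norm p"])
    fix x :: 'a assume "R + norm p \<le> norm x"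
    then have "norm (x + p) \<ge> R" using norm_triangle_ineq4[of "x + p" p] by simp
    then show "\<psi> (x + p) * \<phi> (x + q) = 0" using z(2) by simp
  qed
  have shift: "B (p + d) (q + d) = B p q" for p q d
    using integral_lebesgue_translate[of "\<lambda>x. \<psi> (x + p) * \<phi> (x + q)" d] cont[of p q]
    unfolding B_def by (simp add: add.assoc add.commute[of d] borel_measurable_continuous_onI)
  have eq: "(\<integral>x. diff_quot t u \<psi> x * diff_quot t v \<phi> x \<partial>lebesgue)
    = (B (t *\<^sub>R u) (t *\<^sub>R v) - B (t *\<^sub>R u) 0 - B 0 (t *\<^sub>R v) + B 0 0) / t\<^sup>2" for t :: real and u v
  proof -
    have "(\<integral>x. diff_quot t u \<psi> x * diff_quot t v \<phi> x \<partial>lebesgue)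
      = (\<integral>x. (\<psi> (x + t *\<^sub>R u) * \<phi> (x + t *\<^sub>R v) - \<psi> (x + t *\<^sub>R u) * \<phi> (x + 0)
         - \<psi> (x + 0) * \<phi> (x + t *\<^sub>R v) + \<psi> (x + 0) * \<phi> (x + 0)) / t\<^sup>2 \<partial>lebesgue)"
      unfolding diff_quot_def by (intro Bochner_Integration.integral_cong) (auto simp: power2_eq_square algebra_simps)
    also have "\<dots> = (B (t *\<^sub>R u) (t *\<^sub>R v) - B (t *\<^sub>R u) 0 - B 0 (t *\<^sub>R v) + B 0 0) / t\<^sup>2"
      unfolding B_def using int by (simp del: add_0_right)
    finally show ?thesis .
  qed
  \<comment> \<open>By \<open>shift\<close>, \<open>B p q\<close> depends only on
    \<open>p - q\<close>; reversing the steps and swapping the directions preserves these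
    differences.\<close>
  have "B ((-t) *\<^sub>R v) ((-t) *\<^sub>R u) = B (t *\<^sub>R u) (t *\<^sub>R v)"
    using shift[of "(-t) *\<^sub>R v" "t *\<^sub>R u + t *\<^sub>R v" "(-t) *\<^sub>R u"] by simp
  moreover have "B ((-t) *\<^sub>R v) 0 = B 0 (t *\<^sub>R v)"
    using shift[of "(-t) *\<^sub>R v" "t *\<^sub>R v" 0] by simp
  moreover have "B 0 ((-t) *\<^sub>R u) = B (t *\<^sub>R u) 0"
    using shift[of 0 "t *\<^sub>R u" "(-t) *\<^sub>R u"] by simp
  ultimately show ?thesis unfolding eq by simp
qed

lemma diff_quot_integral_tendsto:
  assumes \<phi>: "test_fun \<phi>" and \<psi>: "test_fun \<psi>"
    and s: "s \<longlonglongrightarrow> 0" "\<And>n. s n \<noteq> 0" "\<And>n. \<bar>s n\<bar> \<le> 1"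
  shows "(\<lambda>n. \<integral>x. diff_quot (s n) u \<psi> x * diff_quot (s n) v \<phi> x \<partial>lebesgue)
    \<longlonglongrightarrow> (\<integral>x. (grad \<psi> x \<bullet> u) * (grad \<phi> x \<bullet> v) \<partial>lebesgue)"
proof -
  have bd: "\<exists>B. B \<ge> 0 \<and> (\<forall>n x. \<bar>diff_quot (s n) w f x\<bar> \<le> B)" if f: "test_fun f" for f w
  proof -
    obtain B where B: "B > 0" "\<And>x. norm (grad f x) \<le> B" using grad_bounded[OF f] by blast
    have "\<bar>diff_quot (s n) w f x\<bar> \<le> B * norm w" for n x
    proof -
      have "norm (f (x + s n *\<^sub>R w) - f x) \<le> B * norm ((x + s n *\<^sub>R w) - x)"
      proof (rule differentiable_bound[of UNIV])
        fix y
        show "(f has_derivative (\<lambda>v. grad f y \<bullet> v)) (at y within UNIV)"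
          using test_fun_has_derivative[OF f] by simp
        show "onorm (\<lambda>v. grad f y \<bullet> v) \<le> B"
        proof (rule onorm_bound)
          fix v
          show "norm (grad f y \<bullet> v) \<le> B * norm v"
            using Cauchy_Schwarz_ineq2[of "grad f y" v] mult_right_mono[OF B(2)[of y], of "norm v"] by simp
        qed (use B in simp)
      qed auto
      then show ?thesis using s(2)[of n] by (simp add: diff_quot_def divide_le_eq mult_ac)
    qed
    then show ?thesis using B(1) by (intro exI[of _ "B * norm w"]) auto
  qed
  have lim: "(\<lambda>n. diff_quot (s n) w f x) \<longlonglongrightarrow> grad f x \<bullet> w" if "test_fun f" for f w x
  proof -
    have d0: "((\<lambda>t. x + t *\<^sub>R w) has_derivative (\<lambda>t. t *\<^sub>R w)) (at 0)"
      by (auto intro!: derivative_eq_intros)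
    have "((\<lambda>t. f (x + t *\<^sub>R w)) has_derivative (\<lambda>t. grad f x \<bullet> (t *\<^sub>R w))) (at 0)"
      using has_derivative_compose[OF d0, of f "\<lambda>v. grad f x \<bullet> v"] test_fun_has_derivative[OF that, of x] by simp
    then have "((\<lambda>t. f (x + t *\<^sub>R w)) has_real_derivative (grad f x \<bullet> w)) (at 0)"
      by (rule has_derivative_imp_has_field_derivative) simp
    then have "((\<lambda>t. diff_quot t w f x) \<longlongrightarrow> grad f x \<bullet> w) (at 0)"
      by (simp add: DERIV_def diff_quot_def)
    moreover have "filterlim s (at 0) sequentially"
      using s by (simp add: filterlim_at)
    ultimately show ?thesis by (rule filterlim_compose)
  qed
  obtain B1 where B1: "B1 \<ge> 0" "\<And>n x. \<bar>diff_quot (s n) u \<psi> x\<bar> \<le> B1" using bd[OF \<psi>] by blast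
  obtain B2 where B2: "B2 \<ge> 0" "\<And>n x. \<bar>diff_quot (s n) v \<phi> x\<bar> \<le> B2" using bd[OF \<phi>] by blast
  obtain R where R: "R > 0" "\<And>x. norm x \<ge> R \<Longrightarrow> \<psi> x = 0" using test_fun_bounded_support[OF \<psi>] by metis
  have m: "f \<in> borel_measurable borel" if "test_fun f" for f
    by (rule borel_measurable_continuous_onI[OF test_fun_continuous[OF that]])
  have mg: "grad f \<in> borel_measurable borel" if "test_fun f" for f
    by (rule borel_measurable_continuous_onI[OF continuous_on_grad[OF that]])
  note [measurable] = m[OF \<phi>] m[OF \<psi>] mg[OF \<phi>] mg[OF \<psi>]
  show ?thesis
  proof (rule integral_dominated_convergence[where w="\<lambda>x. indicator (cball 0 (R + norm u)) x *\<^sub>R (B1 * B2)"])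
    show "(\<lambda>x. (grad \<psi> x \<bullet> u) * (grad \<phi> x \<bullet> v)) \<in> borel_measurable lebesgue"
      by (rule measurable_completion) simp
    show "(\<lambda>x. diff_quot (s n) u \<psi> x * diff_quot (s n) v \<phi> x) \<in> borel_measurable lebesgue" for n
      unfolding diff_quot_def by (rule measurable_completion) simp
    show "integrable lebesgue (\<lambda>x::real^3. indicator (cball 0 (R + norm u)) x *\<^sub>R (B1 * B2))"
      using lmeasurable_iff_integrable[of "cball (0::real^3) (R + norm u)"] by (intro integrable_scaleR_left) auto
    show "AE x in lebesgue. (\<lambda>n. diff_quot (s n) u \<psi> x * diff_quot (s n) v \<phi> x) \<longlonglongrightarrow> (grad \<psi> x \<bullet> u) * (grad \<phi> x \<bullet> v)"
      by (intro AE_I2 tendsto_mult lim \<phi> \<psi>)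
    show "AE x in lebesgue. norm (diff_quot (s n) u \<psi> x * diff_quot (s n) v \<phi> x)
       \<le> indicator (cball 0 (R + norm u)) x *\<^sub>R (B1 * B2)" for n
    proof (rule AE_I2)
      fix x
      show "norm (diff_quot (s n) u \<psi> x * diff_quot (s n) v \<phi> x) \<le> indicator (cball 0 (R + norm u)) x *\<^sub>R (B1 * B2)"
      proof (cases "norm x \<le> R + norm u")
        case True
        then show ?thesis using B1 B2 by (auto simp: abs_mult intro!: mult_mono)
      next
        case False
        \<comment> \<open>Steps of size at most 1 displace the support of \<open>\<psi>\<close> by
          at most \<open>norm u\<close>, so one ball carries all the difference quotients.\<close>
        have "norm (s n *\<^sub>R u) \<le> norm u" using s(3)[of n] by (simp add: mult_left_le_one_le)
        then have "norm (x + s n *\<^sub>R u) \<ge> R" using False norm_triangle_ineq4[of "x + s n *\<^sub>R u" "s n *\<^sub>R u"] by simp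
        moreover have "norm x \<ge> R" using False norm_ge_zero[of u] by linarith
        ultimately show ?thesis using R(2) False by (simp add: diff_quot_def)
      qed
    qed
  qed
qed

lemma grad_grad_symmetric:
  assumes \<phi>: "test_fun \<phi>" and \<psi>: "test_fun \<psi>"
  shows "(\<integral>x. (grad \<psi> x \<bullet> u) * (grad \<phi> x \<bullet> v) \<partial>lebesgue) = (\<integral>x. (grad \<psi> x \<bullet> v) * (grad \<phi> x \<bullet> u) \<partial>lebesgue)"
proof -
  obtain R1 where R1: "R1 > 0" "\<And>x. norm x \<ge> R1 \<Longrightarrow> \<phi> x = 0" using test_fun_bounded_support[OF \<phi>] by metis
  obtain R2 where R2: "R2 > 0" "\<And>x. norm x \<ge> R2 \<Longrightarrow> \<psi> x = 0" using test_fun_bounded_support[OF \<psi>] by metis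
  define s :: "nat \<Rightarrow> real" where "s n = inverse (Suc n)" for n
  have s: "s \<longlonglongrightarrow> 0" unfolding s_def by (rule LIMSEQ_inverse_real_of_nat)
  have s1: "s n \<noteq> 0" "\<bar>s n\<bar> \<le> 1" for n by (auto simp: s_def inverse_le_1_iff)
  have "(\<lambda>n. \<integral>x. diff_quot (s n) u \<psi> x * diff_quot (s n) v \<phi> x \<partial>lebesgue)
    \<longlonglongrightarrow> (\<integral>x. (grad \<psi> x \<bullet> u) * (grad \<phi> x \<bullet> v) \<partial>lebesgue)"
    by (rule diff_quot_integral_tendsto[OF \<phi> \<psi> s s1])
  moreover have "(\<lambda>n. \<integral>x. diff_quot (- s n) v \<psi> x * diff_quot (- s n) u \<phi> x \<partial>lebesgue)
    \<longlonglongrightarrow> (\<integral>x. (grad \<psi> x \<bullet> v) * (grad \<phi> x \<bullet> u) \<partial>lebesgue)"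
    using s1 tendsto_minus[OF s] by (intro diff_quot_integral_tendsto[OF \<phi> \<psi>]) auto
  moreover have "(\<integral>x. diff_quot (s n) u \<psi> x * diff_quot (s n) v \<phi> x \<partial>lebesgue)
     = (\<integral>x. diff_quot (- s n) v \<psi> x * diff_quot (- s n) u \<phi> x \<partial>lebesgue)" for n
    using R1 R2 s1(1)[of n]
    by (intro diff_quot_swap[of \<phi> \<psi> "max R1 R2"] test_fun_continuous \<phi> \<psi>) auto
  ultimately show ?thesis by (simp add: LIMSEQ_unique)
qed

lemma integrable_grad_grad:
  assumes \<phi>: "test_fun \<phi>" and \<psi>: "test_fun \<psi>"
  shows "integrable lebesgue (\<lambda>x. (grad \<psi> x \<bullet> u) * (grad \<phi> x \<bullet> v))"
proof -
  obtain R where "R > 0" "\<And>x. norm x \<ge> R \<Longrightarrow> \<psi> x = 0" "\<And>x. norm x \<ge> R \<Longrightarrow> grad \<psi> x = 0"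
    by (rule test_fun_bounded_support[OF \<psi>]) (rule that)
  then show ?thesis
    by (intro integrable_lebesgue_continuous_compact_support[of _ R] continuous_intros continuous_on_grad \<phi> \<psi>) auto
qed

subsection \<open>Projection onto gradients\<close>

text \<open>\<open>L2_on\<close> is tied to vector fields and to \<open>lebesgue_on\<close>; scalars
  such as cut-off functions and components of fields are needed as well.\<close>

definition square_integrable :: "'a measure \<Rightarrow> ('a \<Rightarrow> 'b::euclidean_space) \<Rightarrow> bool" where
  "square_integrable M f \<longleftrightarrow> f \<in> borel_measurable M \<and> integrable M (\<lambda>x. (norm (f x))\<^sup>2)"

lemma square_integrableD:
  assumes "square_integrable M f"
  shows "f \<in> borel_measurable M" "integrable M (\<lambda>x. (norm (f x))\<^sup>2)"
  using assms unfolding square_integrable_def by blast+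

lemma square_integrable_inner:
  fixes f g :: "'a \<Rightarrow> 'b::euclidean_space"
  assumes f: "square_integrable M f" and g: "square_integrable M g"
  shows "integrable M (\<lambda>x. f x \<bullet> g x)"
proof (rule Bochner_Integration.integrable_bound)
  show "integrable M (\<lambda>x. (norm (f x))\<^sup>2 + (norm (g x))\<^sup>2)"
    using square_integrableD[OF f] square_integrableD[OF g] by auto
  show "(\<lambda>x. f x \<bullet> g x) \<in> borel_measurable M"
    using square_integrableD(1)[OF f] square_integrableD(1)[OF g] by simp
  show "AE x in M. norm (f x \<bullet> g x) \<le> norm ((norm (f x))\<^sup>2 + (norm (g x))\<^sup>2)"
  proof (rule AE_I2)
    fix x
    have "0 \<le> (norm (f x) - norm (g x))\<^sup>2" by simp
    then have "2 * (norm (f x) * norm (g x)) \<le> (norm (f x))\<^sup>2 + (norm (g x))\<^sup>2"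
      by (simp add: power2_diff)
    moreover have "0 \<le> norm (f x) * norm (g x)" by simp
    ultimately show "norm (f x \<bullet> g x) \<le> norm ((norm (f x))\<^sup>2 + (norm (g x))\<^sup>2)"
      using Cauchy_Schwarz_ineq2[of "f x" "g x"] by simp
  qed
qed

lemma square_integrable_scale:
  assumes "square_integrable M f" shows "square_integrable M (\<lambda>x. c *\<^sub>R f x)"
proof -
  have "integrable M (\<lambda>x. c\<^sup>2 * (norm (f x))\<^sup>2)"
    by (intro integrable_mult_right square_integrableD(2)[OF assms])
  then have "integrable M (\<lambda>x. (norm (c *\<^sub>R f x))\<^sup>2)" by (simp add: power_mult_distrib)
  then show ?thesis
    using square_integrableD(1)[OF assms] unfolding square_integrable_def by simp
qed

lemma square_integrable_add:
  fixes f g :: "'a \<Rightarrow> 'b::euclidean_space"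
  assumes f: "square_integrable M f" and g: "square_integrable M g"
  shows "square_integrable M (\<lambda>x. f x + g x)"
    and "(\<integral>x. (norm (f x + g x))\<^sup>2 \<partial>M)
      = (\<integral>x. (norm (f x))\<^sup>2 \<partial>M) + 2 * (\<integral>x. f x \<bullet> g x \<partial>M) + (\<integral>x. (norm (g x))\<^sup>2 \<partial>M)"
proof -
  have eq: "(norm (f x + g x))\<^sup>2 = (norm (f x))\<^sup>2 + 2 * (f x \<bullet> g x) + (norm (g x))\<^sup>2" for x
    by (simp add: power2_norm_eq_inner inner_add inner_commute)
  note int = square_integrableD(2)[OF f] square_integrableD(2)[OF g] square_integrable_inner[OF f g]
  show "square_integrable M (\<lambda>x. f x + g x)"
    using square_integrableD(1)[OF f] square_integrableD(1)[OF g] int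
    unfolding square_integrable_def eq by auto
  show "(\<integral>x. (norm (f x + g x))\<^sup>2 \<partial>M)
      = (\<integral>x. (norm (f x))\<^sup>2 \<partial>M) + 2 * (\<integral>x. f x \<bullet> g x \<partial>M) + (\<integral>x. (norm (g x))\<^sup>2 \<partial>M)"
    unfolding eq using int by simp
qed

lemma square_integrable_diff:
  fixes f g :: "'a \<Rightarrow> 'b::euclidean_space"
  assumes f: "square_integrable M f" and g: "square_integrable M g"
  shows "square_integrable M (\<lambda>x. f x - g x)"
    and "(\<integral>x. (norm (f x - g x))\<^sup>2 \<partial>M)
      = (\<integral>x. (norm (f x))\<^sup>2 \<partial>M) - 2 * (\<integral>x. f x \<bullet> g x \<partial>M) + (\<integral>x. (norm (g x))\<^sup>2 \<partial>M)"
proof -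
  have g': "square_integrable M (\<lambda>x. (-1) *\<^sub>R g x)" by (rule square_integrable_scale[OF g])
  have e: "f x - g x = f x + (-1) *\<^sub>R g x" for x by simp
  show "square_integrable M (\<lambda>x. f x - g x)"
    unfolding e by (rule square_integrable_add(1)[OF f g'])
  show "(\<integral>x. (norm (f x - g x))\<^sup>2 \<partial>M)
      = (\<integral>x. (norm (f x))\<^sup>2 \<partial>M) - 2 * (\<integral>x. f x \<bullet> g x \<partial>M) + (\<integral>x. (norm (g x))\<^sup>2 \<partial>M)"
    unfolding e square_integrable_add(2)[OF f g'] by simp
qed

lemma nonneg_quadratic_linear_coeff:
  fixes b c :: real
  assumes "\<And>t. 0 \<le> 2 * t * b + t\<^sup>2 * c" "c \<ge> 0" shows "b = 0"
proof (rule ccontr)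
  assume "b \<noteq> 0"
  \<comment> \<open>The minimiser of the quadratic with \<open>c + 1\<close> in place of
    \<open>c\<close>, so that \<open>c = 0\<close> needs no separate case; the value becomes
    \<open>t * b - t\<^sup>2\<close>.\<close>
  define t where "t = - b / (c + 1)"
  have t: "t * (c + 1) = - b" using assms(2) by (simp add: t_def)
  have "2 * t * b + t\<^sup>2 * c = t * (2 * b + t * c)" by (simp add: power2_eq_square algebra_simps)
  also have "t * c = - b - t" using t by (simp add: algebra_simps)
  also have "t * (2 * b + (- b - t)) = t * b - t\<^sup>2" by (simp add: power2_eq_square algebra_simps)
  also have "t * b = - (b\<^sup>2 / (c + 1))" by (simp add: t_def power2_eq_square)
  finally have "2 * t * b + t\<^sup>2 * c < 0"
    using \<open>b \<noteq> 0\<close> assms(2) by (smt (verit) divide_pos_pos zero_less_power2 zero_le_power2)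
  with assms(1)[of t] show False by simp
qed

lemma integral_Cauchy_Schwarz:
  fixes f g :: "'a \<Rightarrow> 'b::euclidean_space"
  assumes f: "square_integrable M f" and g: "square_integrable M g"
  shows "(\<integral>x. f x \<bullet> g x \<partial>M)\<^sup>2 \<le> (\<integral>x. (norm (f x))\<^sup>2 \<partial>M) * (\<integral>x. (norm (g x))\<^sup>2 \<partial>M)"
proof -
  define A B C where "A = (\<integral>x. (norm (f x))\<^sup>2 \<partial>M)" and "B = (\<integral>x. f x \<bullet> g x \<partial>M)"
    and "C = (\<integral>x. (norm (g x))\<^sup>2 \<partial>M)"
  have q: "0 \<le> A + 2 * t * B + t\<^sup>2 * C" for t
  proof -
    have "0 \<le> (\<integral>x. (norm (f x + t *\<^sub>R g x))\<^sup>2 \<partial>M)" by (rule Bochner_Integration.integral_nonneg) simp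
    also have "\<dots> = A + 2 * t * B + t\<^sup>2 * C"
      unfolding square_integrable_add(2)[OF f square_integrable_scale[OF g]] A_def B_def C_def
      by (simp add: power_mult_distrib)
    finally show ?thesis .
  qed
  have "C \<ge> 0" unfolding C_def by (rule Bochner_Integration.integral_nonneg) simp
  have "B\<^sup>2 \<le> A * C"
  proof (cases "C = 0")
    case True
    have "B = 0"
    proof (rule ccontr)
      assume "B \<noteq> 0"
      \<comment> \<open>With \<open>C = 0\<close> the quadratic is affine and takes the value -1 at
        this point.\<close>
      then show False using q[of "- (A + 1) / (2 * B)"] True by (simp add: field_simps)
    qed
    with True show ?thesis by simp
  next
    case False
    with \<open>C \<ge> 0\<close> have C: "C > 0" by simp
    \<comment> \<open>\<open>- B / C\<close> is the minimiser of the quadratic in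
      \<open>q\<close>.\<close>
    have "0 \<le> (A + 2 * (- B / C) * B + (- B / C)\<^sup>2 * C) * C"
      by (intro mult_nonneg_nonneg q) (use C in auto)
    also have "\<dots> = A * C - B\<^sup>2" using C by (simp add: power2_eq_square field_simps)
    finally show ?thesis by simp
  qed
  then show ?thesis by (simp add: A_def B_def C_def)
qed

lemma integral_inner_tendsto_L2:
  fixes f :: "nat \<Rightarrow> 'a \<Rightarrow> 'b::euclidean_space"
  assumes f: "\<And>n. square_integrable M (f n)" and h: "square_integrable M h" and g: "square_integrable M g"
    and lim: "(\<lambda>n. \<integral>x. (norm (f n x - h x))\<^sup>2 \<partial>M) \<longlonglongrightarrow> 0"
  shows "(\<lambda>n. \<integral>x. f n x \<bullet> g x \<partial>M) \<longlonglongrightarrow> (\<integral>x. h x \<bullet> g x \<partial>M)"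
proof -
  let ?C = "\<integral>x. (norm (g x))\<^sup>2 \<partial>M"
  have "(\<lambda>n. sqrt ((\<integral>x. (norm (f n x - h x))\<^sup>2 \<partial>M) * ?C)) \<longlonglongrightarrow> sqrt (0 * ?C)"
    by (intro tendsto_intros lim)
  then have L: "(\<lambda>n. sqrt ((\<integral>x. (norm (f n x - h x))\<^sup>2 \<partial>M) * ?C)) \<longlonglongrightarrow> 0" by simp
  have "(\<lambda>n. (\<integral>x. f n x \<bullet> g x \<partial>M) - (\<integral>x. h x \<bullet> g x \<partial>M)) \<longlonglongrightarrow> 0"
  proof (rule Lim_null_comparison[OF _ L], unfold real_norm_def)
    show "\<forall>\<^sub>F n in sequentially. \<bar>(\<integral>x. f n x \<bullet> g x \<partial>M) - (\<integral>x. h x \<bullet> g x \<partial>M)\<bar>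
      \<le> sqrt ((\<integral>x. (norm (f n x - h x))\<^sup>2 \<partial>M) * ?C)"
    proof (rule always_eventually, rule allI)
      fix n
      have "(\<integral>x. f n x \<bullet> g x \<partial>M) - (\<integral>x. h x \<bullet> g x \<partial>M) = (\<integral>x. (f n x - h x) \<bullet> g x \<partial>M)"
        using square_integrable_inner[OF f g] square_integrable_inner[OF h g] by (simp add: inner_diff_left)
      then have "\<bar>(\<integral>x. f n x \<bullet> g x \<partial>M) - (\<integral>x. h x \<bullet> g x \<partial>M)\<bar>\<^sup>2
        \<le> (\<integral>x. (norm (f n x - h x))\<^sup>2 \<partial>M) * ?C"
        using integral_Cauchy_Schwarz[OF square_integrable_diff(1)[OF f h] g] by simp
      then show "\<bar>(\<integral>x. f n x \<bullet> g x \<partial>M) - (\<integral>x. h x \<bullet> g x \<partial>M)\<bar>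
        \<le> sqrt ((\<integral>x. (norm (f n x - h x))\<^sup>2 \<partial>M) * ?C)"
        by (rule real_le_rsqrt)
    qed
  qed
  then show ?thesis by (rule LIM_zero_cancel)
qed

text \<open>Riesz-Fischer. The limit is taken pointwise along an almost everywhere convergent
  subsequence, and Fatou's lemma, applied to \<open>f n - f (r k)\<close> as \<open>k\<close> grows,
  turns the Cauchy bound into a bound on the distance from \<open>f n\<close> to the limit.\<close>

lemma square_integrable_complete:
  fixes f :: "nat \<Rightarrow> 'a \<Rightarrow> 'b::euclidean_space"
  assumes f: "\<And>n. square_integrable M (f n)"
    and Cauchy: "\<And>e. e > 0 \<Longrightarrow> \<exists>N. \<forall>m\<ge>N. \<forall>n\<ge>N. (\<integral>x. (norm (f m x - f n x))\<^sup>2 \<partial>M) \<le> e"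
  obtains g where "square_integrable M g" "(\<lambda>n. \<integral>x. (norm (f n x - g x))\<^sup>2 \<partial>M) \<longlonglongrightarrow> 0"
proof -
  have [measurable]: "f n \<in> borel_measurable M" for n using square_integrableD(1)[OF f] .
  have nn: "(\<integral>\<^sup>+x. ennreal ((norm (f m x - f n x))\<^sup>2) \<partial>M) = ennreal (\<integral>x. (norm (f m x - f n x))\<^sup>2 \<partial>M)" for m n
    by (rule nn_integral_eq_integral[OF square_integrableD(2)[OF square_integrable_diff(1)[OF f f]]]) auto
  have C': "\<exists>N. \<forall>m\<ge>N. \<forall>n\<ge>N. (\<integral>\<^sup>+x. ennreal ((norm (f m x - f n x))\<^sup>2) \<partial>M) \<le> ennreal e" if "e > 0" for e
    unfolding nn using Cauchy[OF that] ennreal_leI by meson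
  obtain r :: "nat \<Rightarrow> nat" where r: "strict_mono r" "AE x in M. convergent (\<lambda>k. f (r k) x)"
    by (rule L2_Cauchy_AE_convergent_subseq[of f M]) (use C' in \<open>auto intro: that\<close>)
  define g where "g x = lim (\<lambda>k. f (r k) x)" for x
  have [measurable]: "g \<in> borel_measurable M" unfolding g_def by measurable
  have ae: "AE x in M. (\<lambda>k. f (r k) x) \<longlonglongrightarrow> g x"
    using r(2) by eventually_elim (simp add: g_def convergent_LIMSEQ_iff)
  have bound: "(\<integral>\<^sup>+x. ennreal ((norm (f n x - g x))\<^sup>2) \<partial>M) \<le> ennreal e"
    if N: "\<And>m n. m \<ge> N \<Longrightarrow> n \<ge> N \<Longrightarrow> (\<integral>x. (norm (f m x - f n x))\<^sup>2 \<partial>M) \<le> e" and n: "n \<ge> N" for N n e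
  proof -
    have "(\<integral>\<^sup>+x. ennreal ((norm (f n x - g x))\<^sup>2) \<partial>M)
      = (\<integral>\<^sup>+x. liminf (\<lambda>k. ennreal ((norm (f n x - f (r k) x))\<^sup>2)) \<partial>M)"
    proof (rule nn_integral_cong_AE)
      show "AE x in M. ennreal ((norm (f n x - g x))\<^sup>2) = liminf (\<lambda>k. ennreal ((norm (f n x - f (r k) x))\<^sup>2))"
        using ae
      proof eventually_elim
        fix x assume "(\<lambda>k. f (r k) x) \<longlonglongrightarrow> g x"
        then have "(\<lambda>k. ennreal ((norm (f n x - f (r k) x))\<^sup>2)) \<longlonglongrightarrow> ennreal ((norm (f n x - g x))\<^sup>2)"
          by (intro tendsto_intros)
        then show "ennreal ((norm (f n x - g x))\<^sup>2) = liminf (\<lambda>k. ennreal ((norm (f n x - f (r k) x))\<^sup>2))"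
          by (intro lim_imp_Liminf[symmetric]) auto
      qed
    qed
    also have "\<dots> \<le> liminf (\<lambda>k. \<integral>\<^sup>+x. ennreal ((norm (f n x - f (r k) x))\<^sup>2) \<partial>M)"
      by (rule nn_integral_liminf) simp
    also have "\<dots> \<le> ennreal e"
    proof (rule Liminf_le)
      show "\<forall>\<^sub>F k in sequentially. (\<integral>\<^sup>+x. ennreal ((norm (f n x - f (r k) x))\<^sup>2) \<partial>M) \<le> ennreal e"
        using eventually_ge_at_top[of N]
      proof eventually_elim
        case (elim k)
        then have "r k \<ge> N" using seq_suble[OF r(1), of k] by linarith
        then show ?case unfolding nn using N[OF n] by (simp add: ennreal_leI)
      qed
    qed simp
    finally show ?thesis .
  qed
  have g: "square_integrable M g"
  proof -
    obtain N where "\<And>m n. m \<ge> N \<Longrightarrow> n \<ge> N \<Longrightarrow> (\<integral>x. (norm (f m x - f n x))\<^sup>2 \<partial>M) \<le> 1"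
      using Cauchy[of 1] by auto
    then have "(\<integral>\<^sup>+x. ennreal ((norm (f N x - g x))\<^sup>2) \<partial>M) \<le> ennreal 1"
      by (intro bound[of N]) auto
    also have "\<dots> < \<infinity>" by simp
    finally have "(\<integral>\<^sup>+x. ennreal ((norm (f N x - g x))\<^sup>2) \<partial>M) < \<infinity>" .
    then have "square_integrable M (\<lambda>x. f N x - g x)"
      unfolding square_integrable_def by (auto intro!: integrableI_bounded)
    from square_integrable_diff(1)[OF f[of N] this] show ?thesis by simp
  qed
  have "(\<lambda>n. \<integral>x. (norm (f n x - g x))\<^sup>2 \<partial>M) \<longlonglongrightarrow> 0"
    unfolding LIMSEQ_def
  proof (intro allI impI)
    fix e :: real assume e: "e > 0"
    then obtain N where N: "\<And>m n. m \<ge> N \<Longrightarrow> n \<ge> N \<Longrightarrow> (\<integral>x. (norm (f m x - f n x))\<^sup>2 \<partial>M) \<le> e / 2"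
      using Cauchy[of "e/2"] by auto
    show "\<exists>N. \<forall>n\<ge>N. dist (\<integral>x. (norm (f n x - g x))\<^sup>2 \<partial>M) 0 < e"
    proof (intro exI allI impI)
      fix n assume n: "n \<ge> N"
      have "ennreal (\<integral>x. (norm (f n x - g x))\<^sup>2 \<partial>M) = (\<integral>\<^sup>+x. ennreal ((norm (f n x - g x))\<^sup>2) \<partial>M)"
        by (rule nn_integral_eq_integral[symmetric, OF square_integrableD(2)[OF square_integrable_diff(1)[OF f g]]]) auto
      also have "\<dots> \<le> ennreal (e / 2)" by (rule bound[OF N n])
      finally have "(\<integral>x. (norm (f n x - g x))\<^sup>2 \<partial>M) \<le> e / 2" using e by (simp add: ennreal_le_iff)
      moreover have "(\<integral>x. (norm (f n x - g x))\<^sup>2 \<partial>M) \<ge> 0" by (rule Bochner_Integration.integral_nonneg) simp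
      ultimately show "dist (\<integral>x. (norm (f n x - g x))\<^sup>2 \<partial>M) 0 < e" using e by (simp add: dist_real_def)
    qed
  qed
  with g show thesis by (rule that)
qed

section \<open>Gradients and curls in L^2\<close>

lemma square_integrable_grad:
  assumes "test_fun \<phi>" shows "square_integrable lebesgue (grad \<phi>)"
proof -
  obtain R where R: "R > 0" "\<And>x. norm x \<ge> R \<Longrightarrow> \<phi> x = 0" "\<And>x. norm x \<ge> R \<Longrightarrow> grad \<phi> x = 0"
    using test_fun_bounded_support[OF assms] by metis
  have "integrable lebesgue (\<lambda>x. (norm (grad \<phi> x))\<^sup>2)"
    by (rule integrable_lebesgue_continuous_compact_support[of _ R])
      (use R in \<open>auto intro!: continuous_intros continuous_on_grad assms\<close>)
  moreover have "grad \<phi> \<in> borel_measurable lebesgue"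
    by (intro measurable_completion)
      (simp add: borel_measurable_continuous_onI[OF continuous_on_grad[OF assms]])
  ultimately show ?thesis by (simp add: square_integrable_def)
qed

text \<open>Each coefficient of \<open>e\<close> is an antisymmetric pair of products of directional
  components. For two gradients the integrals of such a pair cancel by
  \<open>grad_grad_symmetric\<close>, which is the weak form of curl grad = 0.\<close>

lemma cross3_inner_eq_sum:
  "cross3 a b \<bullet> e = (e$1) * ((a \<bullet> axis 2 1) * (b \<bullet> axis 3 1) - (a \<bullet> axis 3 1) * (b \<bullet> axis 2 1))
     + (e$2) * ((a \<bullet> axis 3 1) * (b \<bullet> axis 1 1) - (a \<bullet> axis 1 1) * (b \<bullet> axis 3 1))
     + (e$3) * ((a \<bullet> axis 1 1) * (b \<bullet> axis 2 1) - (a \<bullet> axis 2 1) * (b \<bullet> axis 1 1))"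
  unfolding inner_axis by (simp add: cross3_def inner_vec_def sum_3 algebra_simps)

lemma integral_curl_grad:
  assumes \<phi>: "test_fun \<phi>" and \<psi>: "test_fun \<psi>"
  shows "(\<integral>x. cross3 (grad \<psi> x) (grad \<phi> x) \<bullet> e \<partial>lebesgue) = 0"
proof -
  note int = integrable_grad_grad[OF \<phi> \<psi>]
  show ?thesis
    unfolding cross3_inner_eq_sum using int
    by (simp add: grad_grad_symmetric[OF \<phi> \<psi>, of "axis 3 1" "axis 2 1"]
      grad_grad_symmetric[OF \<phi> \<psi>, of "axis 1 1" "axis 3 1"] grad_grad_symmetric[OF \<phi> \<psi>, of "axis 2 1" "axis 1 1"])
qed

lemma square_integrable_cross3:
  assumes f: "square_integrable M f"
  shows "square_integrable M (\<lambda>x. cross3 e (f x))"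
  unfolding square_integrable_def
proof
  have [measurable]: "f \<in> borel_measurable M" by (rule square_integrableD(1)[OF f])
  have "continuous_on UNIV (\<lambda>y. cross3 e y)" by (intro continuous_on_cross continuous_intros)
  then show m: "(\<lambda>x. cross3 e (f x)) \<in> borel_measurable M"
    by (rule borel_measurable_continuous_on) measurable
  show "integrable M (\<lambda>x. (norm (cross3 e (f x)))\<^sup>2)"
  proof (rule Bochner_Integration.integrable_bound)
    show "integrable M (\<lambda>x. (norm e)\<^sup>2 * (norm (f x))\<^sup>2)" using square_integrableD(2)[OF f] by simp
    show "AE x in M. norm ((norm (cross3 e (f x)))\<^sup>2) \<le> norm ((norm e)\<^sup>2 * (norm (f x))\<^sup>2)"
    proof (rule AE_I2)
      fix x
      have "(norm (cross3 e (f x)))\<^sup>2 + (e \<bullet> f x)\<^sup>2 = (norm e * norm (f x))\<^sup>2"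
        by (rule norm_cross_dot)
      then show "norm ((norm (cross3 e (f x)))\<^sup>2) \<le> norm ((norm e)\<^sup>2 * (norm (f x))\<^sup>2)"
        by (simp add: power_mult_distrib) (metis le_add_same_cancel1 zero_le_power2)
    qed
  qed (use m in measurable)
qed

lemma cross3_inner_left: "cross3 p q \<bullet> e = p \<bullet> cross3 q e"
  by (simp add: cross3_def inner_vec_def sum_3 algebra_simps)

lemma integrable_cross3_inner:
  assumes f: "square_integrable M f" and g: "square_integrable M g"
  shows "integrable M (\<lambda>x. cross3 (f x) (g x) \<bullet> e)"
proof -
  have "square_integrable M (\<lambda>x. cross3 (g x) e)"
    using square_integrable_scale[OF square_integrable_cross3[OF g, of e], of "-1"]
    by (simp add: cross_skew[of e])
  from square_integrable_inner[OF f this] show ?thesis unfolding cross3_inner_left .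
qed

lemma square_integrable_indicator:
  assumes "S \<in> lmeasurable" shows "square_integrable lebesgue (indicator S :: _ \<Rightarrow> real)"
proof -
  have eq: "(norm (indicator S x :: real))\<^sup>2 = indicator S x" for x
    by (simp add: indicator_def)
  have "integrable lebesgue (indicator S :: _ \<Rightarrow> real)"
    using assms lmeasurable_iff_integrable by blast
  then show ?thesis unfolding square_integrable_def eq by simp
qed

text \<open>Hilbert's projection argument carried out with a minimizing sequence, because the
  gradients of test functions are not a closed subspace. The divergence equation is the vanishing
  first variation of \<open>J\<close>; the curl equation holds for every gradient and survives the
  L^2 limit. The sequence \<open>\<phi>\<close> is part of the result because it later supplies
  nearly optimal test functions.\<close>

lemma exists_L2_gradient_projection:
  fixes u :: "real^3 \<Rightarrow> real^3"
  assumes u: "square_integrable lebesgue u"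
  obtains h \<phi> where "square_integrable lebesgue h" "\<And>n::nat. test_fun (\<phi> n)"
    "(\<lambda>n. \<integral>x. (norm (grad (\<phi> n) x - h x))\<^sup>2 \<partial>lebesgue) \<longlonglongrightarrow> 0"
    "\<And>\<psi>. test_fun \<psi> \<Longrightarrow> (\<integral>x. grad \<psi> x \<bullet> (u x + h x) \<partial>lebesgue) = 0"
    "\<And>\<psi> e. test_fun \<psi> \<Longrightarrow> (\<integral>x. cross3 (grad \<psi> x) (h x) \<bullet> e \<partial>lebesgue) = 0"
proof -
  define J where "J \<phi> = (\<integral>x. (norm (u x + grad \<phi> x))\<^sup>2 \<partial>lebesgue)" for \<phi>
  define d where "d = (INF \<phi>\<in>Collect test_fun. J \<phi>)"
  have J0: "J \<phi> \<ge> 0" for \<phi> unfolding J_def by (rule Bochner_Integration.integral_nonneg) simp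
  have dle: "d \<le> J \<phi>" if "test_fun \<phi>" for \<phi>
    unfolding d_def using that J0 by (intro cINF_lower) (auto intro!: bdd_belowI2)
  have "\<exists>\<phi>. test_fun \<phi> \<and> J \<phi> < d + 1 / real (Suc n)" for n
  proof -
    have "(INF \<phi>\<in>Collect test_fun. J \<phi>) < d + 1 / real (Suc n)" unfolding d_def by simp
    then show ?thesis
      by (subst (asm) cINF_less_iff) (use J0 test_fun_0 in \<open>auto intro!: bdd_belowI2\<close>)
  qed
  then obtain \<phi> where \<phi>: "\<And>n. test_fun (\<phi> n)" "\<And>n. J (\<phi> n) < d + 1 / real (Suc n)" by metis
  have gs: "square_integrable lebesgue (grad (\<phi> n))" for n by (rule square_integrable_grad[OF \<phi>(1)])
  have par: "(\<integral>x. (norm (grad (\<phi> m) x - grad (\<phi> n) x))\<^sup>2 \<partial>lebesgue) \<le> 2 / real (Suc m) + 2 / real (Suc n)" for m n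
  proof -
    define a b where "a x = u x + grad (\<phi> m) x" and "b x = u x + grad (\<phi> n) x" for x
    have a: "square_integrable lebesgue a" and b: "square_integrable lebesgue b"
      unfolding a_def b_def by (intro square_integrable_add u gs)+
    \<comment> \<open>The mean of two competitors is a competitor. Comparing \<open>J c\<close> with
      the infimum \<open>d\<close> in the parallelogram identity makes the sequence Cauchy.\<close>
    define c where "c = (\<lambda>x. (1/2) * (\<phi> m x + \<phi> n x))"
    have c: "test_fun c" unfolding c_def by (intro test_fun_scale test_fun_add \<phi>)
    have "grad c x = (1/2) *\<^sub>R (grad (\<phi> m) x + grad (\<phi> n) x)" for x
      unfolding c_def by (simp only: grad_scale[OF test_fun_add[OF \<phi>(1) \<phi>(1)]] grad_add[OF \<phi>(1) \<phi>(1)])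
    then have "u x + grad c x = (1/2) *\<^sub>R (a x + b x)" for x
      unfolding a_def b_def by (simp add: vec_eq_iff field_simps)
    then have "J c = (\<integral>x. (norm (a x + b x))\<^sup>2 \<partial>lebesgue) / 4"
      unfolding J_def by (simp add: power_divide)
    then have "4 * d \<le> (\<integral>x. (norm (a x + b x))\<^sup>2 \<partial>lebesgue)" using dle[OF c] by simp
    moreover have "(\<integral>x. (norm (a x - b x))\<^sup>2 \<partial>lebesgue) + (\<integral>x. (norm (a x + b x))\<^sup>2 \<partial>lebesgue) = 2 * J (\<phi> m) + 2 * J (\<phi> n)"
    proof -
      have "J (\<phi> m) = (\<integral>x. (norm (a x))\<^sup>2 \<partial>lebesgue)" "J (\<phi> n) = (\<integral>x. (norm (b x))\<^sup>2 \<partial>lebesgue)"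
        by (simp_all add: J_def a_def b_def)
      then show ?thesis
        unfolding square_integrable_add(2)[OF a b] square_integrable_diff(2)[OF a b] by simp
    qed
    ultimately have "(\<integral>x. (norm (a x - b x))\<^sup>2 \<partial>lebesgue) \<le> 2 / real (Suc m) + 2 / real (Suc n)"
      using \<phi>(2)[of m] \<phi>(2)[of n] by simp
    then show ?thesis by (simp add: a_def b_def)
  qed
  have cau: "\<exists>N. \<forall>m\<ge>N. \<forall>n\<ge>N. (\<integral>x. (norm (grad (\<phi> m) x - grad (\<phi> n) x))\<^sup>2 \<partial>lebesgue) \<le> e" if e: "e > 0" for e
  proof -
    obtain N :: nat where N: "4 / e < real N" using reals_Archimedean2 by blast
    show ?thesis
    proof (intro exI allI impI)
      fix m n assume mn: "N \<le> m" "N \<le> n"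
      have "2 / real (Suc k) \<le> e / 2" if "N \<le> k" for k
      proof -
        have "4 / e \<le> real (Suc k)" using N that by linarith
        then show ?thesis using e by (simp add: field_simps)
      qed
      from this[OF mn(1)] this[OF mn(2)] par[of m n]
      show "(\<integral>x. (norm (grad (\<phi> m) x - grad (\<phi> n) x))\<^sup>2 \<partial>lebesgue) \<le> e" by linarith
    qed
  qed
  obtain h where h: "square_integrable lebesgue h"
      "(\<lambda>n. \<integral>x. (norm (grad (\<phi> n) x - h x))\<^sup>2 \<partial>lebesgue) \<longlonglongrightarrow> 0"
    by (rule square_integrable_complete[where f="\<lambda>n. grad (\<phi> n)" and M=lebesgue, OF gs cau], assumption, rule that)
  show thesis
  proof (rule that[of h \<phi>, OF h(1) \<phi>(1) h(2)])
    fix \<psi> assume \<psi>: "test_fun \<psi>"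
    have g\<psi>: "square_integrable lebesgue (grad \<psi>)" by (rule square_integrable_grad[OF \<psi>])
    define C where "C = (\<integral>x. (norm (grad \<psi> x))\<^sup>2 \<partial>lebesgue)"
    have C: "C \<ge> 0" unfolding C_def by (rule Bochner_Integration.integral_nonneg) simp
    define b where "b n = (\<integral>x. (u x + grad (\<phi> n) x) \<bullet> grad \<psi> x \<partial>lebesgue)" for n
    define B where "B = (\<integral>x. (u x + h x) \<bullet> grad \<psi> x \<partial>lebesgue)"
    have bB: "b \<longlonglongrightarrow> B"
      unfolding b_def B_def
      by (rule integral_inner_tendsto_L2) (use h u gs g\<psi> in \<open>auto intro: square_integrable_add\<close>)
    \<comment> \<open>First variation at near minimizers: \<open>\<phi> n\<close> misses the infimum
      by less than \<open>1 / real (Suc n)\<close>, and this slack vanishes in the limit.\<close>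
    have "0 \<le> 2 * t * B + t\<^sup>2 * C" for t
    proof -
      have "0 \<le> 1 / real (Suc n) + 2 * t * b n + t\<^sup>2 * C" for n
      proof -
        have s: "square_integrable lebesgue (\<lambda>x. u x + grad (\<phi> n) x)" by (intro square_integrable_add u gs)
        have "d \<le> J (\<lambda>x. \<phi> n x + t * \<psi> x)" by (intro dle test_fun_add test_fun_scale \<phi> \<psi>)
        also have "\<dots> = (\<integral>x. (norm ((u x + grad (\<phi> n) x) + t *\<^sub>R grad \<psi> x))\<^sup>2 \<partial>lebesgue)"
          unfolding J_def by (simp add: grad_add grad_scale test_fun_scale \<phi> \<psi> add.assoc)
        also have "\<dots> = J (\<phi> n) + 2 * t * b n + t\<^sup>2 * C"
          unfolding square_integrable_add(2)[OF s square_integrable_scale[OF g\<psi>]] J_def b_def C_def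
          by (simp add: power_mult_distrib)
        finally show ?thesis using \<phi>(2)[of n] by simp
      qed
      moreover have "(\<lambda>n. 1 / real (Suc n) + 2 * t * b n + t\<^sup>2 * C) \<longlonglongrightarrow> 0 + 2 * t * B + t\<^sup>2 * C"
        by (intro tendsto_intros bB LIMSEQ_Suc[OF lim_1_over_n])
      ultimately show ?thesis using LIMSEQ_le_const[of _ "0 + 2 * t * B + t\<^sup>2 * C" 0] by auto
    qed
    then have "B = 0" using C by (rule nonneg_quadratic_linear_coeff)
    then show "(\<integral>x. grad \<psi> x \<bullet> (u x + h x) \<partial>lebesgue) = 0" by (simp add: B_def inner_commute)
    fix e :: "real^3"
    \<comment> \<open>The triple product isolates the factor that converges and leaves the fixed
      field \<open>cross3 e (grad \<psi> x)\<close> to test against.\<close>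
    have tri: "cross3 a b \<bullet> e = b \<bullet> cross3 e a" for a b
      by (simp add: cross3_def inner_vec_def sum_3 algebra_simps)
    have "(\<lambda>n. \<integral>x. grad (\<phi> n) x \<bullet> cross3 e (grad \<psi> x) \<partial>lebesgue) \<longlonglongrightarrow> (\<integral>x. h x \<bullet> cross3 e (grad \<psi> x) \<partial>lebesgue)"
      by (rule integral_inner_tendsto_L2[OF gs h(1) square_integrable_cross3[OF g\<psi>] h(2)])
    moreover have "(\<integral>x. grad (\<phi> n) x \<bullet> cross3 e (grad \<psi> x) \<partial>lebesgue) = 0" for n
      using integral_curl_grad[OF \<phi>(1) \<psi>, of n e] unfolding tri .
    ultimately show "(\<integral>x. cross3 (grad \<psi> x) (h x) \<bullet> e \<partial>lebesgue) = 0"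
      unfolding tri using LIMSEQ_unique[OF _ tendsto_const] by simp
  qed
qed

subsection \<open>Uniqueness of the demagnetizing field\<close>

text \<open>Dominated convergence: on the interval of radius \<open>d\<close> around
  \<open>s0\<close>, the mean value inequality bounds the difference quotients by
  \<open>w\<close>.\<close>

lemma has_real_derivative_integral:
  fixes F F' :: "real \<Rightarrow> 'a \<Rightarrow> real"
  assumes d: "d > 0"
    and D: "\<And>s x. \<bar>s - s0\<bar> < d \<Longrightarrow> ((\<lambda>s. F s x) has_real_derivative F' s x) (at s)"
    and bd: "\<And>s x. \<bar>s - s0\<bar> < d \<Longrightarrow> \<bar>F' s x\<bar> \<le> w x"
    and w: "integrable M w"
    and F: "\<And>s. \<bar>s - s0\<bar> < d \<Longrightarrow> integrable M (F s)"
    and m: "F' s0 \<in> borel_measurable M"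
  shows "((\<lambda>s. \<integral>x. F s x \<partial>M) has_real_derivative (\<integral>x. F' s0 x \<partial>M)) (at s0)"
  unfolding DERIV_def tendsto_at_iff_sequentially
proof (intro allI impI)
  fix X :: "nat \<Rightarrow> real" assume X: "\<forall>i. X i \<in> UNIV - {0}" "X \<longlonglongrightarrow> 0"
  from X(2) d have "\<forall>\<^sub>F n in sequentially. dist (X n) 0 < d" by (rule tendstoD)
  then obtain N where N: "\<And>n. n \<ge> N \<Longrightarrow> \<bar>X n\<bar> < d" by (auto simp: eventually_sequentially)
  define Y where "Y n = X (n + N)" for n
  have Y: "\<bar>Y n\<bar> < d" "Y n \<noteq> 0" for n using N X(1) by (auto simp: Y_def)
  have Y0: "Y \<longlonglongrightarrow> 0" unfolding Y_def using X(2) by (rule LIMSEQ_ignore_initial_segment)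
  have I: "integrable M (F (s0 + Y n))" "integrable M (F s0)" for n using Y(1)[of n] d by (auto intro!: F)
  have [measurable]: "F (s0 + Y n) \<in> borel_measurable M" "F s0 \<in> borel_measurable M" "F' s0 \<in> borel_measurable M" for n
    using I m by auto
  have "(\<lambda>n. \<integral>x. (F (s0 + Y n) x - F s0 x) / Y n \<partial>M) \<longlonglongrightarrow> (\<integral>x. F' s0 x \<partial>M)"
  proof (rule integral_dominated_convergence[OF _ _ w])
    show "AE x in M. (\<lambda>n. (F (s0 + Y n) x - F s0 x) / Y n) \<longlonglongrightarrow> F' s0 x"
    proof (rule AE_I2)
      fix x
      have "((\<lambda>h. (F (s0 + h) x - F s0 x) / h) \<longlongrightarrow> F' s0 x) (at 0)"
        using D[of s0 x] d by (simp add: DERIV_def)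
      moreover have "filterlim Y (at 0) sequentially" using Y(2) Y0 by (simp add: filterlim_at)
      ultimately show "(\<lambda>n. (F (s0 + Y n) x - F s0 x) / Y n) \<longlonglongrightarrow> F' s0 x"
        by (rule filterlim_compose)
    qed
    show "AE x in M. norm ((F (s0 + Y n) x - F s0 x) / Y n) \<le> w x" for n
    proof (rule AE_I2)
      fix x
      have "norm (F (s0 + Y n) x - F s0 x) \<le> w x * norm ((s0 + Y n) - s0)"
      proof (rule field_differentiable_bound[of "{s. \<bar>s - s0\<bar> < d}" "\<lambda>s. F s x" "\<lambda>s. F' s x"])
        have "{s. \<bar>s - s0\<bar> < d} = ball s0 d" by (auto simp: dist_real_def)
        then show "convex {s. \<bar>s - s0\<bar> < d}" by simp
      qed (use D bd Y d in \<open>auto intro: DERIV_subset\<close>)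
      then show "norm ((F (s0 + Y n) x - F s0 x) / Y n) \<le> w x"
        using Y(2)[of n] by (simp add: divide_le_eq)
    qed
  qed measurable
  then have "(\<lambda>n. ((\<integral>x. F (s0 + Y n) x \<partial>M) - (\<integral>x. F s0 x \<partial>M)) / Y n) \<longlonglongrightarrow> (\<integral>x. F' s0 x \<partial>M)"
    using I by simp
  then show "((\<lambda>h. ((\<integral>x. F (s0 + h) x \<partial>M) - (\<integral>x. F s0 x \<partial>M)) / h) \<circ> X) \<longlonglongrightarrow> (\<integral>x. F' s0 x \<partial>M)"
    unfolding comp_def Y_def by (rule LIMSEQ_offset)
qed

section \<open>Liouville's theorem through averages over radial bumps\<close>

lemma radial_bump_support:
  assumes "s > 0" "bump n (1 - s * ((x - a) \<bullet> (x - a))) \<noteq> 0"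
  shows "norm (x - a) \<le> sqrt (1 / s)"
proof -
  have "1 - s * ((x - a) \<bullet> (x - a)) > 0"
    using assms(2) bump_nonpos linorder_not_le by blast
  then have "(norm (x - a))\<^sup>2 \<le> 1 / s"
    using assms(1) by (simp add: power2_norm_eq_inner field_simps)
  then show ?thesis by (simp add: real_le_rsqrt)
qed

lemma square_integrable_radial_bump:
  fixes a :: "'a::euclidean_space"
  assumes s: "s > 0" shows "square_integrable lebesgue (\<lambda>x. bump n (1 - s * ((x - a) \<bullet> (x - a))))"
proof -
  let ?f = "\<lambda>x. bump n (1 - s * ((x - a) \<bullet> (x - a)))"
  have c: "continuous_on UNIV ?f" by (intro continuous_intros)
  have "integrable lebesgue (\<lambda>x. (norm (?f x))\<^sup>2)"
  proof (rule integrable_lebesgue_continuous_compact_support[of _ "norm a + sqrt (1/s) + 1"])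
    show "continuous_on UNIV (\<lambda>x. (norm (?f x))\<^sup>2)" by (intro continuous_intros c)
    fix x :: 'a assume x: "norm a + sqrt (1/s) + 1 \<le> norm x"
    have "?f x = 0"
    proof (rule ccontr)
      assume "?f x \<noteq> 0"
      from radial_bump_support[OF s this] norm_triangle_ineq2[of x a] x show False by simp
    qed
    then show "(norm (?f x))\<^sup>2 = 0" by (simp only: norm_zero power_zero_numeral)
  qed
  moreover have "?f \<in> borel_measurable lebesgue"
    using borel_measurable_continuous_onI[OF c] by (intro measurable_completion) simp
  ultimately show ?thesis by (simp add: square_integrable_def)
qed

text \<open>With \<open>G s\<close> the integral in the conclusion, the hypothesis reads \<open>3 G + 2 s G' = 0\<close>, so
  \<open>s\<^sup>3 G(s)\<^sup>2\<close> is constant, and it tends to 0 as \<open>s \<rightarrow> 0\<close> by the Cauchy-Schwarz inequality.\<close>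

lemma weakly_harmonic_bump_average_zero:
  fixes f :: "real^3 \<Rightarrow> real"
  assumes f: "square_integrable lebesgue f"
    and harm: "\<And>s. s > 0 \<Longrightarrow> (\<integral>x. (3 * bump 2 (1 - s * ((x - a) \<bullet> (x - a)))
        - 2 * s * ((x - a) \<bullet> (x - a)) * (bump 4 (1 - s * ((x - a) \<bullet> (x - a)))
           - 2 * bump 3 (1 - s * ((x - a) \<bullet> (x - a))))) * f x \<partial>lebesgue) = 0"
    and s: "s > 0"
  shows "(\<integral>x. bump 2 (1 - s * ((x - a) \<bullet> (x - a))) * f x \<partial>lebesgue) = 0"
proof -
  define q where "q s x = 1 - s * ((x - a) \<bullet> (x - a))" for s and x :: "real^3"
  define D where "D s x = (bump 4 (q s x) - 2 * bump 3 (q s x)) * ((x - a) \<bullet> (x - a))" for s x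
  define G where "G s = (\<integral>x. bump 2 (q s x) * f x \<partial>lebesgue)" for s
  define H where "H s = (\<integral>x. D s x * f x \<partial>lebesgue)" for s
  have fm [measurable]: "f \<in> borel_measurable lebesgue" by (rule square_integrableD(1)[OF f])
  have intf: "integrable lebesgue (\<lambda>x. indicator (cball a r) x * \<bar>f x\<bar>)" for r
  proof -
    have "square_integrable lebesgue (indicator (cball a r) :: _ \<Rightarrow> real)"
      by (rule square_integrable_indicator) simp
    moreover have "square_integrable lebesgue (\<lambda>x. \<bar>f x\<bar>)" using f by (simp add: square_integrable_def)
    ultimately show ?thesis by (auto dest: square_integrable_inner)
  qed
  obtain B3 where B3: "B3 > 0" "\<And>t. t \<le> 1 \<Longrightarrow> \<bar>bump 3 t\<bar> \<le> B3" by (rule bump_bounded) (rule that)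
  obtain B4 where B4: "B4 > 0" "\<And>t. t \<le> 1 \<Longrightarrow> \<bar>bump 4 t\<bar> \<le> B4" by (rule bump_bounded) (rule that)
  obtain B2 where B2: "B2 > 0" "\<And>t. t \<le> 1 \<Longrightarrow> \<bar>bump 2 t\<bar> \<le> B2" by (rule bump_bounded) (rule that)
  have q1: "q s x \<le> 1" if "s > 0" for s x using that by (simp add: q_def)
  have qc: "continuous_on UNIV (q s)" for s unfolding q_def by (intro continuous_intros)
  have Dc: "continuous_on UNIV (D s)" for s
    unfolding D_def by (intro continuous_intros qc)
  have Dm [measurable]: "D s \<in> borel_measurable lebesgue" for s
    using borel_measurable_continuous_onI[OF Dc] by (intro measurable_completion) simp
  \<comment> \<open>\<open>D\<close> is minus the derivative of \<open>bump 2 (q s x)\<close> in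
    \<open>s\<close>. On the support its quadratic factor is at most \<open>1 / s\<close>.\<close>
  have Db: "\<bar>D s x\<bar> \<le> (B4 + 2 * B3) * (1 / s) * indicator (cball a (sqrt (1 / s))) x" if "s > 0" for s x
  proof (cases "norm (x - a) \<le> sqrt (1 / s)")
    case True
    then have "(norm (x - a))\<^sup>2 \<le> 1 / s"
      using power_mono[OF True, of 2] that by simp
    then have r: "(x - a) \<bullet> (x - a) \<le> 1 / s" by (simp add: power2_norm_eq_inner)
    have "\<bar>bump 4 (q s x) - 2 * bump 3 (q s x)\<bar> \<le> B4 + 2 * B3"
      using B4(2)[OF q1[OF that, of x]] B3(2)[OF q1[OF that, of x]] by linarith
    then have "\<bar>D s x\<bar> \<le> (B4 + 2 * B3) * (1 / s)"
      unfolding D_def abs_mult using r B3(1) B4(1) by (intro mult_mono) auto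
    then show ?thesis using True by (simp add: dist_norm norm_minus_commute)
  next
    case False
    then have "bump 4 (q s x) = 0" "bump 3 (q s x) = 0"
      using radial_bump_support[OF that] unfolding q_def by blast+
    then show ?thesis using B3(1) B4(1) that by (simp add: D_def)
  qed
  have intD: "integrable lebesgue (\<lambda>x. D s x * f x)" if "s > 0" for s
  proof (rule Bochner_Integration.integrable_bound)
    show "integrable lebesgue (\<lambda>x. (B4 + 2 * B3) * (1 / s) * (indicator (cball a (sqrt (1 / s))) x * \<bar>f x\<bar>))"
      by (intro integrable_mult_right intf)
    show "AE x in lebesgue. norm (D s x * f x) \<le> norm ((B4 + 2 * B3) * (1 / s) * (indicator (cball a (sqrt (1 / s))) x * \<bar>f x\<bar>))"
    proof (rule AE_I2)
      fix x
      have "\<bar>D s x\<bar> * \<bar>f x\<bar> \<le> (B4 + 2 * B3) * (1 / s) * indicator (cball a (sqrt (1 / s))) x * \<bar>f x\<bar>"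
        by (rule mult_right_mono[OF Db[OF that]]) simp
      also have "\<dots> = (B4 + 2 * B3) * (1 / s) * (indicator (cball a (sqrt (1 / s))) x * \<bar>f x\<bar>)"
        by (simp only: mult.assoc)
      also have "\<dots> \<le> \<bar>(B4 + 2 * B3) * (1 / s) * (indicator (cball a (sqrt (1 / s))) x * \<bar>f x\<bar>)\<bar>"
        by (rule abs_ge_self)
      finally show "norm (D s x * f x) \<le> norm ((B4 + 2 * B3) * (1 / s) * (indicator (cball a (sqrt (1 / s))) x * \<bar>f x\<bar>))"
        by (simp only: real_norm_def abs_mult[of "D s x" "f x"])
    qed
  qed measurable
  have b2: "square_integrable lebesgue (\<lambda>x. bump 2 (q s x))" if "s > 0" for s
    unfolding q_def by (rule square_integrable_radial_bump[OF that])
  have intG: "integrable lebesgue (\<lambda>x. bump 2 (q s x) * f x)" if "s > 0" for s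
    using square_integrable_inner[OF b2[OF that] f] by simp
  have ode: "3 * G s = 2 * s * H s" if "s > 0" for s
  proof -
    have "0 = (\<integral>x. 3 * (bump 2 (q s x) * f x) - 2 * s * (D s x * f x) \<partial>lebesgue)"
      unfolding harm[OF that, symmetric] q_def D_def
      by (rule Bochner_Integration.integral_cong) (simp_all add: algebra_simps)
    also have "\<dots> = 3 * G s - 2 * s * H s"
      unfolding G_def H_def using intG[OF that] intD[OF that] by simp
    finally show ?thesis by simp
  qed
  have G': "(G has_real_derivative - H s) (at s)" if s: "s > 0" for s
  proof -
    \<comment> \<open>The radius \<open>s/2\<close> keeps \<open>t\<close> above \<open>s/2\<close>,
      so \<open>1 / t \<le> 2 / s\<close> and one ball contains all the supports.\<close>
    have "(G has_real_derivative (\<integral>x. - (D s x * f x) \<partial>lebesgue)) (at s)"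
      unfolding G_def
    proof (rule has_real_derivative_integral[where d="s/2" and F'="\<lambda>s x. - (D s x * f x)"
          and w="\<lambda>x. (B4 + 2 * B3) * (2 / s) * (indicator (cball a (sqrt (2 / s))) x * \<bar>f x\<bar>)"])
      fix t x assume t: "\<bar>t - s\<bar> < s/2"
      then have t0: "t > s/2" by (simp add: abs_if split: if_splits)
      have e: "2 + 2 = (4::nat)" "2 + 1 = (3::nat)" "of_nat 2 = (2::real)" by simp_all
      have "((\<lambda>t. q t x) has_real_derivative - ((x - a) \<bullet> (x - a))) (at t)"
        unfolding q_def by (auto intro!: derivative_eq_intros)
      from DERIV_chain2[OF bump_deriv[of 2 "q t x"] this]
      have "((\<lambda>t. bump 2 (q t x)) has_real_derivative (bump 4 (q t x) - 2 * bump 3 (q t x)) * - ((x - a) \<bullet> (x - a))) (at t)"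
        unfolding e .
      from DERIV_cmult_right[OF this, of "f x"]
      show "((\<lambda>t. bump 2 (q t x) * f x) has_real_derivative - (D t x * f x)) (at t)"
        by (simp add: D_def algebra_simps)
      have "1 / t \<le> 2 / s" using t0 s by (simp add: field_simps)
      have "\<bar>D t x\<bar> \<le> (B4 + 2 * B3) * (1 / t) * indicator (cball a (sqrt (1 / t))) x"
        using t0 s by (intro Db) simp
      also have "\<dots> \<le> (B4 + 2 * B3) * (2 / s) * indicator (cball a (sqrt (2 / s))) x"
      proof (intro mult_mono)
        have "cball a (sqrt (1 / t)) \<subseteq> cball a (sqrt (2 / s))"
          using \<open>1 / t \<le> 2 / s\<close> by (intro subset_cball) simp
        then show "indicator (cball a (sqrt (1 / t))) x \<le> (indicator (cball a (sqrt (2 / s))) x :: real)"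
          by (intro indicator_leI) blast
      qed (use \<open>1 / t \<le> 2 / s\<close> B3 B4 s t0 in auto)
      finally have "\<bar>D t x\<bar> * \<bar>f x\<bar> \<le> (B4 + 2 * B3) * (2 / s) * indicator (cball a (sqrt (2 / s))) x * \<bar>f x\<bar>"
        by (rule mult_right_mono) simp
      then show "\<bar>- (D t x * f x)\<bar> \<le> (B4 + 2 * B3) * (2 / s) * (indicator (cball a (sqrt (2 / s))) x * \<bar>f x\<bar>)"
        by (simp only: abs_minus_cancel abs_mult mult.assoc)
    next
      show "integrable lebesgue (\<lambda>x. (B4 + 2 * B3) * (2 / s) * (indicator (cball a (sqrt (2 / s))) x * \<bar>f x\<bar>))"
        by (intro integrable_mult_right intf)
      fix t assume "\<bar>t - s\<bar> < s/2"
      then have "t > 0" using s by (simp add: abs_if split: if_splits)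
      then show "integrable lebesgue (\<lambda>x. bump 2 (q t x) * f x)" by (rule intG)
    qed (use s in simp, measurable)
    then show ?thesis unfolding H_def by simp
  qed
  \<comment> \<open>The equation makes \<open>G\<close> behave like a multiple of \<open>s\<close>
    to the power -3/2; squaring gives an integer exponent.\<close>
  define K where "K s = s^3 * (G s)\<^sup>2" for s
  have K': "(K has_real_derivative 0) (at s)" if s: "s > 0" for s
  proof -
    have "(K has_real_derivative (3 * s\<^sup>2 * (G s)\<^sup>2 + s^3 * (2 * G s * (- H s)))) (at s)"
      unfolding K_def using G'[OF s]
      by (auto intro!: derivative_eq_intros simp: algebra_simps)
    also have "3 * s\<^sup>2 * (G s)\<^sup>2 + s^3 * (2 * G s * (- H s)) = s\<^sup>2 * G s * (3 * G s - 2 * s * H s)"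
      by (simp add: power2_eq_square power3_eq_cube algebra_simps)
    finally show ?thesis using ode[OF s] by simp
  qed
  have Kc: "K t = K s" if "t > 0" for t
  proof -
    have "\<exists>c. \<forall>x\<in>{0<..}. K x = c"
    proof (rule has_field_derivative_zero_constant)
      fix x :: real assume "x \<in> {0<..}"
      then show "(K has_real_derivative 0) (at x within {0<..})"
        using K'[of x] by (auto intro: DERIV_subset)
    qed simp
    then show ?thesis using s that by auto
  qed
  \<comment> \<open>The 8 is the cube of the 2 in the radius \<open>2 / t\<close>: doubling the
    support radius \<open>1 / t\<close> places the closed support inside an open ball.\<close>
  define C where "C = B2\<^sup>2 * (unit_ball_vol 3 * 8) * (\<integral>x. (norm (f x))\<^sup>2 \<partial>lebesgue)"
  have C0: "C \<ge> 0" unfolding C_def by (intro mult_nonneg_nonneg Bochner_Integration.integral_nonneg) auto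
  \<comment> \<open>At scale \<open>t\<^sup>2\<close> the support has radius \<open>1 / t\<close>,
    hence volume of order \<open>1 / t^3\<close>, against the factor \<open>t^6\<close> in
    \<open>K\<close>. The resulting \<open>C * t^3\<close> is weakened to \<open>C * t\<close>,
    which still tends to 0.\<close>
  have Kle: "K s \<le> C * t" if t: "0 < t" "t \<le> 1" for t
  proof -
    have t2: "t\<^sup>2 > 0" using t by simp
    have sq: "sqrt (1 / t\<^sup>2) = 1 / t" using t by (simp add: real_sqrt_divide)
    have "(\<integral>x. (norm (bump 2 (q (t\<^sup>2) x)))\<^sup>2 \<partial>lebesgue) \<le> (\<integral>x. B2\<^sup>2 * indicator (ball a (2 / t)) x \<partial>lebesgue)"
    proof (rule integral_mono)
      show "integrable lebesgue (\<lambda>x. (norm (bump 2 (q (t\<^sup>2) x)))\<^sup>2)"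
        by (rule square_integrableD(2)[OF b2[OF t2]])
      show "integrable lebesgue (\<lambda>x. B2\<^sup>2 * indicator (ball a (2 / t)) x)"
        using lmeasurable_iff_integrable[of "ball a (2/t)"] by (intro integrable_mult_right) auto
      fix x
      show "(norm (bump 2 (q (t\<^sup>2) x)))\<^sup>2 \<le> B2\<^sup>2 * indicator (ball a (2 / t)) x"
      proof (cases "x \<in> ball a (2 / t)")
        case True
        then show ?thesis using power_mono[OF B2(2)[OF q1[OF t2, of x]], of 2] by simp
      next
        case False
        have "1 / t < 2 / t" using t by (simp add: divide_strict_right_mono)
        then have "\<not> norm (x - a) \<le> 1 / t" using False by (simp add: dist_norm norm_minus_commute)
        then have "bump 2 (q (t\<^sup>2) x) = 0" using radial_bump_support[OF t2, of 2 x a] unfolding sq q_def by blast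
        then show ?thesis by simp
      qed
    qed
    also have "\<dots> = B2\<^sup>2 * measure lebesgue (ball a (2 / t))" by simp
    also have "measure lebesgue (ball a (2 / t)) = unit_ball_vol 3 * 8 / t^3"
      using t content_ball[of "2 / t" a] by (simp add: power_divide)
    finally have b: "(\<integral>x. (norm (bump 2 (q (t\<^sup>2) x)))\<^sup>2 \<partial>lebesgue) \<le> B2\<^sup>2 * (unit_ball_vol 3 * 8 / t^3)" .
    have "(G (t\<^sup>2))\<^sup>2 \<le> (\<integral>x. (norm (bump 2 (q (t\<^sup>2) x)))\<^sup>2 \<partial>lebesgue) * (\<integral>x. (norm (f x))\<^sup>2 \<partial>lebesgue)"
      using integral_Cauchy_Schwarz[OF b2[OF t2] f] by (simp add: G_def)
    also have "\<dots> \<le> B2\<^sup>2 * (unit_ball_vol 3 * 8 / t^3) * (\<integral>x. (norm (f x))\<^sup>2 \<partial>lebesgue)"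
      by (intro mult_right_mono b Bochner_Integration.integral_nonneg) simp
    also have "\<dots> = C / t^3" by (simp add: C_def)
    finally have "K (t\<^sup>2) \<le> (t\<^sup>2)^3 * (C / t^3)" unfolding K_def by (intro mult_left_mono) auto
    also have "\<dots> = C * t^3" using t by (simp add: eval_nat_numeral field_simps)
    also have "\<dots> \<le> C * t" using t C0 by (intro mult_left_mono) (auto simp: power3_eq_cube mult_le_one intro: mult_left_le_one_le)
    finally show ?thesis using Kc[OF t2] by simp
  qed
  have "K s \<le> 0"
  proof (rule field_le_epsilon)
    fix e :: real assume e: "e > 0"
    define t where "t = min 1 (e / (C + 1))"
    have t: "0 < t" "t \<le> 1" using e C0 by (auto simp: t_def)
    have "C * t \<le> C * (e / (C + 1))" using C0 by (intro mult_left_mono) (auto simp: t_def)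
    also have "\<dots> \<le> e" using C0 e by (simp add: field_simps)
    finally show "K s \<le> 0 + e" using Kle[OF t] by simp
  qed
  then have "(G s)\<^sup>2 \<le> 0" using s by (simp add: K_def mult_le_0_iff)
  then show ?thesis by (simp add: G_def q_def)
qed

section \<open>From vanishing averages to vanishing almost everywhere\<close>

lemma AE_zero_if_box_integrals_zero:
  fixes f :: "'a::euclidean_space \<Rightarrow> real"
  assumes int: "\<And>l u. integrable lborel (\<lambda>x. indicator (box l u) x * f x)"
    and zero: "\<And>l u. (\<integral>x. indicator (box l u) x * f x \<partial>lborel) = 0"
  shows "AE x in lborel. f x = 0"
proof -
  \<comment> \<open>\<open>f\<close> is only locally integrable, so it is cut down to a bounded set.
    A box is used because its intersections with other boxes are boxes, to which the hypotheses
    still apply.\<close>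
  define N where "N n = box (- real n *\<^sub>R One) (real n *\<^sub>R One :: 'a)" for n :: nat
  define g where "g n x = indicator (N n) x * f x" for n x
  have g: "integrable lborel (g n)" for n unfolding g_def N_def by (rule int)
  let ?E = "range (\<lambda>(a, b). box a b :: 'a set)"
  have gA: "(\<integral>x. indicator A x *\<^sub>R g n x \<partial>lborel) = 0" if "A \<in> sets borel" for A n
  proof -
    have Is: "Int_stable ?E" by (auto simp: Int_stable_def box_Int_box)
    have sub: "?E \<subseteq> Pow UNIV" by simp
    have sE: "sets (borel :: 'a measure) = sigma_sets UNIV ?E"
      by (subst borel_eq_box) (simp add: sets_measure_of)
    have I: "integrable lborel (\<lambda>x. indicator A x *\<^sub>R g n x)" if "A \<in> sets borel" for A
      using that by (intro integrable_mult_indicator g) simp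
    have "A \<in> sigma_sets UNIV ?E" using that sE by simp
    from Is sub this show ?thesis
    proof (induction rule: sigma_sets_induct_disjoint)
      case (basic A)
      then obtain l u where A: "A = box l u" by auto
      have "box l u \<inter> N n = box (\<Sum>i\<in>Basis. max (l \<bullet> i) ((- real n *\<^sub>R One) \<bullet> i) *\<^sub>R i)
          (\<Sum>i\<in>Basis. min (u \<bullet> i) ((real n *\<^sub>R One) \<bullet> i) *\<^sub>R i)"
        unfolding N_def by (rule box_Int_box)
      then obtain l' u' where lu: "box l u \<inter> N n = box l' u'" by blast
      have "(\<lambda>x. indicator A x *\<^sub>R g n x) = (\<lambda>x. indicator (box l' u') x * f x)"
        unfolding A g_def lu[symmetric] by (auto simp: indicator_def)
      then show ?case by (simp add: zero)
    next
      case (compl A)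
      then have A: "A \<in> sets borel" using sE by simp
      \<comment> \<open>\<open>N n\<close> is itself a box, so the whole integral vanishes; this
        settles complements.\<close>
      have "(\<integral>x. g n x \<partial>lborel) = 0" unfolding g_def N_def by (rule zero)
      moreover have "(\<lambda>x. indicator (UNIV - A) x *\<^sub>R g n x) = (\<lambda>x. g n x - indicator A x *\<^sub>R g n x)"
        by (auto simp: indicator_def)
      ultimately show ?case using compl(2) I[OF A] g by simp
    next
      case (union A)
      then have A: "A i \<in> sets borel" for i using sE by auto
      have "(\<Union>i. A i) \<in> sets borel" using A by auto
      then have "set_lebesgue_integral lborel (\<Union>i. A i) (g n) = (\<Sum>i. set_lebesgue_integral lborel (A i) (g n))"
        using union(1) A I unfolding set_integrable_def[symmetric]
        by (intro lebesgue_integral_countable_add) (auto simp: disjoint_family_on_def)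
      then show ?case using union(3) by (simp add: set_lebesgue_integral_def)
    qed simp
  qed
  have "AE x in lborel. g n x = 0" for n
    using g by (rule sigma_finite_measure.density_zero[OF lborel.sigma_finite_measure_axioms]) (unfold set_lebesgue_integral_def, rule gA, simp)
  then have "AE x in lborel. \<forall>n. g n x = 0" by (simp add: AE_all_countable)
  then show ?thesis
  proof (rule AE_mp, intro AE_I2 impI)
    fix x :: 'a assume z: "\<forall>n. g n x = 0"
    obtain n :: nat where n: "norm x < real n" using reals_Archimedean2 by blast
    have "x \<in> N n"
      unfolding N_def mem_box
    proof
      fix i :: 'a assume i: "i \<in> Basis"
      then have "\<bar>x \<bullet> i\<bar> < real n" using Basis_le_norm[of i x] n by linarith
      then show "(- real n *\<^sub>R One) \<bullet> i < x \<bullet> i \<and> x \<bullet> i < (real n *\<^sub>R One) \<bullet> i"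
        using i by auto
    qed
    with z[rule_format, of n] show "f x = 0" by (simp add: g_def)
  qed
qed

text \<open>The centre \<open>a\<close> is the variable of integration: this integral is the
  constant that normalises averages over centres.\<close>

lemma integral_radial_bump_pos:
  fixes x :: "'a::euclidean_space"
  assumes s: "s > 0"
  shows "integrable lborel (\<lambda>a. bump n (1 - s * ((x - a) \<bullet> (x - a))))"
    and "(\<integral>a. bump n (1 - s * ((x - a) \<bullet> (x - a))) \<partial>lborel) > 0"
proof -
  let ?f = "\<lambda>a. bump n (1 - s * ((x - a) \<bullet> (x - a)))"
  have c: "continuous_on UNIV ?f" by (intro continuous_intros)
  then have m: "?f \<in> borel_measurable lborel" using borel_measurable_continuous_onI by simp
  have "integrable lebesgue ?f"
  proof (rule integrable_lebesgue_continuous_compact_support[OF c, of "norm x + sqrt (1/s) + 1"])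
    fix a :: 'a assume a: "norm x + sqrt (1/s) + 1 \<le> norm a"
    show "?f a = 0"
    proof (rule ccontr)
      assume "?f a \<noteq> 0"
      from radial_bump_support[OF s this] norm_triangle_ineq2[of a x] a show False
        by (simp add: norm_minus_commute)
    qed
  qed
  then show I: "integrable lborel ?f" by (rule iffD1[OF integrable_completion[OF m]])
  obtain c where c: "c > 0" "\<And>a. a \<in> ball x c \<Longrightarrow> ?f a > 0"
  proof (rule that[of "1 / sqrt s"])
    fix a assume "a \<in> ball x (1 / sqrt s)"
    then have "norm (x - a) < 1 / sqrt s" by (simp add: dist_norm)
    then have "(norm (x - a))\<^sup>2 < (1 / sqrt s)\<^sup>2" by (intro power_strict_mono) auto
    then have "s * ((x - a) \<bullet> (x - a)) < 1" using s
      by (simp add: power2_norm_eq_inner power_divide field_simps)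
    then show "?f a > 0" by (intro bump_pos) simp
  qed (use s in simp)
  show "(\<integral>a. ?f a \<partial>lborel) > 0"
  proof (rule ccontr)
    assume "\<not> ?thesis"
    moreover have "(\<integral>a. ?f a \<partial>lborel) \<ge> 0" by (rule Bochner_Integration.integral_nonneg) (simp add: bump_nonneg)
    ultimately have "(\<integral>a. ?f a \<partial>lborel) = 0" by simp
    then have "AE a in lborel. ?f a = 0"
      using integral_nonneg_eq_0_iff_AE[OF I] by (simp add: bump_nonneg)
    then have "AE a in lborel. a \<notin> ball x c"
      by eventually_elim (use c(2) in fastforce)
    then have "emeasure lborel (ball x c) = 0"
      by (subst (asm) AE_iff_measurable[of "ball x c"]) auto
    moreover have "unit_ball_vol (real DIM('a)) * c ^ DIM('a) > 0" using c(1) by simp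
    ultimately show False using c(1) by (simp add: emeasure_ball ennreal_eq_0_iff)
  qed
qed

text \<open>Averaging the hypothesis over the centres \<open>a\<close> in a box turns the bump into an approximation
  of the indicator function of that box.\<close>

lemma AE_zero_if_bump_averages_zero:
  fixes f :: "'a::euclidean_space \<Rightarrow> real"
  assumes fm [measurable]: "f \<in> borel_measurable borel"
    and loc: "\<And>r. integrable lborel (\<lambda>x. indicator (cball 0 r) x * f x)"
    and zero: "\<And>a s. s > 0 \<Longrightarrow> (\<integral>x. bump m (1 - s * ((x - a) \<bullet> (x - a))) * f x \<partial>lborel) = 0"
  shows "AE x in lborel. f x = 0"
proof (rule AE_zero_if_box_integrals_zero)
  fix l u :: 'a
  let ?Q = "box l u"
  obtain r where r: "?Q \<subseteq> cball 0 r" "r > 0"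
    using bounded_box[of l u] by (auto simp: bounded_pos subset_eq)
  show int: "integrable lborel (\<lambda>x. indicator ?Q x * f x)"
  proof (rule Bochner_Integration.integrable_bound[OF loc[of r]])
    show "AE x in lborel. norm (indicator ?Q x * f x) \<le> norm (indicator (cball 0 r) x * f x)"
      using r by (intro AE_I2) (auto simp: indicator_def)
  qed measurable
  \<comment> \<open>\<open>Suc n\<close> keeps the scales at least 1, so every bump has support
    radius at most 1, and centres in \<open>?Q\<close> see only points of the ball of radius
    \<open>r + 1\<close>.\<close>
  define s where "s n = real (Suc n)" for n
  have s: "s n \<ge> 1" "s n > 0" for n by (auto simp: s_def)
  define \<eta> where "\<eta> n x a = bump m (1 - s n * ((x - a) \<bullet> (x - a)))" for n and x a :: 'a
  have \<eta>0: "\<eta> n x a \<ge> 0" for n x a unfolding \<eta>_def by (rule bump_nonneg)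
  have \<eta>c: "continuous_on UNIV (\<lambda>p. \<eta> n (fst p) (snd p))" for n
    unfolding \<eta>_def by (intro continuous_intros)
  have \<eta>m [measurable]: "(\<lambda>p. \<eta> n (fst p) (snd p)) \<in> borel_measurable (borel \<Otimes>\<^sub>M borel)" for n
    unfolding borel_prod by (rule borel_measurable_continuous_onI[OF \<eta>c])
  have \<eta>mx [measurable]: "(\<lambda>a. \<eta> n x (a + y)) \<in> borel_measurable borel" "\<eta> n x \<in> borel_measurable borel"
    "(\<lambda>x. \<eta> n x y) \<in> borel_measurable borel" for n x y
    unfolding \<eta>_def by (intro borel_measurable_continuous_onI continuous_intros)+
  obtain B where B: "B > 0" "\<And>t. t \<le> 1 \<Longrightarrow> \<bar>bump m t\<bar> \<le> B" by (rule bump_bounded) (rule that)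
  have \<eta>B: "\<bar>\<eta> n x a\<bar> \<le> B" for n x a unfolding \<eta>_def using s[of n] by (intro B) simp
  have supp: "norm (x - a) \<le> sqrt (1 / s n)" if "\<eta> n x a \<noteq> 0" for n x a
    using radial_bump_support[OF s(2)] that unfolding \<eta>_def by blast
  have supp1: "norm (x - a) \<le> 1" if "\<eta> n x a \<noteq> 0" for n x a
  proof -
    have "sqrt (1 / s n) \<le> 1" using s[of n] by simp
    then show ?thesis using supp[OF that] by linarith
  qed
  \<comment> \<open>By translation invariance the mass in \<open>a\<close> is the same for every
    \<open>x\<close>, so one constant per scale normalises.\<close>
  define \<kappa> where "\<kappa> n = (\<integral>a. \<eta> n 0 a \<partial>lborel)" for n
  have \<kappa>: "(\<integral>a. \<eta> n x a \<partial>lborel) = \<kappa> n" for n x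
  proof -
    have "(\<integral>a. \<eta> n x a \<partial>lborel) = (\<integral>a. \<eta> n x (a + x) \<partial>lborel)"
    proof -
      have "(\<integral>a. \<eta> n x (a + x) \<partial>lebesgue) = (\<integral>a. \<eta> n x a \<partial>lebesgue)"
        by (rule integral_lebesgue_translate) measurable
      moreover have "(\<lambda>a. \<eta> n x (a + x)) \<in> borel_measurable lborel" "\<eta> n x \<in> borel_measurable lborel"
        using \<eta>mx by simp_all
      ultimately show ?thesis using integral_completion by metis
    qed
    also have "\<dots> = \<kappa> n" unfolding \<kappa>_def \<eta>_def by simp
    finally show ?thesis .
  qed
  have \<kappa>0: "\<kappa> n > 0" for n unfolding \<kappa>_def \<eta>_def by (rule integral_radial_bump_pos(2)[OF s(2)])
  have \<eta>I: "integrable lborel (\<lambda>a. \<eta> n x a)" for n x unfolding \<eta>_def by (rule integral_radial_bump_pos(1)[OF s(2)])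
  have \<eta>QI: "integrable lborel (\<lambda>a. indicator ?Q a * \<eta> n x a)" for n x
  proof (rule Bochner_Integration.integrable_bound[OF \<eta>I[of n x]])
    show "AE a in lborel. norm (indicator ?Q a * \<eta> n x a) \<le> norm (\<eta> n x a)"
      by (intro AE_I2) (auto simp: indicator_def)
  qed measurable
  \<comment> \<open>The indicator of the box smoothed at scale \<open>s n\<close>. It equals 1 at
    points whose distance to the complement exceeds \<open>sqrt (1 / s n)\<close>, and 0 that far
    outside, so only the boundary, a null set, escapes the pointwise limit.\<close>
  define \<Theta> where "\<Theta> n x = (\<integral>a. indicator ?Q a * \<eta> n x a \<partial>lborel) / \<kappa> n" for n x
  have \<Theta>m [measurable]: "\<Theta> n \<in> borel_measurable borel" for n
    unfolding \<Theta>_def by measurable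
  have \<Theta>b: "0 \<le> \<Theta> n x" "\<Theta> n x \<le> 1" for n x
  proof -
    show "0 \<le> \<Theta> n x" unfolding \<Theta>_def using \<kappa>0[of n] \<eta>0
      by (intro divide_nonneg_pos Bochner_Integration.integral_nonneg) auto
    have "(\<integral>a. indicator ?Q a * \<eta> n x a \<partial>lborel) \<le> (\<integral>a. \<eta> n x a \<partial>lborel)"
      by (rule integral_mono[OF \<eta>QI \<eta>I]) (use \<eta>0 in \<open>auto simp: indicator_def\<close>)
    then show "\<Theta> n x \<le> 1" unfolding \<Theta>_def \<kappa> using \<kappa>0[of n] by simp
  qed
  have \<Theta>0: "\<Theta> n x = 0" if "\<And>a. a \<in> ?Q \<Longrightarrow> \<eta> n x a = 0" for n x
  proof -
    have "(\<lambda>a. indicator ?Q a * \<eta> n x a) = (\<lambda>_. 0)" using that by (auto simp: indicator_def)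
    then show ?thesis by (simp add: \<Theta>_def)
  qed
  have \<Theta>1: "\<Theta> n x = 1" if "\<And>a. a \<notin> ?Q \<Longrightarrow> \<eta> n x a = 0" for n x
  proof -
    have "(\<lambda>a. indicator ?Q a * \<eta> n x a) = (\<lambda>a. \<eta> n x a)"
      by (intro ext) (auto simp: indicator_def that)
    then show ?thesis using \<kappa>0[of n] by (simp add: \<Theta>_def \<kappa>)
  qed
  have small: "\<forall>\<^sub>F n in sequentially. sqrt (1 / s n) < e" if "e > 0" for e
  proof -
    have "(\<lambda>n. sqrt (1 / s n)) \<longlonglongrightarrow> sqrt 0"
      unfolding s_def by (intro tendsto_real_sqrt LIMSEQ_Suc[OF lim_1_over_n])
    then show ?thesis using that by (intro order_tendstoD(2)) auto
  qed
  have lim: "AE x in lborel. (\<lambda>n. \<Theta> n x) \<longlonglongrightarrow> indicator ?Q x"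
  proof -
    have "negligible (cbox l u - box l u)" by (rule negligible_frontier_interval)
    then have "AE x in lborel. x \<notin> cbox l u - box l u"
      by (intro AE_not_in) (simp add: negligible_iff_null_sets null_sets_completion_iff)
    then show ?thesis
    proof (rule AE_mp, intro AE_I2 impI)
      fix x assume x: "x \<notin> cbox l u - box l u"
      show "(\<lambda>n. \<Theta> n x) \<longlonglongrightarrow> indicator ?Q x"
      proof (cases "x \<in> ?Q")
        case True
        then obtain e where e: "e > 0" "ball x e \<subseteq> ?Q" using open_box[of l u] open_contains_ball by blast
        have "\<forall>\<^sub>F n in sequentially. \<Theta> n x = 1"
          using small[OF e(1)]
        proof eventually_elim
          case (elim n)
          show ?case
          proof (rule \<Theta>1, rule ccontr)
            fix a assume a: "a \<notin> ?Q" "\<eta> n x a \<noteq> 0"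
            then have "a \<in> ball x e" using supp[of n x a] elim by (simp add: dist_norm)
            with e(2) a(1) show False by blast
          qed
        qed
        then show ?thesis using True by (simp add: tendsto_eventually)
      next
        case False
        then have "x \<in> - cbox l u" using x by blast
        moreover have "open (- cbox l u)" using closed_cbox by (rule open_Compl)
        ultimately obtain e where e: "e > 0" "ball x e \<subseteq> - cbox l u" using open_contains_ball by blast
        have "\<forall>\<^sub>F n in sequentially. \<Theta> n x = 0"
          using small[OF e(1)]
        proof eventually_elim
          case (elim n)
          show ?case
          proof (rule \<Theta>0, rule ccontr)
            fix a assume a: "a \<in> ?Q" "\<eta> n x a \<noteq> 0"
            then have "a \<in> ball x e" using supp[of n x a] elim by (simp add: dist_norm)
            with e(2) a(1) box_subset_cbox[of l u] show False by blast
          qed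
        qed
        then show ?thesis using False by (simp add: tendsto_eventually)
      qed
    qed
  qed
  \<comment> \<open>By Fubini, \<open>\<kappa> n\<close> times this integral is the integral, over
    the centres in \<open>?Q\<close>, of averages that vanish by hypothesis.\<close>
  have F0: "(\<integral>x. \<Theta> n x * f x \<partial>lborel) = 0" for n
  proof -
    let ?h = "\<lambda>p. indicator ?Q (fst p) * \<eta> n (snd p) (fst p) * (f (snd p))"
    have hle: "\<bar>?h (a, x)\<bar> \<le> indicator ?Q a * B * \<bar>indicator (cball 0 (r + 1)) x * f x\<bar>" for a x
    proof (cases "a \<in> ?Q \<and> \<eta> n x a \<noteq> 0")
      case True
      then have "norm a \<le> r" "norm (x - a) \<le> 1" using r(1) supp1[of n x a] by auto
      then have "x \<in> cball 0 (r + 1)" using norm_triangle_ineq2[of x a] by simp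
      then show ?thesis using True \<eta>B[of n x a] by (auto simp: abs_mult intro!: mult_right_mono)
    next
      case False
      then show ?thesis using B(1) by auto
    qed
    have h: "integrable (lborel \<Otimes>\<^sub>M lborel) ?h"
    proof (rule lborel_pair.Fubini_integrable)
      have [measurable]: "(\<lambda>p. \<eta> n (snd p) (fst p)) \<in> borel_measurable (borel \<Otimes>\<^sub>M borel)"
        unfolding borel_prod \<eta>_def by (intro borel_measurable_continuous_onI continuous_intros)
      show hm [measurable]: "?h \<in> borel_measurable (lborel \<Otimes>\<^sub>M lborel)" by measurable
      have ix: "integrable lborel (\<lambda>x. ?h (a, x))" for a
      proof (rule Bochner_Integration.integrable_bound)
        show "integrable lborel (\<lambda>x. indicator ?Q a * B * \<bar>indicator (cball 0 (r + 1)) x * f x\<bar>)"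
          by (intro integrable_mult_right integrable_abs loc)
        show "AE x in lborel. norm (?h (a, x)) \<le> norm (indicator ?Q a * B * \<bar>indicator (cball 0 (r + 1)) x * f x\<bar>)"
        proof (rule AE_I2)
          fix x show "norm (?h (a, x)) \<le> norm (indicator ?Q a * B * \<bar>indicator (cball 0 (r + 1)) x * f x\<bar>)"
            using order_trans[OF hle[of a x] abs_ge_self] by (simp only: real_norm_def)
        qed
        show "(\<lambda>x. ?h (a, x)) \<in> borel_measurable lborel" by simp
      qed
      then show "AE a in lborel. integrable lborel (\<lambda>x. ?h (a, x))" by simp
      define L where "L = (\<integral>x. \<bar>indicator (cball 0 (r + 1)) x * f x\<bar> \<partial>lborel)"
      show "integrable lborel (\<lambda>a. \<integral>x. norm (?h (a, x)) \<partial>lborel)"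
      proof (rule Bochner_Integration.integrable_bound)
        show "integrable lborel (\<lambda>a. (B * L) * indicator ?Q a)"
          by (intro integrable_mult_right integrable_real_indicator) (use emeasure_lborel_box_finite[of l u] in auto)
        show "(\<lambda>a. \<integral>x. norm (?h (a, x)) \<partial>lborel) \<in> borel_measurable lborel" by measurable
        show "AE a in lborel. norm (\<integral>x. norm (?h (a, x)) \<partial>lborel) \<le> norm ((B * L) * indicator ?Q a)"
        proof (rule AE_I2)
          fix a
          have "(\<integral>x. norm (?h (a, x)) \<partial>lborel) \<le> (\<integral>x. indicator ?Q a * B * \<bar>indicator (cball 0 (r + 1)) x * f x\<bar> \<partial>lborel)"
            by (rule integral_mono[OF integrable_norm[OF ix]])
              (use hle loc in \<open>auto simp only: real_norm_def intro!: integrable_mult_right integrable_abs\<close>)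
          also have "\<dots> = (B * L) * indicator ?Q a" unfolding L_def by simp
          also have "\<dots> \<le> \<bar>(B * L) * indicator ?Q a\<bar>" by (rule abs_ge_self)
          finally show "norm (\<integral>x. norm (?h (a, x)) \<partial>lborel) \<le> norm ((B * L) * indicator ?Q a)"
            by (simp only: real_norm_def abs_of_nonneg[OF Bochner_Integration.integral_nonneg] abs_ge_zero)
        qed
      qed
    qed
    have "(\<integral>a. \<integral>x. ?h (a, x) \<partial>lborel \<partial>lborel) = (\<integral>a. indicator ?Q a * (\<integral>x. \<eta> n x a * f x \<partial>lborel) \<partial>lborel)"
      by (simp add: mult.assoc)
    also have "\<dots> = 0" using zero[OF s(2)[of n]] by (simp add: \<eta>_def)
    finally have "0 = (\<integral>a. \<integral>x. ?h (a, x) \<partial>lborel \<partial>lborel)" by simp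
    also have "\<dots> = (\<integral>x. \<integral>a. ?h (a, x) \<partial>lborel \<partial>lborel)"
      using lborel_pair.Fubini_integral[of "\<lambda>a x. ?h (a, x)"] h by (simp add: split_beta')
    also have "\<dots> = (\<integral>x. \<kappa> n * (\<Theta> n x * f x) \<partial>lborel)"
      using \<kappa>0[of n] by (simp add: \<Theta>_def)
    also have "\<dots> = \<kappa> n * (\<integral>x. \<Theta> n x * f x \<partial>lborel)" by simp
    finally show ?thesis using \<kappa>0[of n] by simp
  qed
  have "(\<lambda>n. \<integral>x. \<Theta> n x * f x \<partial>lborel) \<longlonglongrightarrow> (\<integral>x. indicator ?Q x * f x \<partial>lborel)"
  proof (rule integral_dominated_convergence[where w="\<lambda>x. \<bar>indicator (cball 0 (r + 1)) x * f x\<bar>"])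
    show "AE x in lborel. (\<lambda>n. \<Theta> n x * f x) \<longlonglongrightarrow> indicator ?Q x * f x"
      using lim by eventually_elim (intro tendsto_intros)
    show "AE x in lborel. norm (\<Theta> n x * f x) \<le> \<bar>indicator (cball 0 (r + 1)) x * f x\<bar>" for n
    proof (rule AE_I2)
      fix x
      show "norm (\<Theta> n x * f x) \<le> \<bar>indicator (cball 0 (r + 1)) x * f x\<bar>"
      proof (cases "x \<in> cball 0 (r + 1)")
        case True
        then show ?thesis using \<Theta>b[of n x] by (simp add: abs_mult mult_left_le_one_le)
      next
        case False
        have "\<Theta> n x = 0"
        proof (rule \<Theta>0, rule ccontr)
          fix a assume "a \<in> ?Q" "\<eta> n x a \<noteq> 0"
          then have "norm a \<le> r" "norm (x - a) \<le> 1" using r(1) supp1[of n x a] by auto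
          then have "x \<in> cball 0 (r + 1)" using norm_triangle_ineq2[of x a] by simp
          with False show False by simp
        qed
        then show ?thesis by simp
      qed
    qed
    show "integrable lborel (\<lambda>x. \<bar>indicator (cball 0 (r + 1)) x * f x\<bar>)" by (intro integrable_abs loc)
  qed measurable
  then show "(\<integral>x. indicator ?Q x * f x \<partial>lborel) = 0"
    unfolding F0 using LIMSEQ_unique[OF _ tendsto_const] by force
qed

text \<open>With \<open>A\<close> the Hessian of a radial function, this expresses the componentwise harmonicity of a
  field with vanishing divergence and curl: the left factor is the trace of \<open>A\<close>.\<close>

lemma hessian_identity:
  fixes c k :: real and y h v :: "real^3"
  defines "A \<equiv> \<lambda>e. c *\<^sub>R e + (k * (y \<bullet> e)) *\<^sub>R y"
  shows "(3 * c + k * (y \<bullet> y)) * (h \<bullet> v) =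
    A v \<bullet> h + (cross3 (A (axis 1 1)) h \<bullet> cross3 (axis 1 1) v
      + cross3 (A (axis 2 1)) h \<bullet> cross3 (axis 2 1) v + cross3 (A (axis 3 1)) h \<bullet> cross3 (axis 3 1) v)"
  unfolding A_def inner_axis
  by (simp add: cross3_def inner_vec_def sum_3 axis_def algebra_simps)

text \<open>The test functions are the directional derivatives of one radial function: the
  divergence is tested with direction \<open>v\<close>, the curl with the three axes, and
  \<open>hessian_identity\<close> combines the results into weak harmonicity of
  \<open>h x \<bullet> v\<close> against radial functions. No regularity of \<open>h\<close> is ever
  established.\<close>

lemma div_curl_free_zero:
  fixes h :: "real^3 \<Rightarrow> real^3"
  assumes h: "square_integrable lebesgue h"
    and div: "\<And>\<psi>. test_fun \<psi> \<Longrightarrow> (\<integral>x. grad \<psi> x \<bullet> h x \<partial>lebesgue) = 0"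
    and curl: "\<And>\<psi> e. test_fun \<psi> \<Longrightarrow> (\<integral>x. cross3 (grad \<psi> x) (h x) \<bullet> e \<partial>lebesgue) = 0"
  shows "AE x in lebesgue. h x = 0"
proof -
  have comp: "AE x in lebesgue. h x \<bullet> v = 0" for v
  proof -
    define f where "f x = h x \<bullet> v" for x
    have hm [measurable]: "h \<in> borel_measurable lebesgue" by (rule square_integrableD(1)[OF h])
    have f: "square_integrable lebesgue f"
      unfolding square_integrable_def
    proof
      show "integrable lebesgue (\<lambda>x. (norm (f x))\<^sup>2)"
      proof (rule Bochner_Integration.integrable_bound)
        show "integrable lebesgue (\<lambda>x. (norm v)\<^sup>2 * (norm (h x))\<^sup>2)"
          by (intro integrable_mult_right square_integrableD(2)[OF h])
        show "AE x in lebesgue. norm ((norm (f x))\<^sup>2) \<le> norm ((norm v)\<^sup>2 * (norm (h x))\<^sup>2)"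
        proof (rule AE_I2)
          fix x
          have "(norm (f x))\<^sup>2 \<le> (norm (h x) * norm v)\<^sup>2"
            unfolding f_def real_norm_def by (intro power_mono Cauchy_Schwarz_ineq2) simp
          then show "norm ((norm (f x))\<^sup>2) \<le> norm ((norm v)\<^sup>2 * (norm (h x))\<^sup>2)"
            by (simp add: power_mult_distrib mult.commute)
        qed
      qed (unfold f_def, measurable)
    qed (unfold f_def, measurable)
    have avg: "(\<integral>x. bump 2 (1 - s * ((x - a) \<bullet> (x - a))) * f x \<partial>lebesgue) = 0" if s: "s > 0" for a s
    proof (rule weakly_harmonic_bump_average_zero[OF f _ s])
      fix s :: real assume s: "s > 0"
      define \<psi> where "\<psi> e x = ((x - a) \<bullet> e) * bump 2 (1 - s * ((x - a) \<bullet> (x - a)))" for e x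
      have \<psi>: "test_fun (\<psi> e)" for e unfolding \<psi>_def by (rule test_fun_linear_radial_bump[OF s])
      define c where "c x = bump 2 (1 - s * ((x - a) \<bullet> (x - a)))" for x
      define k where "k x = (bump 4 (1 - s * ((x - a) \<bullet> (x - a))) - 2 * bump 3 (1 - s * ((x - a) \<bullet> (x - a)))) * (- 2 * s)" for x
      have g: "grad (\<psi> e) x = c x *\<^sub>R e + (k x * ((x - a) \<bullet> e)) *\<^sub>R (x - a)" for e x
        unfolding \<psi>_def c_def k_def by (rule grad_linear_radial_bump)
      have i1: "integrable lebesgue (\<lambda>x. grad (\<psi> e) x \<bullet> h x)" for e
        by (rule square_integrable_inner[OF square_integrable_grad[OF \<psi>] h])
      have i2: "integrable lebesgue (\<lambda>x. cross3 (grad (\<psi> e) x) (h x) \<bullet> e')" for e e'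
        by (rule integrable_cross3_inner[OF square_integrable_grad[OF \<psi>] h])
      have "(\<integral>x. (3 * c x + k x * ((x - a) \<bullet> (x - a))) * f x \<partial>lebesgue)
        = (\<integral>x. grad (\<psi> v) x \<bullet> h x + (cross3 (grad (\<psi> (axis 1 1)) x) (h x) \<bullet> cross3 (axis 1 1) v
          + cross3 (grad (\<psi> (axis 2 1)) x) (h x) \<bullet> cross3 (axis 2 1) v
          + cross3 (grad (\<psi> (axis 3 1)) x) (h x) \<bullet> cross3 (axis 3 1) v) \<partial>lebesgue)"
        unfolding f_def hessian_identity g ..
      also have "\<dots> = 0" using i1 i2 by (simp add: div[OF \<psi>] curl[OF \<psi>])
      finally show "(\<integral>x. (3 * bump 2 (1 - s * ((x - a) \<bullet> (x - a)))
          - 2 * s * ((x - a) \<bullet> (x - a)) * (bump 4 (1 - s * ((x - a) \<bullet> (x - a)))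
           - 2 * bump 3 (1 - s * ((x - a) \<bullet> (x - a))))) * f x \<partial>lebesgue) = 0"
        unfolding c_def k_def by (simp add: algebra_simps)
    qed
    \<comment> \<open>Averaging over centres uses Fubini on \<open>lborel\<close>, so a Borel
      representative takes the place of the Lebesgue measurable \<open>f\<close>.\<close>
    have "f \<in> borel_measurable (completion lborel)" using square_integrableD(1)[OF f] .
    then obtain f' where f' [measurable]: "f' \<in> borel_measurable lborel" and ae: "AE x in lborel. f x = f' x"
      using completion_ex_borel_measurable_real by blast
    have ae': "AE x in lebesgue. f x = f' x" using ae by (rule AE_completion)
    have fl: "f' \<in> borel_measurable lebesgue" using f' by (rule measurable_completion)
    have "AE x in lborel. f' x = 0"
    proof (rule AE_zero_if_bump_averages_zero[where m=2])
      show "f' \<in> borel_measurable borel" using f' by simp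
      fix r :: real
      have "square_integrable lebesgue (indicator (cball 0 r) :: real^3 \<Rightarrow> real)"
        by (rule square_integrable_indicator) simp
      from square_integrable_inner[OF this f]
      have "integrable lebesgue (\<lambda>x. indicator (cball 0 r) x * f x)" by simp
      then have "integrable lebesgue (\<lambda>x. indicator (cball 0 r) x * f' x)"
        by (rule integrable_cong_AE_imp)
          (use ae' in \<open>auto intro!: borel_measurable_times borel_measurable_indicator fl\<close>)
      moreover have "(\<lambda>x. indicator (cball 0 r) x * f' x) \<in> borel_measurable lborel"
        by (intro borel_measurable_times borel_measurable_indicator f') simp
      ultimately show "integrable lborel (\<lambda>x. indicator (cball 0 r) x * f' x)"
        using integrable_completion by blast
    next
      fix a :: "real^3" and s :: real assume s: "s > 0"
      have "(\<lambda>x. bump 2 (1 - s * ((x - a) \<bullet> (x - a)))) \<in> borel_measurable borel"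
        by (intro borel_measurable_continuous_onI continuous_intros)
      then have b: "(\<lambda>x. bump 2 (1 - s * ((x - a) \<bullet> (x - a)))) \<in> borel_measurable lborel" by simp
      have m: "(\<lambda>x. bump 2 (1 - s * ((x - a) \<bullet> (x - a))) * f' x) \<in> borel_measurable lborel"
        by (intro borel_measurable_times b f')
      have "(\<integral>x. bump 2 (1 - s * ((x - a) \<bullet> (x - a))) * f' x \<partial>lebesgue)
        = (\<integral>x. bump 2 (1 - s * ((x - a) \<bullet> (x - a))) * f x \<partial>lebesgue)"
        by (rule integral_cong_AE)
          (use ae' in \<open>auto intro!: borel_measurable_times fl square_integrableD(1)[OF f] measurable_completion[OF b]\<close>)
      then show "(\<integral>x. bump 2 (1 - s * ((x - a) \<bullet> (x - a))) * f' x \<partial>lborel) = 0"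
        using avg[OF s] integral_completion[OF m] by simp
    qed
    then have "AE x in lebesgue. f' x = 0" by (rule AE_completion)
    with ae' show "AE x in lebesgue. h x \<bullet> v = 0" by eventually_elim (simp add: f_def)
  qed
  show ?thesis
    using comp[of "axis 1 1"] comp[of "axis 2 1"] comp[of "axis 3 1"]
    by eventually_elim (simp add: inner_axis vec_eq_iff forall_3)
qed

subsection \<open>Existence of a minimizer\<close>

lemma L2_on_iff:
  assumes "\<Omega> \<in> sets lebesgue"
  shows "m \<in> L2_on \<Omega> \<longleftrightarrow> square_integrable lebesgue (\<lambda>x. indicator \<Omega> x *\<^sub>R m x)"
proof -
  have "(norm (indicator \<Omega> x *\<^sub>R m x))\<^sup>2 = indicator \<Omega> x *\<^sub>R (norm (m x))\<^sup>2" for x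
    by (simp add: indicator_def)
  then show ?thesis
    using assms
    by (simp add: L2_on_def square_integrable_def borel_measurable_restrict_space_iff integrable_restrict_space)
qed

lemma L2_on_UNIV_iff: "h \<in> L2_on UNIV \<longleftrightarrow> square_integrable lebesgue h"
proof -
  have "(\<lambda>x. indicator UNIV x *\<^sub>R h x) = h" by simp
  then show ?thesis using L2_on_iff[of UNIV h] by simp
qed

lemma is_demag_field_iff:
  assumes u: "square_integrable lebesgue (\<lambda>x. indicator \<Omega> x *\<^sub>R m x)"
  shows "is_demag_field \<Omega> m h \<longleftrightarrow> square_integrable lebesgue h
    \<and> (\<forall>\<psi>. test_fun \<psi> \<longrightarrow> (\<integral>x. grad \<psi> x \<bullet> (indicator \<Omega> x *\<^sub>R m x + h x) \<partial>lebesgue) = 0)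
    \<and> (\<forall>\<psi> e. test_fun \<psi> \<longrightarrow> (\<integral>x. cross3 (grad \<psi> x) (h x) \<bullet> e \<partial>lebesgue) = 0)"
proof (cases "square_integrable lebesgue h")
  case h: True
  have "distr_curl h \<psi> = 0 \<longleftrightarrow> (\<forall>e. (\<integral>x. cross3 (grad \<psi> x) (h x) \<bullet> e \<partial>lebesgue) = 0)"
    if \<psi>: "test_fun \<psi>" for \<psi>
  proof -
    have I: "integrable lebesgue (\<lambda>x. cross3 (grad \<psi> x) (h x) \<bullet> e)" for e
      by (rule integrable_cross3_inner[OF square_integrable_grad[OF \<psi>] h])
    \<comment> \<open>Without integrability the Bochner integral is 0 by convention and would say
      nothing about the components; here it is assembled from them.\<close>
    have "integrable lebesgue (\<lambda>x. cross3 (grad \<psi> x) (h x))"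
    proof -
      have "integrable lebesgue (\<lambda>x. \<Sum>b\<in>Basis. (cross3 (grad \<psi> x) (h x) \<bullet> b) *\<^sub>R b)"
        by (intro Bochner_Integration.integrable_sum integrable_scaleR_left I)
      then show ?thesis unfolding euclidean_representation .
    qed
    then have eq: "(\<integral>x. cross3 (grad \<psi> x) (h x) \<bullet> e \<partial>lebesgue) = (\<integral>x. cross3 (grad \<psi> x) (h x) \<partial>lebesgue) \<bullet> e" for e
      by (rule integral_inner_left)
    have "(\<forall>e. V \<bullet> e = 0) \<longleftrightarrow> V = 0" for V :: "real^3"
      using inner_eq_zero_iff[of V] by force
    then show ?thesis unfolding distr_curl_def eq by simp
  qed
  with h show ?thesis
    unfolding is_demag_field_def L2_on_UNIV_iff distr_div_def by auto
qed (simp add: is_demag_field_def L2_on_UNIV_iff)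

lemma is_demag_field_unique:
  assumes u: "square_integrable lebesgue (\<lambda>x. indicator \<Omega> x *\<^sub>R m x)"
    and h1: "is_demag_field \<Omega> m h1" and h2: "is_demag_field \<Omega> m h2"
  shows "AE x in lebesgue. h1 x = h2 x"
proof -
  note a = h1[unfolded is_demag_field_iff[OF u]] and b = h2[unfolded is_demag_field_iff[OF u]]
  have s1: "square_integrable lebesgue h1" and s2: "square_integrable lebesgue h2" using a b by auto
  have "AE x in lebesgue. h1 x - h2 x = 0"
  proof (rule div_curl_free_zero[OF square_integrable_diff(1)[OF s1 s2]])
    fix \<psi> assume \<psi>: "test_fun \<psi>"
    note g = square_integrable_grad[OF \<psi>]
    have eq: "grad \<psi> x \<bullet> (h1 x - h2 x) = grad \<psi> x \<bullet> (indicator \<Omega> x *\<^sub>R m x + h1 x) - grad \<psi> x \<bullet> (indicator \<Omega> x *\<^sub>R m x + h2 x)" for x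
      by (simp add: inner_add_right inner_diff_right)
    show "(\<integral>x. grad \<psi> x \<bullet> (h1 x - h2 x) \<partial>lebesgue) = 0"
      unfolding eq
      using a b \<psi> square_integrable_inner[OF g square_integrable_add(1)[OF u s1]]
        square_integrable_inner[OF g square_integrable_add(1)[OF u s2]] by simp
    fix e :: "real^3"
    have I: "integrable lebesgue (\<lambda>x. cross3 (grad \<psi> x) (h x) \<bullet> e)" if h: "square_integrable lebesgue h" for h
      by (rule integrable_cross3_inner[OF g h])
    have eq: "cross3 (grad \<psi> x) (h1 x - h2 x) \<bullet> e = cross3 (grad \<psi> x) (h1 x) \<bullet> e - cross3 (grad \<psi> x) (h2 x) \<bullet> e" for x
      by (simp add: Cross3.right_diff_distrib inner_diff_left)
    show "(\<integral>x. cross3 (grad \<psi> x) (h1 x - h2 x) \<bullet> e \<partial>lebesgue) = 0"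
      unfolding eq using a b \<psi> I[OF s1] I[OF s2] by simp
  qed
  then show ?thesis by eventually_elim simp
qed

text \<open>A completed square: for square integrable \<open>m\<close> the divergence equation makes
  it \<open>demag_energy \<Omega> m\<close> minus the squared L^2 distance of
  \<open>grad \<psi>\<close> from the field. The formula itself does not mention the field, which
  makes it easy to follow along a sequence of \<open>m\<close>.\<close>

definition demag_lower_bound :: "(real^3) set \<Rightarrow> (real^3 \<Rightarrow> real^3) \<Rightarrow> (real^3 \<Rightarrow> real) \<Rightarrow> real" where
  "demag_lower_bound \<Omega> m \<psi> = - 2 * (\<integral>x. grad \<psi> x \<bullet> (indicator \<Omega> x *\<^sub>R m x) \<partial>lebesgue)
     - (\<integral>x. (norm (grad \<psi> x))\<^sup>2 \<partial>lebesgue)"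

definition demag_energy :: "(real^3) set \<Rightarrow> (real^3 \<Rightarrow> real^3) \<Rightarrow> real" where
  "demag_energy \<Omega> m = (\<integral>x. (norm (demag_field \<Omega> m x))\<^sup>2 \<partial>lebesgue)"

text \<open>Both comparisons with the lower bounds rest on the identity \<open>lb\<close>. The
  approximating gradients come from the projection \<open>h0\<close>, and uniqueness makes them
  converge to the chosen field as well.\<close>

lemma demag_energy:
  assumes \<Omega>: "\<Omega> \<in> sets lebesgue" and m: "m \<in> L2_on \<Omega>"
  shows "- (\<integral>x. demag_field \<Omega> m x \<bullet> m x \<partial>lebesgue_on \<Omega>) = demag_energy \<Omega> m"
    and "test_fun \<psi> \<Longrightarrow> demag_lower_bound \<Omega> m \<psi> \<le> demag_energy \<Omega> m"
    and "e > 0 \<Longrightarrow> \<exists>\<psi>. test_fun \<psi> \<and> demag_energy \<Omega> m < demag_lower_bound \<Omega> m \<psi> + e"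
proof -
  define u where "u x = indicator \<Omega> x *\<^sub>R m x" for x
  have u: "square_integrable lebesgue u" using m \<Omega> unfolding u_def by (simp add: L2_on_iff)
  obtain h0 \<phi> where h0: "square_integrable lebesgue h0" "\<And>n::nat. test_fun (\<phi> n)"
    "(\<lambda>n. \<integral>x. (norm (grad (\<phi> n) x - h0 x))\<^sup>2 \<partial>lebesgue) \<longlonglongrightarrow> 0"
    "\<And>\<psi>. test_fun \<psi> \<Longrightarrow> (\<integral>x. grad \<psi> x \<bullet> (u x + h0 x) \<partial>lebesgue) = 0"
    "\<And>\<psi> e. test_fun \<psi> \<Longrightarrow> (\<integral>x. cross3 (grad \<psi> x) (h0 x) \<bullet> e \<partial>lebesgue) = 0"
    by (rule exists_L2_gradient_projection[OF u]) (rule that)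
  have d0: "is_demag_field \<Omega> m h0"
    unfolding is_demag_field_iff[OF u[unfolded u_def]] using h0 by (auto simp: u_def)
  define h where "h = demag_field \<Omega> m"
  have dh: "is_demag_field \<Omega> m h" unfolding h_def demag_field_def
    by (rule someI[where P="is_demag_field \<Omega> m", OF d0])
  have h: "square_integrable lebesgue h"
    "\<And>\<psi>. test_fun \<psi> \<Longrightarrow> (\<integral>x. grad \<psi> x \<bullet> (u x + h x) \<partial>lebesgue) = 0"
    using dh unfolding is_demag_field_iff[OF u[unfolded u_def]] by (auto simp: u_def)
  have ae: "AE x in lebesgue. h x = h0 x"
    by (rule is_demag_field_unique[OF u[unfolded u_def] dh d0])
  have \<phi>: "(\<lambda>n. \<integral>x. (norm (grad (\<phi> n) x - h x))\<^sup>2 \<partial>lebesgue) \<longlonglongrightarrow> 0"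
  proof -
    have "(\<integral>x. (norm (grad (\<phi> n) x - h x))\<^sup>2 \<partial>lebesgue) = (\<integral>x. (norm (grad (\<phi> n) x - h0 x))\<^sup>2 \<partial>lebesgue)" for n
    proof (rule integral_cong_AE)
      note gs = square_integrable_grad[OF h0(2)[of n]]
      show "(\<lambda>x. (norm (grad (\<phi> n) x - h x))\<^sup>2) \<in> borel_measurable lebesgue"
        "(\<lambda>x. (norm (grad (\<phi> n) x - h0 x))\<^sup>2) \<in> borel_measurable lebesgue"
        using square_integrableD(2)[OF square_integrable_diff(1)[OF gs h(1)]]
          square_integrableD(2)[OF square_integrable_diff(1)[OF gs h0(1)]] by auto
      show "AE x in lebesgue. (norm (grad (\<phi> n) x - h x))\<^sup>2 = (norm (grad (\<phi> n) x - h0 x))\<^sup>2"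
        using ae by eventually_elim simp
    qed
    then show ?thesis using h0(3) by simp
  qed
  have E: "demag_energy \<Omega> m = (\<integral>x. (norm (h x))\<^sup>2 \<partial>lebesgue)" by (simp add: demag_energy_def h_def)
  have gu: "(\<integral>x. grad \<psi> x \<bullet> u x \<partial>lebesgue) = - (\<integral>x. grad \<psi> x \<bullet> h x \<partial>lebesgue)" if \<psi>: "test_fun \<psi>" for \<psi>
    using h(2)[OF \<psi>] square_integrable_inner[OF square_integrable_grad[OF \<psi>] u]
      square_integrable_inner[OF square_integrable_grad[OF \<psi>] h(1)]
    by (simp add: inner_add_right)
  have lb: "demag_lower_bound \<Omega> m \<psi> = demag_energy \<Omega> m - (\<integral>x. (norm (grad \<psi> x - h x))\<^sup>2 \<partial>lebesgue)"
    if \<psi>: "test_fun \<psi>" for \<psi>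
    unfolding demag_lower_bound_def u_def[symmetric] gu[OF \<psi>] E
      square_integrable_diff(2)[OF square_integrable_grad[OF \<psi>] h(1)] by simp
  show "demag_lower_bound \<Omega> m \<psi> \<le> demag_energy \<Omega> m" if \<psi>: "test_fun \<psi>"
    unfolding lb[OF \<psi>] by (simp add: Bochner_Integration.integral_nonneg)
  show "\<exists>\<psi>. test_fun \<psi> \<and> demag_energy \<Omega> m < demag_lower_bound \<Omega> m \<psi> + e" if e: "e > 0"
  proof -
    have "\<forall>\<^sub>F n in sequentially. (\<integral>x. (norm (grad (\<phi> n) x - h x))\<^sup>2 \<partial>lebesgue) < e"
      using \<phi> e by (rule order_tendstoD(2))
    then obtain n where "(\<integral>x. (norm (grad (\<phi> n) x - h x))\<^sup>2 \<partial>lebesgue) < e"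
      by (auto simp: eventually_sequentially)
    then show ?thesis using lb[OF h0(2)[of n]] h0(2)[of n] by (intro exI[of _ "\<phi> n"]) simp
  qed
  \<comment> \<open>Letting the gradients converge to \<open>h\<close> in \<open>gu\<close> gives
    that relation with \<open>h\<close> itself as the test field.\<close>
  have "(\<lambda>n. \<integral>x. grad (\<phi> n) x \<bullet> u x \<partial>lebesgue) \<longlonglongrightarrow> (\<integral>x. h x \<bullet> u x \<partial>lebesgue)"
    by (rule integral_inner_tendsto_L2[OF square_integrable_grad[OF h0(2)] h(1) u \<phi>])
  moreover have "(\<lambda>n. \<integral>x. grad (\<phi> n) x \<bullet> h x \<partial>lebesgue) \<longlonglongrightarrow> (\<integral>x. h x \<bullet> h x \<partial>lebesgue)"
    by (rule integral_inner_tendsto_L2[OF square_integrable_grad[OF h0(2)] h(1) h(1) \<phi>])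
  ultimately have "(\<integral>x. h x \<bullet> u x \<partial>lebesgue) = - (\<integral>x. h x \<bullet> h x \<partial>lebesgue)"
    unfolding gu[OF h0(2)] using LIMSEQ_unique tendsto_minus by blast
  also have "(\<integral>x. h x \<bullet> h x \<partial>lebesgue) = demag_energy \<Omega> m" unfolding E by (simp add: power2_norm_eq_inner)
  also have "(\<integral>x. h x \<bullet> u x \<partial>lebesgue) = (\<integral>x. h x \<bullet> m x \<partial>lebesgue_on \<Omega>)"
    using \<Omega> by (subst integral_restrict_space) (auto simp: u_def)
  finally show "- (\<integral>x. demag_field \<Omega> m x \<bullet> m x \<partial>lebesgue_on \<Omega>) = demag_energy \<Omega> m"
    by (simp add: h_def)
qed

lemma demag_energy_nonneg: "demag_energy \<Omega> m \<ge> 0"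
  unfolding demag_energy_def by (rule Bochner_Integration.integral_nonneg) simp

lemma micromag_energy_eq:
  assumes "\<Omega> \<in> sets lebesgue" "m \<in> L2_on \<Omega>"
  shows "micromag_energy \<Omega> j m = enn2ereal (exchange_energy \<Omega> j m) + ereal (demag_energy \<Omega> m)"
  unfolding micromag_energy_def demag_energy(1)[OF assms, symmetric]
  by (simp add: minus_ereal_def)

text \<open>Iterated integrals reduce the claim to two uses of the almost everywhere hypothesis in a
  single variable, so no null set in the product has to be described.\<close>

lemma exchange_energy_cong_AE:
  assumes \<Omega>: "\<Omega> \<in> lmeasurable" and j: "j \<in> borel_measurable borel"
    and m: "m \<in> borel_measurable (lebesgue_on \<Omega>)" and m': "m' \<in> borel_measurable (lebesgue_on \<Omega>)"
    and ae: "AE x in lebesgue_on \<Omega>. m x = m' x"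
  shows "exchange_energy \<Omega> j m = exchange_energy \<Omega> j m'"
proof -
  interpret finite_measure "lebesgue_on \<Omega>" by (rule finite_measure_lebesgue_on[OF \<Omega>])
  note [measurable] = borel_measurable_kernel_lebesgue_on[OF j, of \<Omega>] m m'
  have fst: "exchange_energy \<Omega> j f
      = (\<integral>\<^sup>+x. \<integral>\<^sup>+y. j (x - y) * ennreal ((norm (f x - f y))\<^sup>2) \<partial>lebesgue_on \<Omega> \<partial>lebesgue_on \<Omega>)"
    if [measurable]: "f \<in> borel_measurable (lebesgue_on \<Omega>)" for f
    unfolding exchange_energy_altdef by (subst nn_integral_fst[symmetric]) simp_all
  show ?thesis
    unfolding fst[OF m] fst[OF m']
  proof (rule nn_integral_cong_AE)
    show "AE x in lebesgue_on \<Omega>. (\<integral>\<^sup>+y. j (x - y) * ennreal ((norm (m x - m y))\<^sup>2) \<partial>lebesgue_on \<Omega>)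
      = (\<integral>\<^sup>+y. j (x - y) * ennreal ((norm (m' x - m' y))\<^sup>2) \<partial>lebesgue_on \<Omega>)"
      using ae
    proof eventually_elim
      fix x assume x: "m x = m' x"
      show "(\<integral>\<^sup>+y. j (x - y) * ennreal ((norm (m x - m y))\<^sup>2) \<partial>lebesgue_on \<Omega>)
        = (\<integral>\<^sup>+y. j (x - y) * ennreal ((norm (m' x - m' y))\<^sup>2) \<partial>lebesgue_on \<Omega>)"
        by (rule nn_integral_cong_AE) (use ae in \<open>eventually_elim, simp add: x\<close>)
    qed
  qed
qed

lemma demag_lower_bound_cong_AE:
  assumes \<Omega>: "\<Omega> \<in> sets lebesgue"
    and ae: "AE x in lebesgue_on \<Omega>. m x = m' x"
    and m: "m \<in> L2_on \<Omega>" and m': "m' \<in> L2_on \<Omega>" and \<psi>: "test_fun \<psi>"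
  shows "demag_lower_bound \<Omega> m \<psi> = demag_lower_bound \<Omega> m' \<psi>"
proof -
  have "(\<integral>x. grad \<psi> x \<bullet> (indicator \<Omega> x *\<^sub>R m x) \<partial>lebesgue) = (\<integral>x. grad \<psi> x \<bullet> (indicator \<Omega> x *\<^sub>R m' x) \<partial>lebesgue)"
  proof (rule integral_cong_AE)
    note g = square_integrable_grad[OF \<psi>]
    show "(\<lambda>x. grad \<psi> x \<bullet> (indicator \<Omega> x *\<^sub>R m x)) \<in> borel_measurable lebesgue"
      "(\<lambda>x. grad \<psi> x \<bullet> (indicator \<Omega> x *\<^sub>R m' x)) \<in> borel_measurable lebesgue"
      using square_integrable_inner[OF g m[unfolded L2_on_iff[OF \<Omega>]]]
        square_integrable_inner[OF g m'[unfolded L2_on_iff[OF \<Omega>]]] by auto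
    have "AE x in lebesgue. x \<in> \<Omega> \<longrightarrow> m x = m' x"
      using ae \<Omega> by (simp add: AE_restrict_space_iff)
    then show "AE x in lebesgue. grad \<psi> x \<bullet> (indicator \<Omega> x *\<^sub>R m x) = grad \<psi> x \<bullet> (indicator \<Omega> x *\<^sub>R m' x)"
      by eventually_elim (auto simp: indicator_def)
  qed
  then show ?thesis by (simp add: demag_lower_bound_def)
qed

lemma unit_field_in_L2_sphere:
  assumes \<Omega>: "\<Omega> \<in> lmeasurable" and m: "m \<in> borel_measurable (lebesgue_on \<Omega>)" "\<And>x. norm (m x) = 1"
  shows "m \<in> L2_sphere \<Omega>"
proof -
  interpret finite_measure "lebesgue_on \<Omega>" by (rule finite_measure_lebesgue_on[OF \<Omega>])
  show ?thesis using m by (simp add: L2_sphere_def L2_on_def)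
qed

text \<open>The functionals \<open>demag_lower_bound \<Omega> \<cdot> \<psi>\<close> are continuous, so it suffices to bound the
  liminf of the exchange energies, for each test function separately.\<close>

lemma energy_lower_semicontinuous:
  assumes \<Omega>: "\<Omega> \<in> lmeasurable" and j: "j \<in> borel_measurable borel"
    and w: "\<And>k::nat. w k \<in> borel_measurable (lebesgue_on \<Omega>)" "\<And>k x. norm (w k x) = 1"
    and lim: "\<And>x. (\<lambda>k. w k x) \<longlonglongrightarrow> m x"
    and en: "\<And>k \<psi>. test_fun \<psi> \<Longrightarrow> exchange_energy \<Omega> j (w k) \<le> ennreal (\<epsilon> k - demag_lower_bound \<Omega> (w k) \<psi>)"
    and \<epsilon>: "\<epsilon> \<longlonglongrightarrow> I"
    and nonneg: "\<And>k \<psi>. test_fun \<psi> \<Longrightarrow> demag_lower_bound \<Omega> (w k) \<psi> \<le> \<epsilon> k"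
  shows "m \<in> X_space \<Omega> j" "micromag_energy \<Omega> j m \<le> ereal I"
proof -
  interpret finite_measure "lebesgue_on \<Omega>" by (rule finite_measure_lebesgue_on[OF \<Omega>])
  have \<Omega>s: "\<Omega> \<in> sets lebesgue" using \<Omega> by auto
  note [measurable] = borel_measurable_kernel_lebesgue_on[OF j, of \<Omega>] w(1)
  have mm [measurable]: "m \<in> borel_measurable (lebesgue_on \<Omega>)"
    by (rule borel_measurable_LIMSEQ_metric[OF w(1)]) (rule lim)
  have m1: "norm (m x) = 1" for x
    using tendsto_norm[OF lim[of x]] unfolding w(2) by (simp add: LIMSEQ_const_iff)
  have mS: "m \<in> L2_sphere \<Omega>" by (rule unit_field_in_L2_sphere[OF \<Omega> mm m1])
  then have mL: "m \<in> L2_on \<Omega>" by (simp add: L2_sphere_def)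
  have lb: "(\<lambda>k. demag_lower_bound \<Omega> (w k) \<psi>) \<longlonglongrightarrow> demag_lower_bound \<Omega> m \<psi>" if \<psi>: "test_fun \<psi>" for \<psi>
  proof -
    have c: "continuous_on UNIV (grad \<psi>)" by (rule continuous_on_grad[OF \<psi>])
    obtain R where R: "R > 0" "\<And>x. norm x \<ge> R \<Longrightarrow> \<psi> x = 0" "\<And>x. norm x \<ge> R \<Longrightarrow> grad \<psi> x = 0"
      by (rule test_fun_bounded_support[OF \<psi>]) (rule that)
    have "(\<lambda>k. \<integral>x. grad \<psi> x \<bullet> (indicator \<Omega> x *\<^sub>R w k x) \<partial>lebesgue)
      \<longlonglongrightarrow> (\<integral>x. grad \<psi> x \<bullet> (indicator \<Omega> x *\<^sub>R m x) \<partial>lebesgue)"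
    proof (rule integral_dominated_convergence[where w="\<lambda>x. norm (grad \<psi> x)"])
      have "w k \<in> L2_on \<Omega>" for k
        using unit_field_in_L2_sphere[OF \<Omega> w(1)[of k] w(2)] by (simp add: L2_sphere_def)
      from square_integrable_inner[OF square_integrable_grad[OF \<psi>] this[unfolded L2_on_iff[OF \<Omega>s]]]
      show "(\<lambda>x. grad \<psi> x \<bullet> (indicator \<Omega> x *\<^sub>R w k x)) \<in> borel_measurable lebesgue" for k by auto
      from square_integrable_inner[OF square_integrable_grad[OF \<psi>] mL[unfolded L2_on_iff[OF \<Omega>s]]]
      show "(\<lambda>x. grad \<psi> x \<bullet> (indicator \<Omega> x *\<^sub>R m x)) \<in> borel_measurable lebesgue" by auto
      show "integrable lebesgue (\<lambda>x. norm (grad \<psi> x))"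
        by (rule integrable_lebesgue_continuous_compact_support[of _ R])
          (use R in \<open>auto intro!: continuous_intros c\<close>)
      show "AE x in lebesgue. (\<lambda>k. grad \<psi> x \<bullet> (indicator \<Omega> x *\<^sub>R w k x)) \<longlonglongrightarrow> grad \<psi> x \<bullet> (indicator \<Omega> x *\<^sub>R m x)"
        by (intro AE_I2 tendsto_intros lim)
      show "AE x in lebesgue. norm (grad \<psi> x \<bullet> (indicator \<Omega> x *\<^sub>R w k x)) \<le> norm (grad \<psi> x)" for k
      proof (rule AE_I2)
        fix x show "norm (grad \<psi> x \<bullet> (indicator \<Omega> x *\<^sub>R w k x)) \<le> norm (grad \<psi> x)"
          using Cauchy_Schwarz_ineq2[of "grad \<psi> x" "w k x"] w(2)[of k x] by (simp add: indicator_def)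
      qed
    qed
    then show ?thesis unfolding demag_lower_bound_def by (intro tendsto_intros)
  qed
  have ex: "exchange_energy \<Omega> j m \<le> ennreal (I - demag_lower_bound \<Omega> m \<psi>)" if \<psi>: "test_fun \<psi>" for \<psi>
  proof -
    have "exchange_energy \<Omega> j m \<le> (\<integral>\<^sup>+p. liminf (\<lambda>k. j (fst p - snd p) * ennreal ((norm (w k (fst p) - w k (snd p)))\<^sup>2))
        \<partial>(lebesgue_on \<Omega> \<Otimes>\<^sub>M lebesgue_on \<Omega>))"
      unfolding exchange_energy_altdef
    proof (rule nn_integral_mono)
      fix p :: "(real^3) \<times> (real^3)"
      let ?a = "\<lambda>k. ennreal ((norm (w k (fst p) - w k (snd p)))\<^sup>2)"
      have t: "?a \<longlonglongrightarrow> ennreal ((norm (m (fst p) - m (snd p)))\<^sup>2)"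
        by (intro tendsto_intros lim)
      \<comment> \<open>\<open>j\<close> may be infinite, and multiplication is not continuous at
        infinity times 0. If the limit values agree, the left side is 0; otherwise the second factor
        has a positive limit and the product converges.\<close>
      show "j (fst p - snd p) * ennreal ((norm (m (fst p) - m (snd p)))\<^sup>2) \<le> liminf (\<lambda>k. j (fst p - snd p) * ?a k)"
      proof (cases "m (fst p) = m (snd p)")
        case False
        then have "(\<lambda>k. j (fst p - snd p) * ?a k) \<longlonglongrightarrow> j (fst p - snd p) * ennreal ((norm (m (fst p) - m (snd p)))\<^sup>2)"
          by (intro tendsto_mult_ennreal tendsto_const t) auto
        then show ?thesis by (simp add: lim_imp_Liminf)
      qed simp
    qed
    also have "\<dots> \<le> liminf (\<lambda>k. exchange_energy \<Omega> j (w k))"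
      unfolding exchange_energy_altdef by (rule nn_integral_liminf) measurable
    also have "\<dots> \<le> liminf (\<lambda>k. ennreal (\<epsilon> k - demag_lower_bound \<Omega> (w k) \<psi>))"
      by (intro Liminf_mono always_eventually allI en[OF \<psi>])
    also have "\<dots> = ennreal (I - demag_lower_bound \<Omega> m \<psi>)"
      by (intro lim_imp_Liminf tendsto_intros \<epsilon> lb[OF \<psi>]) simp
    finally show ?thesis .
  qed
  \<comment> \<open>\<open>ennreal\<close> sends negative numbers to 0, so the sign of
    \<open>I - demag_lower_bound \<Omega> m \<psi>\<close> is needed to read \<open>ex\<close> as an
    inequality of reals.\<close>
  have le: "demag_lower_bound \<Omega> m \<psi> \<le> I" if "test_fun \<psi>" for \<psi>
    by (rule LIMSEQ_le[OF lb[OF that] \<epsilon>]) (use nonneg[OF that] in auto)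
  have fin: "exchange_energy \<Omega> j m < \<infinity>"
    using ex[OF test_fun_0] by (rule le_less_trans) simp
  with mS show "m \<in> X_space \<Omega> j" by (simp add: X_space_def)
  define E where "E = enn2real (exchange_energy \<Omega> j m)"
  have E: "exchange_energy \<Omega> j m = ennreal E" "E \<ge> 0" using fin by (auto simp: E_def)
  have "E + demag_energy \<Omega> m \<le> I"
  proof (rule field_le_epsilon)
    fix e :: real assume "e > 0"
    then obtain \<psi> where \<psi>: "test_fun \<psi>" "demag_energy \<Omega> m < demag_lower_bound \<Omega> m \<psi> + e"
      using demag_energy(3)[OF \<Omega>s mL] by blast
    have "E \<le> I - demag_lower_bound \<Omega> m \<psi>"
      using ex[OF \<psi>(1)] le[OF \<psi>(1)] unfolding E(1) by (simp add: ennreal_le_iff)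
    with \<psi>(2) show "E + demag_energy \<Omega> m \<le> I + e" by simp
  qed
  then show "micromag_energy \<Omega> j m \<le> ereal I"
    unfolding micromag_energy_eq[OF \<Omega>s mL] E(1) using E(2) by (simp add: enn2ereal_ennreal)
qed

theorem theorem2p9:
  fixes \<Omega> :: "(real^3) set" and j :: "real^3 \<Rightarrow> ennreal"
  assumes "open \<Omega>" and "connected \<Omega>" and "\<Omega> \<noteq> {}" and "bounded \<Omega>"
    and "j \<in> borel_measurable borel"
    and "\<And>z. j (- z) = j z"
    and "(\<integral>\<^sup>+ z. ennreal (min 1 ((norm z)\<^sup>2)) * j z \<partial>lebesgue) < \<infinity>"
    and "\<And>R. R > 0 \<Longrightarrow> (\<integral>\<^sup>+ z \<in> ball 0 R. j z \<partial>lebesgue) = \<infinity>"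
  shows "\<exists>m \<in> X_space \<Omega> j. \<forall>m' \<in> X_space \<Omega> j. micromag_energy \<Omega> j m \<le> micromag_energy \<Omega> j m'"
proof -
  have \<Omega>: "\<Omega> \<in> lmeasurable" using assms(1,4) by (simp add: lmeasurable_open)
  then have \<Omega>s: "\<Omega> \<in> sets lebesgue" by auto
  define I where "I = Inf (micromag_energy \<Omega> j ` X_space \<Omega> j)"
  \<comment> \<open>A constant unit field has zero exchange energy, so
    \<open>X_space \<Omega> j\<close> is nonempty and the infimum is finite.\<close>
  let ?c = "\<lambda>_::real^3. axis 1 1 :: real^3"
  have c1: "norm (?c x) = 1" for x by (simp add: norm_axis_1)
  have cL: "?c \<in> L2_sphere \<Omega>" by (rule unit_field_in_L2_sphere[OF \<Omega> _ c1]) simp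
  have cX: "?c \<in> X_space \<Omega> j" using cL by (simp add: X_space_def exchange_energy_altdef)
  have pos: "m \<in> L2_on \<Omega> \<and> exchange_energy \<Omega> j m < \<infinity>
      \<and> micromag_energy \<Omega> j m = ereal (enn2real (exchange_energy \<Omega> j m) + demag_energy \<Omega> m)"
    if "m \<in> X_space \<Omega> j" for m
  proof -
    have m: "m \<in> L2_on \<Omega>" "exchange_energy \<Omega> j m < \<infinity>"
      using that by (auto simp: X_space_def L2_sphere_def)
    have "enn2ereal (exchange_energy \<Omega> j m) = ereal (enn2real (exchange_energy \<Omega> j m))"
      using m(2) by (metis enn2ereal_ennreal enn2real_nonneg ennreal_enn2real infinity_ennreal_def)
    then show ?thesis using m by (simp add: micromag_energy_eq[OF \<Omega>s])
  qed
  have I0: "0 \<le> I"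
    unfolding I_def using pos demag_energy_nonneg by (intro Inf_greatest) (auto simp del: plus_ereal.simps)
  have "I \<le> micromag_energy \<Omega> j ?c" unfolding I_def using cX by (intro Inf_lower) auto
  also have "\<dots> < \<infinity>" using pos[OF cX] by simp
  finally have "I < \<infinity>" .
  with I0 obtain I' where I': "I = ereal I'" by (cases I) auto
  obtain e where e: "\<And>n::nat. e n \<in> micromag_energy \<Omega> j ` X_space \<Omega> j" "e \<longlonglongrightarrow> I"
    using Inf_as_limit[of "micromag_energy \<Omega> j ` X_space \<Omega> j"] cX unfolding I_def by blast
  have "\<forall>n. \<exists>v. v \<in> X_space \<Omega> j \<and> e n = micromag_energy \<Omega> j v" using e(1) by blast
  then obtain v0 where v0: "\<And>n. v0 n \<in> X_space \<Omega> j" "\<And>n. e n = micromag_energy \<Omega> j (v0 n)"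
    by metis
  have "\<forall>\<^sub>F n in sequentially. e n < ereal (I' + 1)" using e(2) by (rule order_tendstoD(2)) (simp add: I')
  then obtain N where N: "\<And>n. n \<ge> N \<Longrightarrow> e n < ereal (I' + 1)" by (auto simp: eventually_sequentially)
  \<comment> \<open>Dropping the first \<open>N\<close> members makes \<open>I' + 1\<close> a bound
    for all the energies, as the compactness argument requires.\<close>
  define v where "v n = v0 (n + N)" for n
  have v: "v n \<in> X_space \<Omega> j" for n using v0 by (simp add: v_def)
  have vm: "v n \<in> borel_measurable (lebesgue_on \<Omega>)" and vL: "v n \<in> L2_on \<Omega>"
    and vS: "AE x in lebesgue_on \<Omega>. v n x \<in> sphere 0 1" for n
    using v[of n] by (auto simp: X_space_def L2_sphere_def L2_on_def)
  define \<epsilon> where "\<epsilon> n = enn2real (exchange_energy \<Omega> j (v n)) + demag_energy \<Omega> (v n)" for n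
  have \<epsilon>e: "ereal (\<epsilon> n) = e (n + N)" for n
    using pos[OF v[of n]] v0(2)[of "n + N"] by (simp add: \<epsilon>_def v_def)
  have \<epsilon>: "\<epsilon> \<longlonglongrightarrow> I'"
    using LIMSEQ_ignore_initial_segment[OF e(2), of N] unfolding \<epsilon>e[symmetric] I' by simp
  have \<epsilon>1: "\<epsilon> n < I' + 1" for n using N[of "n + N"] unfolding \<epsilon>e[symmetric] by simp
  have exv: "exchange_energy \<Omega> j (v n) = ennreal (\<epsilon> n - demag_energy \<Omega> (v n))" for n
    using pos[OF v[of n]] by (simp add: \<epsilon>_def)
  \<comment> \<open>The default \<open>axis 1 1\<close>, off \<open>\<Omega>\<close> and where the
    constraint fails, gives length 1 at every point; the compactness argument asks for its bound at
    all \<open>x\<close>. On \<open>\<Omega>\<close> this changes only a null set.\<close>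
  define u where "u n x = (if x \<in> \<Omega> \<and> norm (v n x) = 1 then v n x else axis 1 1)" for n x
  have u1: "norm (u n x) = 1" for n x by (simp add: u_def norm_axis_1)
  have um: "u n \<in> borel_measurable (lebesgue_on \<Omega>)" for n
  proof -
    note [measurable] = vm[of n]
    have "(\<lambda>x. if norm (v n x) = 1 then v n x else axis 1 1) \<in> borel_measurable (lebesgue_on \<Omega>)" by measurable
    then show ?thesis by (subst measurable_cong[where g="\<lambda>x. if norm (v n x) = 1 then v n x else axis 1 1"]) (auto simp: u_def)
  qed
  have uv: "AE x in lebesgue_on \<Omega>. u n x = v n x" for n
    using vS[of n] AE_space[of "lebesgue_on \<Omega>"] by eventually_elim (auto simp: u_def)
  have exu: "exchange_energy \<Omega> j (u n) = exchange_energy \<Omega> j (v n)" for n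
    by (rule exchange_energy_cong_AE[OF \<Omega> assms(5) um vm uv])
  have C: "exchange_energy \<Omega> j (u n) \<le> ennreal (I' + 1)" for n
    unfolding exu exv using \<epsilon>1[of n] demag_energy_nonneg[of \<Omega> "v n"] by (intro ennreal_leI) simp
  have I'0: "I' + 1 \<ge> 0" using I0 I' by simp
  obtain r :: "nat \<Rightarrow> nat" where r: "strict_mono r" "AE x in lebesgue_on \<Omega>. convergent (\<lambda>k. u (r k) x)"
    by (rule nonintegrable_kernel_compactness[where u=u, OF assms(1,4,5,8) um _ C I'0])
      (use u1 in \<open>auto intro: that\<close>)
  obtain Z where Z: "Z \<in> null_sets (lebesgue_on \<Omega>)" "{x \<in> space (lebesgue_on \<Omega>). \<not> convergent (\<lambda>k. u (r k) x)} \<subseteq> Z"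
    using r(2) by (auto elim!: AE_E simp: null_sets_def)
  \<comment> \<open>A second change on a null set: on \<open>Z\<close> and off
    \<open>\<Omega>\<close> the sequence is constant, so it converges at every point and
    \<open>lim\<close> is a true limit everywhere.\<close>
  define w where "w k x = (if x \<in> \<Omega> - Z then u (r k) x else axis 1 1)" for k x
  have w1: "norm (w k x) = 1" for k x by (simp add: w_def u1 norm_axis_1)
  have wm: "w k \<in> borel_measurable (lebesgue_on \<Omega>)" for k
  proof -
    note [measurable] = um[of "r k"]
    have [measurable]: "Z \<in> sets (lebesgue_on \<Omega>)" using Z(1) by auto
    have "(\<lambda>x. if x \<in> Z then axis 1 1 else u (r k) x) \<in> borel_measurable (lebesgue_on \<Omega>)" by measurable
    then show ?thesis by (subst measurable_cong[where g="\<lambda>x. if x \<in> Z then axis 1 1 else u (r k) x"]) (auto simp: w_def)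
  qed
  have wu: "AE x in lebesgue_on \<Omega>. w k x = u (r k) x" for k
    using AE_not_in[OF Z(1)] AE_space[of "lebesgue_on \<Omega>"] by eventually_elim (auto simp: w_def)
  have wv: "AE x in lebesgue_on \<Omega>. w k x = v (r k) x" for k
    using wu[of k] uv[of "r k"] by eventually_elim simp
  have wL: "w k \<in> L2_on \<Omega>" for k
    using unit_field_in_L2_sphere[OF \<Omega> wm w1] by (simp add: L2_sphere_def)
  have "convergent (\<lambda>k. w k x)" for x
    using Z(2) by (cases "x \<in> \<Omega> - Z") (auto simp: w_def convergent_const)
  then have lim: "(\<lambda>k. w k x) \<longlonglongrightarrow> lim (\<lambda>k. w k x)" for x by (simp add: convergent_LIMSEQ_iff)
  \<comment> \<open>Only the lower bounds are carried from \<open>v (r k)\<close> to its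
    modification \<open>w k\<close>; the energies remain those of \<open>v (r k)\<close>, so the
    fields chosen for the two representatives are never compared.\<close>
  have lbw: "demag_lower_bound \<Omega> (w k) \<psi> \<le> demag_energy \<Omega> (v (r k))" if "test_fun \<psi>" for k \<psi>
    unfolding demag_lower_bound_cong_AE[OF \<Omega>s wv wL vL that] by (rule demag_energy(2)[OF \<Omega>s vL that])
  have en: "exchange_energy \<Omega> j (w k) \<le> ennreal (\<epsilon> (r k) - demag_lower_bound \<Omega> (w k) \<psi>)" if "test_fun \<psi>" for k \<psi>
    unfolding exchange_energy_cong_AE[OF \<Omega> assms(5) wm vm wv] exv
    using lbw[OF that, of k] by (intro ennreal_leI) simp
  have nn: "demag_lower_bound \<Omega> (w k) \<psi> \<le> \<epsilon> (r k)" if "test_fun \<psi>" for k \<psi>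
    using lbw[OF that, of k] unfolding \<epsilon>_def by (simp add: add_increasing)
  have \<epsilon>r: "(\<lambda>k. \<epsilon> (r k)) \<longlonglongrightarrow> I'" using LIMSEQ_subseq_LIMSEQ[OF \<epsilon> r(1)] by (simp add: comp_def)
  show ?thesis
  proof (intro bexI ballI)
    show "(\<lambda>x. lim (\<lambda>k. w k x)) \<in> X_space \<Omega> j"
      by (rule energy_lower_semicontinuous(1)[OF \<Omega> assms(5) wm w1 lim en \<epsilon>r nn])
    fix m' assume m': "m' \<in> X_space \<Omega> j"
    have "micromag_energy \<Omega> j (\<lambda>x. lim (\<lambda>k. w k x)) \<le> I"
      unfolding I' by (rule energy_lower_semicontinuous(2)[OF \<Omega> assms(5) wm w1 lim en \<epsilon>r nn])
    also have "I \<le> micromag_energy \<Omega> j m'" unfolding I_def using m' by (intro Inf_lower) auto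
    finally show "micromag_energy \<Omega> j (\<lambda>x. lim (\<lambda>k. w k x)) \<le> micromag_energy \<Omega> j m'" .
  qed
qed

end
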